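(* Let $X$ and $Y$ be real-valued random variables with $Y$ not almost surely a constant, let $(X_1,Y_1),(X_2,Y_2),\ldots$ be i.i.d. pairs with the same law as $(X,Y)$, and let $\xi_n(X,Y)$ be the coefficient computed from $(X_1,Y_1),\ldots,(X_n,Y_n)$ as defined in the context. Suppose that $X$ and $Y$ are independent. Then $\sqrt{n}\,\xi_n(X,Y)$ converges to $N(0,\tau^2)$ in distribution as $n\to\infty$, where \[ \tau^2 = \frac{\mathbb{E}\,\phi(Y_1,Y_2)^2 - 2\,\mathbb{E}\big(\phi(Y_1,Y_2)\phi(Y_1,Y_3)\big) + \big(\mathbb{E}\,\phi(Y_1,Y_2)\big)^2}{\big(\mathbb{E}\, G(Y)(1-G(Y))\big)^2}, \] with $F(t):=\mathbb{P}(Y\le t)$, $G(t):=\mathbb{P}(Y\ge t)$ and $\phi(y,y'):=\min\{F(y),F(y')\}$. The number $\tau^2$ is strictly positive if $Y$ is not a constant, and equals $2/5$ if $Y$ is continuous (i.e. has a continuous cumulative distribution function).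
   Context: Definition of $\xi_n(X,Y)$ for $n\ge 2$: rearrange the data as $(X_{(1)},Y_{(1)}),\ldots,(X_{(n)},Y_{(n)})$ so that $X_{(1)}\le\cdots\le X_{(n)}$; if there are ties among the $X_i$'s, the increasing rearrangement is chosen uniformly at random among all increasing rearrangements (given the data). Let $r_i$ be the number of $j$ such that $Y_{(j)}\le Y_{(i)}$ and let $l_i$ be the number of $j$ such that $Y_{(j)}\ge Y_{(i)}$. Then \[ \xi_n(X,Y) := 1-\frac{n\sum_{i=1}^{n-1}|r_{i+1}-r_i|}{2\sum_{i=1}^n l_i(n-l_i)}. \] The denominator vanishes only when $Y_1=\cdots=Y_n$; in that case $\xi_n$ may be assigned an arbitrary value. *)

theory Defs
  imports "HOL-Probability.Probability"
begin

text \<open>Samples are indexed by \<open>1, \<dots>, n\<close>. An increasing rearrangement of \<open>x\<^sub>1, \<dots>, x\<^sub>n\<close> is given by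
  a permutation \<open>p\<close> of the indices, the rearranged sample being \<open>i \<mapsto> x (p i)\<close>.\<close>

definition increasing_rearrangements :: "nat \<Rightarrow> (nat \<Rightarrow> real) \<Rightarrow> (nat \<Rightarrow> nat) set" where
  "increasing_rearrangements n x = {p. p permutes {1..n} \<and> mono_on {1..n} (\<lambda>i. x (p i))}"

definition rank_le :: "nat \<Rightarrow> (nat \<Rightarrow> real) \<Rightarrow> nat \<Rightarrow> nat" where
  "rank_le n v i = card {j \<in> {1..n}. v j \<le> v i}"

definition rank_ge :: "nat \<Rightarrow> (nat \<Rightarrow> real) \<Rightarrow> nat \<Rightarrow> nat" where
  "rank_ge n v i = card {j \<in> {1..n}. v j \<ge> v i}"

text \<open>The coefficient \<open>\<xi>\<^sub>n\<close>, where \<open>p\<close> is the chosen increasing rearrangement of the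
  \<open>x\<close>-sample and \<open>c\<close> is the arbitrary value assigned if the denominator vanishes.\<close>

definition xi :: "real \<Rightarrow> nat \<Rightarrow> (nat \<Rightarrow> nat) \<Rightarrow> (nat \<Rightarrow> real) \<Rightarrow> real" where
  "xi c n p y =
    (let v = (\<lambda>i. y (p i)); r = (\<lambda>i. real (rank_le n v i)); l = (\<lambda>i. real (rank_ge n v i));
         d = 2 * (\<Sum>i=1..n. l i * (real n - l i))
     in if d = 0 then c else 1 - real n * (\<Sum>i=1..n-1. \<bar>r (i + 1) - r i\<bar>) / d)"

definition sample_sigma_algebra ::
  "'a measure \<Rightarrow> nat \<Rightarrow> (nat \<Rightarrow> 'a \<Rightarrow> real) \<Rightarrow> (nat \<Rightarrow> 'a \<Rightarrow> real) \<Rightarrow> 'a measure" where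
  "sample_sigma_algebra M n Xs Ys =
    vimage_algebra (space M) (\<lambda>\<omega>. \<lambda>i\<in>{1..n}. (Xs i \<omega>, Ys i \<omega>)) (PiM {1..n} (\<lambda>_. borel \<Otimes>\<^sub>M borel))"

text \<open>The random permutation \<open>\<sigma>\<close> is, conditionally on \<open>(X\<^sub>1, Y\<^sub>1), \<dots>, (X\<^sub>n, Y\<^sub>n)\<close>, uniformly
  distributed on the (finite, nonempty) set of increasing rearrangements of \<open>X\<^sub>1, \<dots>, X\<^sub>n\<close>.\<close>

definition uniform_rearrangement ::
  "'a measure \<Rightarrow> nat \<Rightarrow> (nat \<Rightarrow> 'a \<Rightarrow> real) \<Rightarrow> (nat \<Rightarrow> 'a \<Rightarrow> real) \<Rightarrow> ('a \<Rightarrow> nat \<Rightarrow> nat) \<Rightarrow> bool" where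
  "uniform_rearrangement M n Xs Ys \<sigma> \<longleftrightarrow>
    \<sigma> \<in> measurable M (count_space {p. p permutes {1..n}}) \<and>
    (\<forall>p. p permutes {1..n} \<longrightarrow>
      (AE \<omega> in M. real_cond_exp M (sample_sigma_algebra M n Xs Ys)
                      (indicator {\<omega> \<in> space M. \<sigma> \<omega> = p}) \<omega>
                  = pmf (pmf_of_set (increasing_rearrangements n (\<lambda>i. Xs i \<omega>))) p))"

definition F_of :: "'a measure \<Rightarrow> ('a \<Rightarrow> real) \<Rightarrow> real \<Rightarrow> real" where
  "F_of M Y t = measure M {\<omega> \<in> space M. Y \<omega> \<le> t}"

definition G_of :: "'a measure \<Rightarrow> ('a \<Rightarrow> real) \<Rightarrow> real \<Rightarrow> real" where
  "G_of M Y t = measure M {\<omega> \<in> space M. Y \<omega> \<ge> t}"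

definition phi :: "'a measure \<Rightarrow> ('a \<Rightarrow> real) \<Rightarrow> real \<Rightarrow> real \<Rightarrow> real" where
  "phi M Y y y' = min (F_of M Y y) (F_of M Y y')"

definition tau_sq :: "'a measure \<Rightarrow> ('a \<Rightarrow> real) \<Rightarrow> (nat \<Rightarrow> 'a \<Rightarrow> real) \<Rightarrow> real" where
  "tau_sq M Y Ys =
    ((\<integral>\<omega>. (phi M Y (Ys 1 \<omega>) (Ys 2 \<omega>))\<^sup>2 \<partial>M)
      - 2 * (\<integral>\<omega>. phi M Y (Ys 1 \<omega>) (Ys 2 \<omega>) * phi M Y (Ys 1 \<omega>) (Ys 3 \<omega>) \<partial>M)
      + (\<integral>\<omega>. phi M Y (Ys 1 \<omega>) (Ys 2 \<omega>) \<partial>M)\<^sup>2)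
    / (\<integral>\<omega>. G_of M Y (Y \<omega>) * (1 - G_of M Y (Y \<omega>)) \<partial>M)\<^sup>2"

end

theory Submission
  imports Defs "HOL-Real_Asymp.Real_Asymp"
begin

text \<open>
  Write \<open>G z = P (Y \<ge> z)\<close> and \<open>e x z = [z \<le> x] - G z\<close>. The absolute rank difference of two neighbours
  is a sum over \<open>l\<close> of squared differences of the indicators \<open>[Y\<^sub>l \<le> Y\<^sub>i]\<close>, and \<open>l\<^sub>l (n - l\<^sub>l)\<close> is \<open>n\<^sup>2\<close> times the
  empirical variance of \<open>[Y\<^sub>l \<le> Y\<^sub>1], \<dots>, [Y\<^sub>l \<le> Y\<^sub>n]\<close>. Both are unchanged if a number depending on \<open>l\<close> only is
  subtracted from all indicators. Subtracting \<open>G (Y\<^sub>l)\<close> gives, with \<open>e\<^sub>i = e (Y\<^sub>i) (Y\<^sub>l)\<close>, the exact identity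

  \<open>2 \<Sum>\<^sub>i l\<^sub>i (n - l\<^sub>i) - n \<Sum>\<^sub>i \<bar>r\<^sub>i\<^sub>+\<^sub>1 - r\<^sub>i\<bar> = \<Sum>\<^sub>l (2 n \<Sum>\<^sub>i e\<^sub>i e\<^sub>i\<^sub>+\<^sub>1 + n (e\<^sub>1\<^sup>2 + e\<^sub>n\<^sup>2) - 2 (\<Sum>\<^sub>j e\<^sub>j)\<^sup>2)\<close>

  (\<open>rank_identity\<close>), in which the first-order terms of the Hoeffding decomposition have cancelled.

  Since the \<open>e\<^sub>i\<close> are centred given \<open>Y\<^sub>l\<close>, the last two summands are negligible after division by \<open>n\<^sup>2 \<surd>n\<close>.
  In the first one the average over \<open>l\<close> may be replaced by an integral: the error is a sum of
  terms \<open>\<rho>\<close>, almost all pairs of which are orthogonal (\<open>\<rho>_sum_second_moment\<close>). What remains is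
  \<open>2 n\<^sup>2 \<Sum>\<^sub>i \<psi> (Y\<^sub>i) (Y\<^sub>i\<^sub>+\<^sub>1)\<close> with the kernel \<open>\<psi> x y = E (e x Y * e y Y)\<close>. This kernel is degenerate, that is,
  \<open>E (\<psi> x Y) = 0\<close>, so the summands \<open>D\<^sub>j\<close> are bounded martingale differences, and their central limit
  theorem follows from McLeish's argument: the products of the factors \<open>1 + i t D\<^sub>j / \<surd>n\<close> are bounded and have
  expectation one, and the exponential of \<open>i t \<Sum>\<^sub>j D\<^sub>j / \<surd>n\<close> is such a product times a factor that converges to
  the Gaussian characteristic function (\<open>char_kernel_sum_estimate\<close>).
  The normalised denominator converges in \<open>L\<^sup>2\<close> to \<open>E (G (Y) (1 - G (Y)))\<close>, and the two limits are
  combined on the level of characteristic functions (\<open>char_xi_tendsto\<close>).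

  This treats the sample in its given order. The conditional law of the tie-breaking permutation given the data
  is a function of the \<open>X\<^sub>i\<close> alone. If \<open>X\<close> and \<open>Y\<close> are independent, the permutation is therefore independent of
  the \<open>Y\<^sub>i\<close>, and since an i.i.d. vector is exchangeable, permuting it leaves the law of the coefficient
  unchanged (\<open>uniform_rearrangement_indep\<close>, \<open>law_rearranged_statistic\<close>).

  Finally, \<open>\<psi> x y\<close> is \<open>\<phi> x y\<close> minus its two marginal means plus its total mean, so the second moment of \<open>\<psi>\<close> is
  the numerator of \<open>\<tau>\<^sup>2\<close>. It is positive because the integral of \<open>\<psi>\<close> over the event that both arguments exceed
  \<open>t\<close> is positive for any \<open>t\<close> with \<open>0 < P (Y \<le> t) < 1\<close> (\<open>kernel_variance_pos\<close>). For a continuous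
  distribution function \<open>F\<close>, the variable \<open>F (Y)\<close> is uniform and the moments are elementary integrals.
\<close>

section \<open>Moment bounds and characteristic functions\<close>

lemma (in prob_space) integrable_bounded:
  fixes f :: "'a \<Rightarrow> 'b::{banach, second_countable_topology}"
  assumes "f \<in> borel_measurable M" and "\<And>x. norm (f x) \<le> C"
  shows "integrable M f"
  using assms by (intro integrable_const_bound[of _ C]) auto

lemma (in prob_space) abs_expectation_le:
  fixes f :: "'a \<Rightarrow> real"
  assumes "f \<in> borel_measurable M" and "\<And>x. \<bar>f x\<bar> \<le> C"
  shows "\<bar>\<integral>x. f x \<partial>M\<bar> \<le> C"
proof -
  have i: "integrable M f" using assms by (intro integrable_bounded[of _ C]) auto
  have "\<bar>\<integral>x. f x \<partial>M\<bar> \<le> (\<integral>x. \<bar>f x\<bar> \<partial>M)" by (rule integral_abs_bound)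
  also have "\<dots> \<le> (\<integral>x. C \<partial>M)" using i assms(2) by (intro integral_mono) auto
  finally show ?thesis by (simp add: prob_space)
qed

text \<open>A sum of \<open>N\<close> uniformly bounded variables has second moment of order \<open>N\<close> as soon as each of them
  is orthogonal to all but boundedly many others; \<open>Q a\<close> collects the possible exceptions for \<open>a\<close>.\<close>

lemma (in prob_space) second_moment_sum_le:
  fixes Z :: "'i \<Rightarrow> 'a \<Rightarrow> real"
  assumes "finite I"
    and [measurable]: "\<And>a. a \<in> I \<Longrightarrow> Z a \<in> borel_measurable M"
    and bd: "\<And>a \<omega>. a \<in> I \<Longrightarrow> \<bar>Z a \<omega>\<bar> \<le> C"
    and Q: "\<And>a. a \<in> I \<Longrightarrow> finite (Q a) \<and> card (Q a) \<le> m"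
    and orth: "\<And>a b. a \<in> I \<Longrightarrow> b \<in> I \<Longrightarrow> b \<notin> Q a \<Longrightarrow> (\<integral>\<omega>. Z a \<omega> * Z b \<omega> \<partial>M) = 0"
  shows "(\<integral>\<omega>. (\<Sum>a\<in>I. Z a \<omega>)\<^sup>2 \<partial>M) \<le> real m * C\<^sup>2 * real (card I)"
proof -
  have prod_bd: "\<bar>Z a \<omega> * Z b \<omega>\<bar> \<le> C\<^sup>2" if "a \<in> I" "b \<in> I" for a b \<omega>
    using mult_mono[OF bd[OF that(1)] bd[OF that(2)], of \<omega> \<omega>] bd[OF that(1), of \<omega>]
    by (auto simp: abs_mult power2_eq_square)
  have int: "integrable M (\<lambda>\<omega>. Z a \<omega> * Z b \<omega>)" if "a \<in> I" "b \<in> I" for a b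
    using that prod_bd[OF that] by (intro integrable_bounded[of _ "C\<^sup>2"]) auto
  have "(\<integral>\<omega>. (\<Sum>a\<in>I. Z a \<omega>)\<^sup>2 \<partial>M) = (\<integral>\<omega>. (\<Sum>a\<in>I. \<Sum>b\<in>I. Z a \<omega> * Z b \<omega>) \<partial>M)"
    by (simp add: power2_eq_square sum_product)
  also have "\<dots> = (\<Sum>a\<in>I. \<Sum>b\<in>I. (\<integral>\<omega>. Z a \<omega> * Z b \<omega> \<partial>M))"
    by (simp add: int)
  also have "\<dots> \<le> (\<Sum>a\<in>I. real m * C\<^sup>2)"
  proof (rule sum_mono)
    fix a assume a: "a \<in> I"
    have "(\<Sum>b\<in>I. (\<integral>\<omega>. Z a \<omega> * Z b \<omega> \<partial>M)) = (\<Sum>b\<in>I \<inter> Q a. (\<integral>\<omega>. Z a \<omega> * Z b \<omega> \<partial>M))"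
      using orth[OF a] \<open>finite I\<close> by (intro sum.mono_neutral_right) auto
    also have "\<dots> \<le> (\<Sum>b\<in>I \<inter> Q a. C\<^sup>2)"
    proof (rule sum_mono)
      fix b assume b: "b \<in> I \<inter> Q a"
      have "\<bar>\<integral>\<omega>. Z a \<omega> * Z b \<omega> \<partial>M\<bar> \<le> C\<^sup>2"
        using a b prod_bd by (intro abs_expectation_le) auto
      then show "(\<integral>\<omega>. Z a \<omega> * Z b \<omega> \<partial>M) \<le> C\<^sup>2" by simp
    qed
    also have "\<dots> = real (card (I \<inter> Q a)) * C\<^sup>2" by simp
    also have "\<dots> \<le> real m * C\<^sup>2"
      using Q[OF a] card_mono[of "Q a" "I \<inter> Q a"] by (intro mult_right_mono) auto
    finally show "(\<Sum>b\<in>I. (\<integral>\<omega>. Z a \<omega> * Z b \<omega> \<partial>M)) \<le> real m * C\<^sup>2" .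
  qed
  finally show ?thesis by (simp add: mult_ac)
qed

lemma (in prob_space) square_expectation_le:
  fixes X :: "'a \<Rightarrow> real"
  assumes [measurable]: "X \<in> borel_measurable M" and bd: "\<And>x. \<bar>X x\<bar> \<le> C"
  shows "(\<integral>x. X x \<partial>M)\<^sup>2 \<le> (\<integral>x. (X x)\<^sup>2 \<partial>M)"
proof -
  have "\<bar>(X x)\<^sup>2\<bar> \<le> C\<^sup>2" for x
    using power_mono[OF bd[of x], of 2] by simp
  then have "integrable M (\<lambda>x. (X x)\<^sup>2)" "integrable M X"
    using bd by (auto intro: integrable_bounded[of _ "C\<^sup>2"] integrable_bounded[of _ C])
  then have "variance X = (\<integral>x. (X x)\<^sup>2 \<partial>M) - (\<integral>x. X x \<partial>M)\<^sup>2" by (intro variance_eq)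
  then show ?thesis using variance_positive[of X] by simp
qed

lemma (in prob_space) expectation_abs_le_sqrt:
  fixes X :: "'a \<Rightarrow> real"
  assumes [measurable]: "X \<in> borel_measurable M" and bd: "\<And>x. \<bar>X x\<bar> \<le> C"
    and le: "(\<integral>x. (X x)\<^sup>2 \<partial>M) \<le> v"
  shows "(\<integral>x. \<bar>X x\<bar> \<partial>M) \<le> sqrt v"
proof (rule real_le_rsqrt)
  have "(\<integral>x. \<bar>X x\<bar> \<partial>M)\<^sup>2 \<le> (\<integral>x. \<bar>X x\<bar>\<^sup>2 \<partial>M)"
    using bd by (intro square_expectation_le[of _ C]) auto
  then show "(\<integral>x. \<bar>X x\<bar> \<partial>M)\<^sup>2 \<le> v" using le by simp
qed

lemma cmod_iexp_diff_le: "cmod (iexp x - iexp y) \<le> \<bar>x - y\<bar>"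
proof -
  have "cmod (iexp x - iexp y) = cmod (iexp y) * cmod (iexp (x - y) - 1)"
    unfolding norm_mult[symmetric] by (simp add: algebra_simps flip: exp_add)
  also have "\<dots> \<le> \<bar>x - y\<bar>" using iexp_approx1[of "x - y" 0] by simp
  finally show ?thesis .
qed

lemma abs_exp_neg_diff_le:
  fixes u v :: real
  assumes "0 \<le> u" "0 \<le> v"
  shows "\<bar>exp (- u) - exp (- v)\<bar> \<le> \<bar>u - v\<bar>"
proof -
  have *: "exp (- u) - exp (- v) \<le> v - u" if "0 \<le> u" "u \<le> v" for u v :: real
  proof -
    have "exp (- u) - exp (- v) = exp (- u) * (1 - exp (u - v))" by (simp add: algebra_simps flip: exp_add)
    also have "\<dots> \<le> 1 * (v - u)"
    proof (intro mult_mono)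
      show "1 - exp (u - v) \<le> v - u" using exp_ge_add_one_self[of "u - v"] by linarith
    qed (use that in auto)
    finally show ?thesis by simp
  qed
  show ?thesis
    using *[of u v] *[of v u] assms by (cases "u \<le> v") (auto simp: abs_if)
qed

lemma cmod_one_plus_imaginary: "cmod (1 + \<i> * complex_of_real x) \<le> exp (x\<^sup>2 / 2)"
proof -
  have "cmod (1 + \<i> * complex_of_real x) = sqrt (1 + x\<^sup>2)"
    by (simp add: cmod_def)
  also have "\<dots> \<le> sqrt (exp (x\<^sup>2))"
    using exp_ge_add_one_self[of "x\<^sup>2"] by simp
  also have "sqrt (exp (x\<^sup>2)) = exp (x\<^sup>2 / 2)"
    by (rule real_sqrt_unique) (simp_all add: power2_eq_square flip: exp_add)
  finally show ?thesis .
qed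

text \<open>The comparison of factors in McLeish's argument. The linear factor carries the martingale
  property, the real exponential carries the quadratic variation, and their product agrees with
  \<open>iexp x\<close> up to third order.\<close>

lemma iexp_approx_one_plus_imaginary:
  "cmod (iexp x - (1 + \<i> * complex_of_real x) * complex_of_real (exp (- (x\<^sup>2 / 2)))) \<le> 2 * \<bar>x\<bar> ^ 3"
proof (cases "\<bar>x\<bar> \<le> 1")
  case True
  define r where "r = exp (- (x\<^sup>2 / 2)) - (1 - x\<^sup>2 / 2)"
  have r: "\<bar>r\<bar> \<le> x ^ 4 / 4"
  proof -
    have "0 \<le> r" using exp_ge_add_one_self[of "- (x\<^sup>2/2)"] by (simp add: r_def)
    moreover have "r \<le> (x\<^sup>2 / 2)\<^sup>2"
    proof -
      have "exp (- (x\<^sup>2/2)) = 1 / exp (x\<^sup>2/2)" by (simp add: exp_minus field_simps)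
      also have "\<dots> \<le> 1 / (1 + x\<^sup>2/2)"
        by (intro divide_left_mono exp_ge_add_one_self mult_pos_pos) (auto intro: add_pos_nonneg)
      also have "\<dots> \<le> 1 - x\<^sup>2/2 + (x\<^sup>2/2)\<^sup>2"
      proof -
        have p: "0 \<le> x\<^sup>2 / 2" by simp
        have "1 \<le> (1 - y + y\<^sup>2) * (1 + y)" if "0 \<le> y" for y :: real
        proof -
          have "(1 - y + y\<^sup>2) * (1 + y) = 1 + y^3" by algebra
          then show ?thesis using that by simp
        qed
        from this[OF p] show ?thesis by (subst pos_divide_le_eq) (auto intro: add_pos_nonneg)
      qed
      finally show ?thesis by (simp add: r_def)
    qed
    ultimately show ?thesis by (simp add: power_divide flip: power_mult)
  qed
  define E A B where "E = iexp x - (\<Sum>k \<le> 2. (\<i> * x)^k / fact k)"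
    and "A = \<i> * complex_of_real (x ^ 3 / 2)"
    and "B = (1 + \<i> * complex_of_real x) * complex_of_real r"
  have E: "cmod E \<le> \<bar>x\<bar>^3 / 6"
    using iexp_approx1[of x 2] by (simp add: E_def eval_nat_numeral)
  have A: "cmod A \<le> \<bar>x\<bar> ^ 3 / 2"
    by (simp add: A_def norm_mult norm_divide norm_power)
  have B: "cmod B \<le> 2 * (\<bar>x\<bar> ^ 3 / 4)"
  proof -
    have "cmod (1 + \<i> * complex_of_real x) \<le> 2"
      using norm_triangle_ineq[of 1 "\<i> * complex_of_real x"] True by (simp add: norm_mult)
    moreover have "\<bar>r\<bar> \<le> \<bar>x\<bar>^3 / 4"
    proof -
      have "x ^ 4 = \<bar>x\<bar> ^ 3 * \<bar>x\<bar>" by (simp add: power_eq_if abs_mult[symmetric] mult.assoc)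
      also have "\<dots> \<le> \<bar>x\<bar> ^ 3" using True by (simp add: mult_left_le)
      finally show ?thesis using r by simp
    qed
    ultimately show ?thesis
      unfolding B_def norm_mult norm_of_real by (intro mult_mono) auto
  qed
  have "iexp x - (1 + \<i> * complex_of_real x) * complex_of_real (exp (- (x\<^sup>2 / 2))) = E + (A - B)"
    unfolding E_def A_def B_def r_def
    by (simp add: eval_nat_numeral field_simps)
  also have "cmod \<dots> \<le> cmod E + (cmod A + cmod B)"
    by (intro order.trans[OF norm_triangle_ineq] add_left_mono norm_triangle_ineq4)
  also have "\<dots> \<le> \<bar>x\<bar>^3 / 6 + (\<bar>x\<bar>^3 / 2 + 2 * (\<bar>x\<bar>^3 / 4))"
    using E A B by (intro add_mono)
  finally show ?thesis using zero_le_power[OF abs_ge_zero[of x], of 3] by linarith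
next
  case False
  have "cmod ((1 + \<i> * complex_of_real x) * complex_of_real (exp (- (x\<^sup>2 / 2)))) \<le> 1"
    using mult_right_mono[OF cmod_one_plus_imaginary[of x], of "exp (- (x\<^sup>2 / 2))"]
    by (simp add: norm_mult flip: exp_add)
  then have "cmod (iexp x - (1 + \<i> * complex_of_real x) * complex_of_real (exp (- (x\<^sup>2 / 2)))) \<le> 1 + 1"
    by (intro order.trans[OF norm_triangle_ineq4] add_mono) auto
  also have "\<dots> \<le> 2 * \<bar>x\<bar> ^ 3" using False one_le_power[of "\<bar>x\<bar>" 3] by simp
  finally show ?thesis .
qed

lemma char_normal:
  assumes "\<tau> > 0"
  shows "real_distribution (density lborel (normal_density 0 \<tau>))"
    and "char (density lborel (normal_density 0 \<tau>)) t = complex_of_real (exp (- (\<tau> * t)\<^sup>2 / 2))"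
proof -
  interpret S: real_distribution std_normal_distribution by (rule real_dist_normal_dist)
  have "distributed std_normal_distribution lborel (\<lambda>x. x) std_normal_density"
    unfolding distributed_def using distr_id2[of lborel std_normal_distribution] by simp
  then have "distributed std_normal_distribution lborel (\<lambda>x. 0 + \<tau> * x) (normal_density (0 + \<tau> * 0) (\<bar>\<tau>\<bar> * 1))"
    using assms by (intro S.normal_density_affine) auto
  then have "distr std_normal_distribution lborel (\<lambda>x. \<tau> * x) = density lborel (normal_density 0 \<tau>)"
    using assms by (simp add: distributed_def)
  moreover have "distr std_normal_distribution lborel (\<lambda>x. \<tau> * x) = distr std_normal_distribution borel (\<lambda>x. \<tau> * x)"
    by (intro distr_cong) auto
  ultimately have eq: "density lborel (normal_density 0 \<tau>) = distr std_normal_distribution borel (\<lambda>x. \<tau> * x)" by simp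
  show "real_distribution (density lborel (normal_density 0 \<tau>))"
    unfolding eq by (rule S.real_distribution_distr) simp
  have "char (density lborel (normal_density 0 \<tau>)) t = (\<integral>x. iexp (t * (\<tau> * x)) \<partial>std_normal_distribution)"
    unfolding eq char_def by (subst integral_distr) auto
  also have "\<dots> = char std_normal_distribution (\<tau> * t)"
    by (simp add: char_def mult.assoc mult.left_commute)
  finally show "char (density lborel (normal_density 0 \<tau>)) t = complex_of_real (exp (- (\<tau> * t)\<^sup>2 / 2))"
    by (simp add: char_std_normal_distribution)
qed

text \<open>A quantitative form of Slutsky's lemma. The mixed term \<open>\<bar>v\<bar> * \<bar>d - \<beta>\<bar>\<close> is split by the
  arithmetic-geometric mean inequality, with the weight \<open>s\<close> still to be chosen, so that only second
  moments of \<open>v\<close> and \<open>d - \<beta>\<close> are needed.\<close>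

lemma ratio_deviation:
  fixes x d v \<beta> s :: real
  assumes \<beta>: "\<beta> > 0" and d: "d \<ge> \<beta> / 2" and s: "s > 0"
  shows "\<bar>x / d - v / \<beta>\<bar> \<le> 2 / \<beta> * \<bar>x - v\<bar> + (v\<^sup>2 / s + s * (d - \<beta>)\<^sup>2) / \<beta>\<^sup>2"
proof -
  have dp: "d > 0" using \<beta> d by linarith
  have "x / d - v / \<beta> = (x - v) / d + v * (\<beta> - d) / (d * \<beta>)"
    using dp \<beta> by (simp add: field_simps)
  then have "\<bar>x / d - v / \<beta>\<bar> \<le> \<bar>(x - v) / d\<bar> + \<bar>v * (\<beta> - d) / (d * \<beta>)\<bar>"
    by (simp only: abs_triangle_ineq)
  also have "\<bar>(x - v) / d\<bar> \<le> 2 / \<beta> * \<bar>x - v\<bar>"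
  proof -
    have "1 / d \<le> 2 / \<beta>" using dp \<beta> d by (simp add: field_simps)
    from mult_right_mono[OF this abs_ge_zero[of "x - v"]] show ?thesis using dp by (simp add: abs_divide)
  qed
  also have "\<bar>v * (\<beta> - d) / (d * \<beta>)\<bar> \<le> (v\<^sup>2 / s + s * (d - \<beta>)\<^sup>2) / \<beta>\<^sup>2"
  proof -
    have "2 * (\<bar>v\<bar> * \<bar>\<beta> - d\<bar>) \<le> v\<^sup>2 / s + s * (d - \<beta>)\<^sup>2"
    proof -
      define r where "r = sqrt s"
      have r: "r > 0" "r * r = s" using s by (auto simp: r_def)
      have "0 \<le> (\<bar>v\<bar> / r - r * \<bar>\<beta> - d\<bar>)\<^sup>2" by simp
      also have "\<dots> = v\<^sup>2 / s + s * (d - \<beta>)\<^sup>2 - 2 * (\<bar>v\<bar> * \<bar>\<beta> - d\<bar>)"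
        using r(1) unfolding r(2)[symmetric] by (simp add: power2_diff power_divide power_mult_distrib power2_commute[of d] flip: power2_eq_square)
      finally show ?thesis by simp
    qed
    moreover have "\<bar>v * (\<beta> - d) / (d * \<beta>)\<bar> \<le> 2 * (\<bar>v\<bar> * \<bar>\<beta> - d\<bar>) / \<beta>\<^sup>2"
    proof -
      have "1 / (d * \<beta>) \<le> 2 / \<beta>\<^sup>2" using dp \<beta> d by (simp add: field_simps power2_eq_square)
      from mult_left_mono[OF this, of "\<bar>v\<bar> * \<bar>\<beta> - d\<bar>"] show ?thesis
        using dp \<beta> by (simp add: abs_mult abs_divide mult.commute)
    qed
    ultimately show ?thesis
      by (smt (verit) divide_right_mono zero_le_power2)
  qed
  finally show ?thesis by simp
qed

section \<open>Independent samples and resampling of a coordinate\<close>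

locale sampling = real_distribution N for N :: "real measure"
begin

definition P :: "(nat \<Rightarrow> real) measure" where "P = PiM UNIV (\<lambda>_. N)"

declare events_eq_borel [measurable_cong]

lemma prob_UNIV [simp]: "prob UNIV = 1"
  using prob_space by (simp add: space_eq_univ)

sublocale P: prob_space P
  unfolding P_def by (intro prob_space_PiM prob_space_axioms)

lemma measurable_coordinate [measurable]: "(\<lambda>w. w i) \<in> borel_measurable P"
proof -
  have "(\<lambda>w. w i) \<in> measurable P N" unfolding P_def by measurable
  then show ?thesis by (simp cong: measurable_cong_sets)
qed

lemma measurable_fun_upd_P [measurable]: "(\<lambda>(y, w). w(k := y)) \<in> measurable (N \<Otimes>\<^sub>M P) P"
  unfolding P_def
proof (rule measurable_PiM_single')
  show "(\<lambda>x. (case x of (y, w) \<Rightarrow> w(k := y)) i) \<in> N \<Otimes>\<^sub>M Pi\<^sub>M UNIV (\<lambda>_. N) \<rightarrow>\<^sub>M N" for i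
    by (cases "i = k") (simp_all add: case_prod_unfold)
qed (simp add: space_pair_measure space_PiM)

lemma distr_fun_upd: "distr (N \<Otimes>\<^sub>M P) P (\<lambda>(y, w). w(k := y)) = P"
  using distr_pair_PiM_eq_PiM[of UNIV "\<lambda>_::nat. N" k] prob_space_axioms by (simp add: P_def)

text \<open>Replacing one coordinate by an independent copy does not change the law of the sequence. Applied
  to one coordinate after another, this takes the place of conditional expectations and of Fubini's
  theorem for all functions of finitely many coordinates.\<close>

lemma resample:
  fixes Z :: "(nat \<Rightarrow> real) \<Rightarrow> 'b::{banach, second_countable_topology}"
  assumes [measurable]: "Z \<in> borel_measurable P" and bd: "\<And>w. norm (Z w) \<le> C"
  shows "(\<integral>w. Z w \<partial>P) = (\<integral>w. (\<integral>y. Z (w(k := y)) \<partial>N) \<partial>P)"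
proof -
  interpret NP: pair_prob_space N P ..
  have [measurable]: "(\<lambda>(y, w). Z (w(k := y))) \<in> borel_measurable (N \<Otimes>\<^sub>M P)"
    using measurable_compose[OF measurable_fun_upd_P[of k] assms(1)] by (simp add: case_prod_unfold)
  have "(\<integral>w. Z w \<partial>P) = (\<integral>w. Z w \<partial>distr (N \<Otimes>\<^sub>M P) P (\<lambda>(y, w). w(k := y)))"
    by (simp add: distr_fun_upd)
  also have "\<dots> = (\<integral>(y, w). Z (w(k := y)) \<partial>(N \<Otimes>\<^sub>M P))"
    by (subst integral_distr) (auto simp: case_prod_unfold)
  also have "\<dots> = (\<integral>w. (\<integral>y. Z (w(k := y)) \<partial>N) \<partial>P)"
    using bd by (subst NP.integral_snd[symmetric]) (auto intro!: NP.integrable_bounded[of _ C])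
  finally show ?thesis .
qed

text \<open>All orthogonality relations below come from this: a variable has mean zero if it averages to
  zero over a single coordinate, the others being fixed.\<close>

lemma resample_zero:
  fixes Z :: "(nat \<Rightarrow> real) \<Rightarrow> 'b::{banach, second_countable_topology}"
  assumes "Z \<in> borel_measurable P" and "\<And>w. norm (Z w) \<le> C"
    and "\<And>w. (\<integral>y. Z (w(k := y)) \<partial>N) = 0"
  shows "(\<integral>w. Z w \<partial>P) = 0"
  using resample[OF assms(1,2), of k] assms(3) by simp

lemma expectation_coordinate:
  fixes f :: "real \<Rightarrow> real"
  assumes "f \<in> borel_measurable borel" and "\<And>x. \<bar>f x\<bar> \<le> C"
  shows "(\<integral>w. f (w i) \<partial>P) = (\<integral>x. f x \<partial>N)"
proof -
  have "(\<lambda>w. f (w i)) \<in> borel_measurable P" by (rule measurable_compose[OF measurable_coordinate assms(1)])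
  from resample[OF this, of C i] assms(2) show ?thesis by (simp add: P.prob_space)
qed

lemma expectation_two_coordinates:
  fixes f :: "real \<Rightarrow> real \<Rightarrow> real" and i j :: nat
  assumes f: "(\<lambda>(x, y). f x y) \<in> borel_measurable (borel \<Otimes>\<^sub>M borel)" and bd: "\<And>x y. \<bar>f x y\<bar> \<le> C" and "i \<noteq> j"
  shows "(\<integral>w. f (w i) (w j) \<partial>P) = (\<integral>x. (\<integral>y. f x y \<partial>N) \<partial>N)"
proof -
  have "(\<lambda>w. (w i, w j)) \<in> measurable P (borel \<Otimes>\<^sub>M borel)" by measurable
  from measurable_compose[OF this f] have "(\<lambda>w. f (w i) (w j)) \<in> borel_measurable P" by simp
  from resample[OF this, of C j] have "(\<integral>w. f (w i) (w j) \<partial>P) = (\<integral>w. (\<integral>y. f (w i) y \<partial>N) \<partial>P)"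
    using bd \<open>i \<noteq> j\<close> by simp
  also have "\<dots> = (\<integral>x. (\<integral>y. f x y \<partial>N) \<partial>N)"
  proof (rule expectation_coordinate[of _ C])
    have "(\<lambda>(x, y). f x y) \<in> borel_measurable (borel \<Otimes>\<^sub>M N)"
      using f by (subst measurable_cong_sets[OF sets_pair_measure_cong[OF refl events_eq_borel] refl])
    then show "(\<lambda>x. \<integral>y. f x y \<partial>N) \<in> borel_measurable borel"
      by (rule borel_measurable_lebesgue_integral)
    show "\<bar>\<integral>y. f x y \<partial>N\<bar> \<le> C" for x
    proof (rule abs_expectation_le)
      have "(\<lambda>y. (x, y)) \<in> measurable N (borel \<Otimes>\<^sub>M borel)"
        by (intro measurable_Pair measurable_const measurable_ident_sets) simp_all
      from measurable_compose[OF this f] show "f x \<in> borel_measurable N" by simp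
    qed (rule bd)
  qed
  finally show ?thesis .
qed

lemma Fubini_bounded:
  fixes f :: "real \<Rightarrow> real \<Rightarrow> real"
  assumes "(\<lambda>(x, y). f x y) \<in> borel_measurable (borel \<Otimes>\<^sub>M borel)" and "\<And>x y. \<bar>f x y\<bar> \<le> C"
  shows "(\<integral>x. (\<integral>y. f x y \<partial>N) \<partial>N) = (\<integral>y. (\<integral>x. f x y \<partial>N) \<partial>N)"
proof -
  interpret NN: pair_prob_space N N ..
  have m: "(\<lambda>(x, y). f x y) \<in> borel_measurable (N \<Otimes>\<^sub>M N)"
    using assms(1) by measurable
  show ?thesis
  proof (rule NN.Fubini_integral[symmetric])
    show "integrable (N \<Otimes>\<^sub>M N) (\<lambda>(x, y). f x y)"
      using assms(2) by (intro NN.integrable_bounded[OF m, of C]) (simp add: case_prod_unfold)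
  qed
qed

lemma measurable_restrict_P:
  "(\<lambda>w. restrict w {1..n}) \<in> measurable P (PiM {1..n} (\<lambda>_. N))"
  unfolding P_def by (rule measurable_restrict_subset) simp

lemma distr_restrict:
  "distr P (PiM {1..n} (\<lambda>_. N)) (\<lambda>w. restrict w {1..n}) = PiM {1..n} (\<lambda>_. N)"
proof -
  interpret I: product_prob_space "\<lambda>_::nat. N" UNIV by unfold_locales
  show ?thesis unfolding P_def by (rule I.distr_PiM_restrict_finite) auto
qed

lemma second_moment_sum_orthogonal:
  fixes Z :: "nat \<Rightarrow> (nat \<Rightarrow> real) \<Rightarrow> real"
  assumes "finite I" and m: "\<And>i. i \<in> I \<Longrightarrow> Z i \<in> borel_measurable P" and bd: "\<And>i w. i \<in> I \<Longrightarrow> \<bar>Z i w\<bar> \<le> 1"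
    and orth: "\<And>i j. i < j \<Longrightarrow> (\<integral>w. Z i w * Z j w \<partial>P) = 0"
  shows "(\<integral>w. (\<Sum>i\<in>I. Z i w)\<^sup>2 \<partial>P) \<le> real (card I)"
proof -
  have "(\<integral>w. (\<Sum>i\<in>I. Z i w)\<^sup>2 \<partial>P) \<le> real 1 * 1\<^sup>2 * real (card I)"
  proof (rule P.second_moment_sum_le[where Q="\<lambda>i. {i}"])
    fix i j :: nat assume "j \<notin> {i}"
    then show "(\<integral>w. Z i w * Z j w \<partial>P) = 0"
      using orth[of i j] orth[of j i] by (cases i j rule: linorder_cases) (auto simp: mult.commute)
  qed (use assms in auto)
  then show ?thesis by simp
qed

lemma sum_iid_second_moment:
  assumes [measurable]: "f \<in> borel_measurable borel" and f: "\<And>x. 0 \<le> f x" "\<And>x. f x \<le> 1" and "finite I"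
  shows "(\<integral>w. (\<Sum>i\<in>I. f (w i) - (\<integral>x. f x \<partial>N))\<^sup>2 \<partial>P) \<le> real (card I)"
proof (rule second_moment_sum_orthogonal)
  let ?m = "\<integral>x. f x \<partial>N"
  have m: "0 \<le> ?m" "?m \<le> 1" using abs_expectation_le[of f 1] f by auto
  show bd: "\<bar>f (w i) - ?m\<bar> \<le> 1" for i :: nat and w
    using f[of "w i"] m by auto
  fix i j :: nat assume "i < j"
  have "\<bar>(f x - ?m) * (f y - ?m)\<bar> \<le> 1" for x y
    using mult_mono[OF bd[of "\<lambda>_. x" 0] bd[of "\<lambda>_. y" 0]] by (simp add: abs_mult)
  moreover have "(\<integral>x. f x - ?m \<partial>N) = 0"
    using f by (subst Bochner_Integration.integral_diff) (auto intro!: integrable_bounded[of _ 1])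
  ultimately show "(\<integral>w. (f (w i) - ?m) * (f (w j) - ?m) \<partial>P) = 0"
    using \<open>i < j\<close> by (intro resample_zero[of _ 1 j]) auto
qed (use assms in auto)

section \<open>The degenerate kernel\<close>

definition G :: "real \<Rightarrow> real" where "G z = measure N {z..}"

definition e :: "real \<Rightarrow> real \<Rightarrow> real" where "e x z = (if z \<le> x then 1 else 0) - G z"

text \<open>The inner product of the centred indicator functions \<open>e x\<close> and \<open>e y\<close> in \<open>L\<^sup>2 (N)\<close>; in particular \<open>\<psi>\<close> is
  positive semidefinite.\<close>

definition \<psi> :: "real \<Rightarrow> real \<Rightarrow> real" where "\<psi> x y = (\<integral>z. e x z * e y z \<partial>N)"

lemma G_eq_integral: "G z = (\<integral>x. (if z \<le> x then 1 else 0 :: real) \<partial>N)"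
proof -
  have "(\<integral>x. (if z \<le> x then 1 else 0 :: real) \<partial>N) = (\<integral>x. indicator {z..} x \<partial>N)"
    by (intro Bochner_Integration.integral_cong) (auto simp: indicator_def)
  then show ?thesis by (simp add: G_def)
qed

lemma G_measurable [measurable]: "G \<in> borel_measurable borel"
proof -
  have "(\<lambda>z. \<integral>x. (if z \<le> x then 1 else 0 :: real) \<partial>N) \<in> borel_measurable borel" by measurable
  then show ?thesis by (simp add: G_eq_integral[abs_def])
qed

lemma G_bounds: "0 \<le> G z" "G z \<le> 1"
  by (auto simp: G_def)

lemma e_measurable [measurable]: "(\<lambda>(x, z). e x z) \<in> borel_measurable (borel \<Otimes>\<^sub>M borel)"
  unfolding e_def by measurable

lemma e_bound: "\<bar>e x z\<bar> \<le> 1"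
  using G_bounds[of z] by (auto simp: e_def)

lemma ee_bound: "\<bar>e x z * e y z'\<bar> \<le> 1"
  using mult_mono[OF e_bound[of x z] e_bound[of y z']] by (auto simp: abs_mult)

lemma e_mean: "(\<integral>x. e x z \<partial>N) = 0"
  unfolding e_def
  by (subst Bochner_Integration.integral_diff) (auto intro!: integrable_bounded[of _ 1] simp: G_eq_integral[symmetric] prob_space)

lemma \<psi>_measurable [measurable]: "(\<lambda>(x, y). \<psi> x y) \<in> borel_measurable (borel \<Otimes>\<^sub>M borel)"
  unfolding \<psi>_def by measurable

lemma \<psi>_bound: "\<bar>\<psi> x y\<bar> \<le> 1"
  unfolding \<psi>_def using ee_bound by (intro abs_expectation_le) auto

lemma \<psi>_sq: "0 \<le> (\<psi> x y)\<^sup>2" "(\<psi> x y)\<^sup>2 \<le> 1"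
  using \<psi>_bound[of x y] by (auto simp: abs_square_le_1)

lemma \<psi>_commute: "\<psi> x y = \<psi> y x"
  by (simp add: \<psi>_def mult.commute)

lemma \<psi>_mean: "(\<integral>y. \<psi> x y \<partial>N) = 0"
proof -
  interpret NN: pair_prob_space N N ..
  have "(\<integral>y. \<psi> x y \<partial>N) = (\<integral>z. (\<integral>y. e x z * e y z \<partial>N) \<partial>N)"
    unfolding \<psi>_def
    by (rule NN.Fubini_integral, rule NN.integrable_bounded[of _ 1]) (use ee_bound in \<open>auto\<close>)
  then show ?thesis by (simp add: e_mean)
qed

lemma \<psi>_mean': "(\<integral>x. \<psi> x y \<partial>N) = 0"
  using \<psi>_mean[of y] by (simp add: \<psi>_commute)

definition kernel_sq_mean :: "real \<Rightarrow> real" where "kernel_sq_mean x = (\<integral>y. (\<psi> x y)\<^sup>2 \<partial>N)"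

definition kernel_variance :: real where "kernel_variance = (\<integral>x. kernel_sq_mean x \<partial>N)"

text \<open>The limit of \<open>\<Sum>\<^sub>i l\<^sub>i (n - l\<^sub>i) / n\<^sup>3\<close>.\<close>

definition den_limit :: real where "den_limit = (\<integral>z. G z * (1 - G z) \<partial>N)"

lemma kernel_sq_mean_measurable [measurable]: "kernel_sq_mean \<in> borel_measurable borel"
  unfolding kernel_sq_mean_def by measurable

lemma kernel_sq_mean_bounds: "0 \<le> kernel_sq_mean x" "kernel_sq_mean x \<le> 1"
  using abs_expectation_le[of "\<lambda>y. (\<psi> x y)\<^sup>2" 1] \<psi>_sq by (auto simp: kernel_sq_mean_def)

lemma kernel_variance_bounds: "0 \<le> kernel_variance" "kernel_variance \<le> 1"
  using abs_expectation_le[of kernel_sq_mean 1] kernel_sq_mean_bounds by (auto simp: kernel_variance_def)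

lemma G_var_bounds: "0 \<le> G z * (1 - G z)" "G z * (1 - G z) \<le> 1"
  using G_bounds[of z] mult_le_one[of "G z" "1 - G z"] by auto

lemma den_limit_bounds: "0 \<le> den_limit" "den_limit \<le> 1"
  using abs_expectation_le[of "\<lambda>z. G z * (1 - G z)" 1] G_var_bounds by (auto simp: den_limit_def)

text \<open>For \<open>j \<noteq> k\<close> one of the two indices differs from \<open>l\<close>, and resampling it kills the product; the index
  \<open>l\<close> itself needs no separate treatment.\<close>

lemma row_sum_sq_expectation:
  fixes l n :: nat
  shows
  "(\<integral>w. (\<Sum>j=1..n::nat. e (w j) (w l))\<^sup>2 \<partial>P) \<le> real n"
proof -
  have orth: "(\<integral>w. e (w j) (w l) * e (w k) (w l) \<partial>P) = 0" if "j \<noteq> k" "j \<noteq> l" for j k l :: nat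
    by (rule resample_zero[of _ 1 j]) (use that ee_bound in \<open>auto simp: e_mean\<close>)
  have "(\<integral>w. (\<Sum>j=1..n::nat. e (w j) (w l))\<^sup>2 \<partial>P) \<le> real 1 * 1\<^sup>2 * real (card {1..n})"
  proof (rule P.second_moment_sum_le[where Q="\<lambda>j. {j}"])
    fix j k :: nat assume "k \<notin> {j}"
    then show "(\<integral>w. e (w j) (w l) * e (w k) (w l) \<partial>P) = 0"
      using orth[of j k] orth[of k j] by (cases "j = l") (auto simp: mult.commute)
  qed (auto simp: e_bound)
  then show ?thesis by simp
qed

subsection \<open>Averaging over the third observation\<close>

text \<open>The error made when the product of two centred indicators at level \<open>w l\<close> is replaced by its mean
  over that level.\<close>

definition \<rho> :: "nat \<Rightarrow> nat \<Rightarrow> (nat \<Rightarrow> real) \<Rightarrow> real" where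
  "\<rho> i l w = e (w i) (w l) * e (w (i + 1)) (w l) - \<psi> (w i) (w (i + 1))"

lemma \<rho>_measurable [measurable]: "\<rho> i l \<in> borel_measurable P"
  unfolding \<rho>_def by measurable

lemma \<rho>_bound: "\<bar>\<rho> i l w\<bar> \<le> 2"
  using ee_bound[of "w i" "w l" "w (i+1)" "w l"] \<psi>_bound[of "w i" "w (i+1)"] by (auto simp: \<rho>_def)

text \<open>Away from the diagonal, \<open>\<rho> i l\<close> is centred both in the coordinate \<open>l\<close> and, by the next lemma, in
  the coordinate \<open>i\<close>. Only the two facts together yield the order \<open>n\<^sup>2\<close> for the second moment of
  the double sum: centring in \<open>l\<close> alone would leave \<open>n\<^sup>3\<close> correlated pairs with equal \<open>l\<close>.\<close>

lemma \<rho>_mean_l: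
  assumes "l \<noteq> i" "l \<noteq> i + 1"
  shows "(\<integral>y. \<rho> i l (w(l := y)) \<partial>N) = 0"
proof -
  have "(\<integral>y. \<rho> i l (w(l := y)) \<partial>N) = (\<integral>y. e (w i) y * e (w (i+1)) y - \<psi> (w i) (w (i+1)) \<partial>N)"
    using assms by (simp add: \<rho>_def)
  also have "\<dots> = 0"
    by (subst Bochner_Integration.integral_diff)
      (use ee_bound in \<open>auto intro!: integrable_bounded[of _ 1] simp: \<psi>_def[symmetric] prob_space\<close>)
  finally show ?thesis .
qed

lemma \<rho>_mean_i:
  assumes "l \<noteq> i" "l \<noteq> i + 1"
  shows "(\<integral>y. \<rho> i l (w(i := y)) \<partial>N) = 0"
proof -
  have "(\<integral>y. \<rho> i l (w(i := y)) \<partial>N) = (\<integral>y. e y (w l) * e (w (i+1)) (w l) - \<psi> y (w (i+1)) \<partial>N)"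
    using assms by (simp add: \<rho>_def)
  also have "\<dots> = 0"
    by (subst Bochner_Integration.integral_diff)
      (simp_all add: e_mean \<psi>_mean' integrable_bounded[of _ 1] e_bound \<psi>_bound)
  finally show ?thesis .
qed

lemma \<rho>_upd_other: "k \<noteq> i \<Longrightarrow> k \<noteq> i + 1 \<Longrightarrow> k \<noteq> l \<Longrightarrow> \<rho> i l (w(k := y)) = \<rho> i l w"
  by (simp add: \<rho>_def)

lemma \<rho>\<rho>_bound: "\<bar>\<rho> i l w * \<rho> i' l' w\<bar> \<le> 4"
  using mult_mono[OF \<rho>_bound[of i l w] \<rho>_bound[of i' l' w]] by (auto simp: abs_mult)

lemma \<rho>_orth_l:
  assumes "l \<noteq> i" "l \<noteq> i + 1" "l \<noteq> i'" "l \<noteq> i' + 1" "l \<noteq> l'"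
  shows "(\<integral>w. \<rho> i l w * \<rho> i' l' w \<partial>P) = 0"
  by (rule resample_zero[of _ 4 l]) (use assms \<rho>\<rho>_bound in \<open>auto simp: \<rho>_upd_other \<rho>_mean_l\<close>)

lemma \<rho>_orth_i:
  assumes "l \<noteq> i" "l \<noteq> i + 1" "i \<noteq> i'" "i \<noteq> i' + 1" "i \<noteq> l'"
  shows "(\<integral>w. \<rho> i l w * \<rho> i' l' w \<partial>P) = 0"
  by (rule resample_zero[of _ 4 i]) (use assms \<rho>\<rho>_bound in \<open>auto simp: \<rho>_upd_other \<rho>_mean_i\<close>)

definition far_pairs :: "nat \<Rightarrow> (nat \<times> nat) set" where
  "far_pairs n = {a \<in> {1..<n} \<times> {1..n}. snd a \<noteq> fst a \<and> snd a \<noteq> fst a + 1}"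

lemma finite_far_pairs [simp]: "finite (far_pairs n)"
  by (simp add: far_pairs_def)

lemma card_far_pairs: "card (far_pairs n) \<le> n\<^sup>2"
proof -
  have "card (far_pairs n) \<le> card ({1..<n} \<times> {1..n})"
    unfolding far_pairs_def by (intro card_mono) auto
  also have "\<dots> \<le> n\<^sup>2" by (simp add: power2_eq_square)
  finally show ?thesis .
qed

lemma card_near_pairs:
  fixes i l :: nat
  shows "card ({i - 1, i, i + 1} \<times> {l} \<union> {l - 1, l} \<times> {i, i + 1}) \<le> 7"
proof -
  have "card ({i - 1, i, i + 1} \<times> {l}) \<le> 3"
    by (subst card_cartesian_product) (auto simp: card_insert_if)
  moreover have "card ({l - 1, l} \<times> {i, i + 1}) \<le> 4"
    by (subst card_cartesian_product) (auto simp: card_insert_if)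
  ultimately show ?thesis
    using card_Un_le[of "{i - 1, i, i + 1} \<times> {l}" "{l - 1, l} \<times> {i, i + 1}"] by linarith
qed

text \<open>If \<open>l = l'\<close>, resample the coordinate \<open>i\<close>, unless it occurs among \<open>i'\<close>, \<open>i' + 1\<close>. If \<open>l \<noteq> l'\<close>, resample
  \<open>l\<close> or \<open>l'\<close>; this fails only if \<open>l\<close> is one of \<open>i'\<close>, \<open>i' + 1\<close> and \<open>l'\<close> is one of \<open>i\<close>, \<open>i + 1\<close>.\<close>

lemma \<rho>_orth:
  assumes l: "l \<noteq> i" "l \<noteq> i + 1" "l' \<noteq> i'" "l' \<noteq> i' + 1"
    and far: "(i', l') \<notin> {i - 1, i, i + 1} \<times> {l} \<union> {l - 1, l} \<times> {i, i + 1}"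
  shows "(\<integral>w. \<rho> i l w * \<rho> i' l' w \<partial>P) = 0"
proof (cases "l' = l")
  case True
  then have "i' \<noteq> i - 1" "i \<noteq> i'" "i \<noteq> l'" using l far by auto
  then have "i \<noteq> i'" "i \<noteq> i' + 1" "i \<noteq> l'" by linarith+
  from \<rho>_orth_i[OF l(1,2) this] show ?thesis .
next
  case False
  have "\<not> ((i' = l - 1 \<or> i' = l) \<and> (l' = i \<or> l' = i + 1))" using far by auto
  then consider "l \<noteq> i'" "l \<noteq> i' + 1" | "l' \<noteq> i" "l' \<noteq> i + 1" by force
  then show ?thesis
  proof cases
    case 1
    then show ?thesis using \<rho>_orth_l[OF l(1,2), of i' l'] False by simp
  next
    case 2
    then show ?thesis using \<rho>_orth_l[OF l(3,4), of i l] False by (simp add: mult.commute)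
  qed
qed

lemma \<rho>_sum_second_moment:
  "(\<integral>w. (\<Sum>a\<in>far_pairs n. \<rho> (fst a) (snd a) w)\<^sup>2 \<partial>P) \<le> 28 * (real n)\<^sup>2"
proof -
  let ?Q = "\<lambda>a. {fst a - 1, fst a, fst a + 1} \<times> {snd a} \<union> {snd a - 1, snd a} \<times> {fst a, fst a + 1} :: (nat \<times> nat) set"
  have "(\<integral>w. (\<Sum>a\<in>far_pairs n. \<rho> (fst a) (snd a) w)\<^sup>2 \<partial>P) \<le> real 7 * 2\<^sup>2 * real (card (far_pairs n))"
  proof (rule P.second_moment_sum_le[where Q="?Q"])
    show "finite (?Q a) \<and> card (?Q a) \<le> 7" for a
      using card_near_pairs[of "fst a" "snd a"] by simp
    fix a b assume a: "a \<in> far_pairs n" and b: "b \<in> far_pairs n" and nQ: "b \<notin> ?Q a"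
    show "(\<integral>w. \<rho> (fst a) (snd a) w * \<rho> (fst b) (snd b) w \<partial>P) = 0"
    proof (rule \<rho>_orth)
      show "(fst b, snd b) \<notin> ?Q a" using nQ by (subst prod.collapse)
      show "snd a \<noteq> fst a" "snd a \<noteq> fst a + 1" using a unfolding far_pairs_def by blast+
      show "snd b \<noteq> fst b" "snd b \<noteq> fst b + 1" using b unfolding far_pairs_def by blast+
    qed
  qed (simp_all only: finite_far_pairs \<rho>_measurable \<rho>_bound)
  moreover have "real (card (far_pairs n)) \<le> (real n)\<^sup>2"
    using of_nat_mono[OF card_far_pairs[of n], where 'a=real] by simp
  moreover have "real 7 * 2\<^sup>2 * real (card (far_pairs n)) = 28 * real (card (far_pairs n))" by simp
  ultimately show ?thesis by linarith
qed

section \<open>Central limit theorem for the kernel sum\<close>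

lemma sum_\<psi>_second_moment:
  "(\<integral>w. (\<Sum>i\<in>{1..<n}. \<psi> (w i) (w (i + 1)))\<^sup>2 \<partial>P) \<le> real n"
proof -
  have "(\<integral>w. (\<Sum>i\<in>{1..<n}. \<psi> (w i) (w (i + 1)))\<^sup>2 \<partial>P) \<le> real (card {1..<n})"
  proof (rule second_moment_sum_orthogonal)
    fix i j :: nat assume "i < j"
    have "\<bar>\<psi> x y * \<psi> x' y'\<bar> \<le> 1" for x y x' y'
      using mult_mono[OF \<psi>_bound[of x y] \<psi>_bound[of x' y']] by (simp add: abs_mult)
    then show "(\<integral>w. \<psi> (w i) (w (i + 1)) * \<psi> (w j) (w (j + 1)) \<partial>P) = 0"
      using \<open>i < j\<close> by (intro resample_zero[of _ 1 "j + 1"]) (auto simp: \<psi>_mean)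
  qed (auto simp: \<psi>_bound)
  then show ?thesis by simp
qed

lemma sum_\<psi>_sq_second_moment:
  "(\<integral>w. (\<Sum>i\<in>{1..<n}. (\<psi> (w i) (w (i + 1)))\<^sup>2 - kernel_sq_mean (w i))\<^sup>2 \<partial>P) \<le> real n"
proof -
  have bd: "\<bar>(\<psi> x y)\<^sup>2 - kernel_sq_mean x'\<bar> \<le> 1" for x y x'
    using \<psi>_sq[of x y] kernel_sq_mean_bounds[of x'] unfolding abs_le_iff by linarith
  have "(\<integral>w. (\<Sum>i\<in>{1..<n}. (\<psi> (w i) (w (i + 1)))\<^sup>2 - kernel_sq_mean (w i))\<^sup>2 \<partial>P) \<le> real (card {1..<n})"
  proof (rule second_moment_sum_orthogonal)
    fix i j :: nat assume "i < j"
    have "\<bar>((\<psi> x y)\<^sup>2 - kernel_sq_mean x) * ((\<psi> x' y')\<^sup>2 - kernel_sq_mean x')\<bar> \<le> 1" for x y x' y'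
      using mult_mono[OF bd[of x y x] bd[of x' y' x']] by (simp add: abs_mult)
    moreover have "(\<integral>y. (\<psi> x y)\<^sup>2 - kernel_sq_mean x \<partial>N) = 0" for x
      using \<psi>_sq[of x]
      by (subst Bochner_Integration.integral_diff) (auto simp: kernel_sq_mean_def intro!: integrable_bounded[of _ 1])
    ultimately show "(\<integral>w. ((\<psi> (w i) (w (i + 1)))\<^sup>2 - kernel_sq_mean (w i)) * ((\<psi> (w j) (w (j + 1)))\<^sup>2 - kernel_sq_mean (w j)) \<partial>P) = 0"
      using \<open>i < j\<close> by (intro resample_zero[of _ 1 "j + 1"]) auto
  qed (auto simp: bd)
  then show ?thesis by simp
qed

text \<open>The law of large numbers for the quadratic variation: the squares are first centred
  conditionally on the left neighbour, which leaves martingale differences, and the conditional means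
  are independent and identically distributed.\<close>

lemma sum_\<psi>_sq_deviation:
  fixes n :: nat
  assumes "n \<ge> 1"
  shows "(\<integral>w. \<bar>(\<Sum>i\<in>{1..<n}. (\<psi> (w i) (w (i + 1)))\<^sup>2) - real n * kernel_variance\<bar> \<partial>P) \<le> 2 * sqrt (real n) + 1"
proof -
  let ?A = "\<lambda>w. \<Sum>i\<in>{1..<n}. (\<psi> (w i) (w (i + 1)))\<^sup>2 - kernel_sq_mean (w i)"
  let ?B = "\<lambda>w. \<Sum>i\<in>{1..<n}. kernel_sq_mean (w i) - kernel_variance"
  have A_bd: "\<bar>?A w\<bar> \<le> real n" for w
  proof -
    have "\<bar>?A w\<bar> \<le> (\<Sum>i\<in>{1..<n}. \<bar>(\<psi> (w i) (w (i + 1)))\<^sup>2 - kernel_sq_mean (w i)\<bar>)" by (rule sum_abs)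
    also have "\<dots> \<le> (\<Sum>i\<in>{1..<n}. 1)"
    proof (rule sum_mono)
      fix i show "\<bar>(\<psi> (w i) (w (i + 1)))\<^sup>2 - kernel_sq_mean (w i)\<bar> \<le> 1"
        using \<psi>_sq[of "w i" "w (i+1)"] kernel_sq_mean_bounds[of "w i"] unfolding abs_le_iff by linarith
    qed
    finally show ?thesis by simp
  qed
  have B_bd: "\<bar>?B w\<bar> \<le> real n" for w
  proof -
    have "\<bar>?B w\<bar> \<le> (\<Sum>i\<in>{1..<n}. \<bar>kernel_sq_mean (w i) - kernel_variance\<bar>)" by (rule sum_abs)
    also have "\<dots> \<le> (\<Sum>i\<in>{1..<n}. 1)"
    proof (rule sum_mono)
      fix i show "\<bar>kernel_sq_mean (w i) - kernel_variance\<bar> \<le> 1"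
        using kernel_variance_bounds kernel_sq_mean_bounds[of "w i"] unfolding abs_le_iff by linarith
    qed
    finally show ?thesis by simp
  qed
  have "(\<integral>w. (?A w)\<^sup>2 \<partial>P) \<le> real n" by (rule sum_\<psi>_sq_second_moment)
  then have A: "(\<integral>w. \<bar>?A w\<bar> \<partial>P) \<le> sqrt (real n)"
    by (intro P.expectation_abs_le_sqrt[OF _ A_bd]) auto
  have "(\<integral>w. (?B w)\<^sup>2 \<partial>P) \<le> real (card {1..<n})"
    using kernel_sq_mean_bounds unfolding kernel_variance_def by (intro sum_iid_second_moment) auto
  then have "(\<integral>w. (?B w)\<^sup>2 \<partial>P) \<le> real n" by simp
  then have B: "(\<integral>w. \<bar>?B w\<bar> \<partial>P) \<le> sqrt (real n)"
    by (intro P.expectation_abs_le_sqrt[OF _ B_bd]) auto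
  have iA: "integrable P (\<lambda>w. \<bar>?A w\<bar>)" using A_bd by (intro P.integrable_bounded[of _ "real n"]) auto
  have iB: "integrable P (\<lambda>w. \<bar>?B w\<bar>)" using B_bd by (intro P.integrable_bounded[of _ "real n"]) auto
  have iAB: "integrable P (\<lambda>w. \<bar>?A w\<bar> + \<bar>?B w\<bar> + 1)" using iA iB by auto
  have le: "\<bar>(\<Sum>i\<in>{1..<n}. (\<psi> (w i) (w (i + 1)))\<^sup>2) - real n * kernel_variance\<bar> \<le> \<bar>?A w\<bar> + \<bar>?B w\<bar> + 1" for w
  proof -
    have "(\<Sum>i\<in>{1..<n}. (\<psi> (w i) (w (i + 1)))\<^sup>2) - real n * kernel_variance = ?A w + ?B w - kernel_variance"
      using assms by (simp add: sum_subtractf of_nat_diff algebra_simps)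
    then show ?thesis using kernel_variance_bounds by linarith
  qed
  have "(\<integral>w. \<bar>(\<Sum>i\<in>{1..<n}. (\<psi> (w i) (w (i + 1)))\<^sup>2) - real n * kernel_variance\<bar> \<partial>P) \<le> (\<integral>w. \<bar>?A w\<bar> + \<bar>?B w\<bar> + 1 \<partial>P)"
  proof (rule integral_mono_AE)
    show "integrable P (\<lambda>w. \<bar>(\<Sum>i\<in>{1..<n}. (\<psi> (w i) (w (i + 1)))\<^sup>2) - real n * kernel_variance\<bar>)"
      using iAB le by (rule_tac Bochner_Integration.integrable_bound[OF iAB]) auto
  qed (use iAB le in auto)
  also have "\<dots> = (\<integral>w. \<bar>?A w\<bar> \<partial>P) + (\<integral>w. \<bar>?B w\<bar> \<partial>P) + 1"
    using iA iB by (simp add: P.prob_space)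
  finally show ?thesis using A B by linarith
qed

text \<open>Resampling the last coordinate removes the last factor, because the kernel is degenerate.\<close>

lemma martingale_product:
  fixes a :: real and n :: nat
  shows "(\<integral>w. (\<Prod>i\<in>{1..<n}. 1 + \<i> * complex_of_real (a * \<psi> (w i) (w (i + 1)))) \<partial>P) = 1"
proof (induction n)
  case 0
  then show ?case by (simp add: P.prob_space)
next
  case (Suc n)
  let ?f = "\<lambda>w i. 1 + \<i> * complex_of_real (a * \<psi> (w i) (w (i + 1)))"
  have f_bd: "cmod (?f w i) \<le> 1 + \<bar>a\<bar>" for w i
  proof -
    have "cmod (?f w i) \<le> 1 + \<bar>a * \<psi> (w i) (w (i + 1))\<bar>"
      by (rule order.trans[OF norm_triangle_ineq]) (simp add: norm_mult abs_mult)
    moreover have "\<bar>a * \<psi> (w i) (w (i + 1))\<bar> \<le> \<bar>a\<bar>"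
      using \<psi>_bound[of "w i" "w (i+1)"] by (simp add: abs_mult mult_left_le)
    ultimately show ?thesis by simp
  qed
  have prod_bd: "cmod (\<Prod>i\<in>{1..<m}. ?f w i) \<le> (1 + \<bar>a\<bar>) ^ (m - 1)" for w m
  proof -
    have "(\<Prod>i\<in>{1..<m}. cmod (?f w i)) \<le> (\<Prod>i\<in>{1..<m}. 1 + \<bar>a\<bar>)"
      using f_bd by (intro prod_mono conjI norm_ge_zero)
    then show ?thesis by (simp only: prod_norm prod_constant card_atLeastLessThan)
  qed
  show ?case
  proof (cases "n = 0")
    case False
    let ?T = "\<lambda>w. \<Prod>i\<in>{1..<n}. ?f w i"
    let ?R = "\<lambda>w. ?T w * (\<i> * complex_of_real (a * \<psi> (w n) (w (n + 1))))"
    have eq: "(\<Prod>i\<in>{1..<Suc n}. ?f w i) = ?T w + ?R w" for w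
      using False by (simp add: atLeastLessThanSuc field_simps)
    have R_bd: "cmod (?R w) \<le> (1 + \<bar>a\<bar>) ^ (n - 1) * \<bar>a\<bar>" for w
    proof -
      have "cmod (\<i> * complex_of_real (a * \<psi> (w n) (w (n + 1)))) \<le> \<bar>a\<bar>"
        using \<psi>_bound[of "w n" "w (n+1)"] by (simp add: norm_mult mult_left_le)
      then show ?thesis
        unfolding norm_mult[of "?T w"] by (intro mult_mono prod_bd) auto
    qed
    have "(\<integral>w. ?R w \<partial>P) = 0"
    proof (rule resample_zero[of _ "(1 + \<bar>a\<bar>) ^ (n - 1) * \<bar>a\<bar>" "n + 1"])
      fix w :: "nat \<Rightarrow> real"
      have "(\<integral>y. ?R (w(n + 1 := y)) \<partial>N) = (\<integral>y. ?T w * (\<i> * complex_of_real a) * complex_of_real (\<psi> (w n) y) \<partial>N)"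
        by (intro Bochner_Integration.integral_cong) (auto intro!: prod.cong simp: mult.assoc)
      also have "\<dots> = ?T w * (\<i> * complex_of_real a) * complex_of_real (\<integral>y. \<psi> (w n) y \<partial>N)"
        by (simp del: of_real_mult)
      finally show "(\<integral>y. ?R (w(n + 1 := y)) \<partial>N) = 0" by (simp add: \<psi>_mean)
    qed (use R_bd in \<open>auto\<close>)
    moreover have "(\<integral>w. ?T w + ?R w \<partial>P) = (\<integral>w. ?T w \<partial>P) + (\<integral>w. ?R w \<partial>P)"
      by (intro Bochner_Integration.integral_add P.integrable_bounded[OF _ prod_bd] P.integrable_bounded[OF _ R_bd]) auto
    ultimately show ?thesis unfolding eq using Suc.IH by simp
  qed (simp add: P.prob_space)
qed

definition kernel_sum :: "nat \<Rightarrow> (nat \<Rightarrow> real) \<Rightarrow> real" where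
  "kernel_sum n w = (\<Sum>i\<in>{1..<n}. \<psi> (w i) (w (i + 1))) / sqrt (real n)"

lemma kernel_sum_measurable [measurable]: "kernel_sum n \<in> borel_measurable P"
  unfolding kernel_sum_def by measurable

text \<open>McLeish's comparison. With \<open>T\<close> the product of the factors \<open>1 + i x\<^sub>j\<close> and \<open>U\<close> the exponential of minus
  half the quadratic variation, \<open>iexp\<close> of the sum is close to \<open>T * U\<close>, and \<open>U\<close> is close to the constant
  \<open>c\<close>. Since the \<open>x\<^sub>j\<close> are bounded by \<open>\<bar>t\<bar> / \<surd>n\<close>, the product \<open>T\<close> is bounded by a number depending on \<open>t\<close>
  only.\<close>

lemma char_kernel_sum_pointwise:
  fixes t :: real and n :: nat
  assumes n: "n \<ge> 1"
  defines "a \<equiv> t / sqrt (real n)"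
  defines "c \<equiv> exp (- (t\<^sup>2 * kernel_variance / 2))"
  shows "cmod (iexp (t * kernel_sum n w) - (\<Prod>i\<in>{1..<n}. 1 + \<i> * complex_of_real (a * \<psi> (w i) (w (i + 1)))) * complex_of_real c)
    \<le> 2 * \<bar>t\<bar> ^ 3 / sqrt (real n)
      + exp (t\<^sup>2 / 2) * (t\<^sup>2 / (2 * real n) * \<bar>(\<Sum>i\<in>{1..<n}. (\<psi> (w i) (w (i + 1)))\<^sup>2) - real n * kernel_variance\<bar>)"
proof -
  let ?I = "{1..<n}"
  define x where "x i = a * \<psi> (w i) (w (i + 1))" for i
  define T where "T = (\<Prod>i\<in>?I. 1 + \<i> * complex_of_real (x i))"
  define U where "U = exp (- (\<Sum>i\<in>?I. (x i)\<^sup>2 / 2))"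
  have x_bd: "\<bar>x i\<bar> \<le> \<bar>a\<bar>" for i
    using \<psi>_bound[of "w i" "w (i+1)"] by (simp add: x_def abs_mult mult_left_le)
  have na: "real n * a\<^sup>2 = t\<^sup>2" using n by (simp add: a_def power_divide)
  have TU: "(\<Prod>i\<in>?I. (1 + \<i> * complex_of_real (x i)) * complex_of_real (exp (- ((x i)\<^sup>2 / 2)))) = T * complex_of_real U"
    by (simp add: T_def U_def prod.distrib sum_negf[symmetric] exp_sum flip: of_real_prod)
  have E: "iexp (t * kernel_sum n w) = (\<Prod>i\<in>?I. iexp (x i))"
  proof -
    have "t * kernel_sum n w = (\<Sum>i\<in>?I. x i)"
      unfolding kernel_sum_def x_def a_def sum_divide_distrib sum_distrib_left by simp
    then show ?thesis by (simp add: exp_sum sum_distrib_left)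
  qed
  have "cmod (iexp (t * kernel_sum n w) - T * complex_of_real U) \<le>
      (\<Sum>i\<in>?I. cmod (iexp (x i) - (1 + \<i> * complex_of_real (x i)) * complex_of_real (exp (- ((x i)\<^sup>2 / 2)))))"
    unfolding E TU[symmetric]
  proof (rule norm_prod_diff)
    fix i
    show "cmod ((1 + \<i> * complex_of_real (x i)) * complex_of_real (exp (- ((x i)\<^sup>2 / 2)))) \<le> 1"
      using mult_right_mono[OF cmod_one_plus_imaginary[of "x i"], of "exp (- ((x i)\<^sup>2 / 2))"]
      by (simp add: norm_mult flip: exp_add)
  qed simp
  also have "\<dots> \<le> (\<Sum>i\<in>?I. 2 * \<bar>a\<bar> ^ 3)"
  proof (rule sum_mono)
    fix i
    have "\<bar>x i\<bar> ^ 3 \<le> \<bar>a\<bar> ^ 3" by (rule power_mono[OF x_bd]) simp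
    then show "cmod (iexp (x i) - (1 + \<i> * complex_of_real (x i)) * complex_of_real (exp (- ((x i)\<^sup>2 / 2)))) \<le> 2 * \<bar>a\<bar> ^ 3"
      using iexp_approx_one_plus_imaginary[of "x i"] by linarith
  qed
  also have "\<dots> \<le> real n * (2 * \<bar>a\<bar> ^ 3)" by (simp add: mult_right_mono)
  also have "\<dots> = 2 * \<bar>t\<bar> ^ 3 / sqrt (real n)"
  proof -
    have "real n * \<bar>a\<bar> ^ 3 = (real n * a\<^sup>2) * \<bar>a\<bar>"
      by (simp add: power3_eq_cube power2_eq_square mult.assoc flip: abs_mult)
    also have "\<dots> = \<bar>t\<bar> ^ 3 / sqrt (real n)"
      unfolding na by (simp add: a_def power3_eq_cube power2_eq_square flip: abs_mult)
    finally show ?thesis by simp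
  qed
  finally have 1: "cmod (iexp (t * kernel_sum n w) - T * complex_of_real U) \<le> 2 * \<bar>t\<bar> ^ 3 / sqrt (real n)" .
  have T_bd: "cmod T \<le> exp (t\<^sup>2 / 2)"
  proof -
    have "cmod T \<le> (\<Prod>i\<in>?I. exp (a\<^sup>2 / 2))"
      unfolding T_def prod_norm[symmetric]
    proof (intro prod_mono conjI norm_ge_zero)
      fix i
      have "(x i)\<^sup>2 \<le> a\<^sup>2" using x_bd by (simp add: abs_le_square_iff)
      then show "cmod (1 + \<i> * complex_of_real (x i)) \<le> exp (a\<^sup>2 / 2)"
        by (intro order.trans[OF cmod_one_plus_imaginary]) simp
    qed
    also have "\<dots> = exp (real (n - 1) * (a\<^sup>2 / 2))" by (simp only: prod_constant card_atLeastLessThan exp_of_nat_mult)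
    also have "\<dots> \<le> exp (real n * (a\<^sup>2 / 2))" by (simp add: mult_right_mono)
    finally show ?thesis using na by simp
  qed
  have "\<bar>U - c\<bar> \<le> \<bar>(\<Sum>i\<in>?I. (x i)\<^sup>2 / 2) - t\<^sup>2 * kernel_variance / 2\<bar>"
    unfolding U_def c_def using kernel_variance_bounds by (intro abs_exp_neg_diff_le sum_nonneg) auto
  also have "(\<Sum>i\<in>?I. (x i)\<^sup>2 / 2) - t\<^sup>2 * kernel_variance / 2 = t\<^sup>2 / (2 * real n) * ((\<Sum>i\<in>?I. (\<psi> (w i) (w (i + 1)))\<^sup>2) - real n * kernel_variance)"
  proof -
    have "(\<Sum>i\<in>?I. (x i)\<^sup>2 / 2) = a\<^sup>2 / 2 * (\<Sum>i\<in>?I. (\<psi> (w i) (w (i + 1)))\<^sup>2)"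
      unfolding x_def sum_distrib_left by (simp add: power_mult_distrib)
    moreover have "a\<^sup>2 = t\<^sup>2 / real n" using n by (simp add: a_def power_divide)
    ultimately show ?thesis using n by (simp add: right_diff_distrib)
  qed
  also have "\<bar>\<dots>\<bar> = t\<^sup>2 / (2 * real n) * \<bar>(\<Sum>i\<in>?I. (\<psi> (w i) (w (i + 1)))\<^sup>2) - real n * kernel_variance\<bar>"
    by (simp add: abs_mult)
  finally have Uc: "\<bar>U - c\<bar> \<le> t\<^sup>2 / (2 * real n) * \<bar>(\<Sum>i\<in>?I. (\<psi> (w i) (w (i + 1)))\<^sup>2) - real n * kernel_variance\<bar>" .
  have "cmod (T * complex_of_real U - T * complex_of_real c) = cmod T * \<bar>U - c\<bar>"
    by (simp add: norm_mult flip: right_diff_distrib of_real_diff)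
  also have "\<dots> \<le> exp (t\<^sup>2 / 2) * (t\<^sup>2 / (2 * real n) * \<bar>(\<Sum>i\<in>?I. (\<psi> (w i) (w (i + 1)))\<^sup>2) - real n * kernel_variance\<bar>)"
    using T_bd Uc by (intro mult_mono) auto
  finally have 2: "cmod (T * complex_of_real U - T * complex_of_real c)
    \<le> exp (t\<^sup>2 / 2) * (t\<^sup>2 / (2 * real n) * \<bar>(\<Sum>i\<in>?I. (\<psi> (w i) (w (i + 1)))\<^sup>2) - real n * kernel_variance\<bar>)" .
  have "cmod (iexp (t * kernel_sum n w) - T * complex_of_real c)
      \<le> cmod (iexp (t * kernel_sum n w) - T * complex_of_real U) + cmod (T * complex_of_real U - T * complex_of_real c)"
    using norm_triangle_ineq[of "iexp (t * kernel_sum n w) - T * complex_of_real U" "T * complex_of_real U - T * complex_of_real c"] by simp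
  with 1 2 show ?thesis unfolding T_def x_def by linarith
qed

text \<open>As \<open>T\<close> has expectation one, the comparison with \<open>T * c\<close> is a comparison with \<open>c\<close> after integration.\<close>

lemma char_kernel_sum_estimate:
  fixes t :: real and n :: nat
  assumes n: "n \<ge> 1"
  shows "cmod ((\<integral>w. iexp (t * kernel_sum n w) \<partial>P) - complex_of_real (exp (- (t\<^sup>2 * kernel_variance / 2))))
    \<le> 2 * \<bar>t\<bar> ^ 3 / sqrt (real n) + exp (t\<^sup>2 / 2) * (t\<^sup>2 / (2 * real n) * (2 * sqrt (real n) + 1))"
proof -
  define c where "c = complex_of_real (exp (- (t\<^sup>2 * kernel_variance / 2)))"
  define a where "a = t / sqrt (real n)"
  let ?T = "\<lambda>w. \<Prod>i\<in>{1..<n}. 1 + \<i> * complex_of_real (a * \<psi> (w i) (w (i + 1)))"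
  let ?V = "\<lambda>w. \<bar>(\<Sum>i\<in>{1..<n}. (\<psi> (w i) (w (i + 1)))\<^sup>2) - real n * kernel_variance\<bar>"
  let ?H = "\<lambda>w. 2 * \<bar>t\<bar> ^ 3 / sqrt (real n) + exp (t\<^sup>2 / 2) * (t\<^sup>2 / (2 * real n) * ?V w)"
  have T1: "(\<integral>w. ?T w \<partial>P) = 1" by (rule martingale_product)
  have iT: "integrable P ?T"
    using T1 not_integrable_integral_eq[of P ?T] by (cases "integrable P ?T") (simp_all only: zero_neq_one if_True simp_thms)
  have iE: "integrable P (\<lambda>w. iexp (t * kernel_sum n w))"
    by (rule P.integrable_bounded[of _ 1]) auto
  have iV: "integrable P ?V"
  proof (rule P.integrable_bounded[of _ "2 * real n"])
    fix w :: "nat \<Rightarrow> real"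
    have "(\<Sum>i\<in>{1..<n}. (\<psi> (w i) (w (i + 1)))\<^sup>2) \<le> (\<Sum>i\<in>{1..<n}. 1)" by (intro sum_mono \<psi>_sq)
    moreover have "0 \<le> (\<Sum>i\<in>{1..<n}. (\<psi> (w i) (w (i + 1)))\<^sup>2)" by (intro sum_nonneg \<psi>_sq)
    moreover have "0 \<le> real n * kernel_variance" "real n * kernel_variance \<le> real n" using kernel_variance_bounds by (auto simp: mult_left_le)
    ultimately show "norm (?V w) \<le> 2 * real n" by simp
  qed simp
  have eq: "(\<integral>w. iexp (t * kernel_sum n w) \<partial>P) - c = (\<integral>w. iexp (t * kernel_sum n w) - ?T w * c \<partial>P)"
  proof -
    have "(\<integral>w. iexp (t * kernel_sum n w) - ?T w * c \<partial>P) = (\<integral>w. iexp (t * kernel_sum n w) \<partial>P) - (\<integral>w. ?T w \<partial>P) * c"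
      using iT iE by (subst Bochner_Integration.integral_diff) simp_all
    then show ?thesis unfolding T1 by simp
  qed
  have "cmod ((\<integral>w. iexp (t * kernel_sum n w) \<partial>P) - c) \<le> (\<integral>w. ?H w \<partial>P)"
    unfolding eq
  proof (rule order.trans[OF integral_norm_bound], rule integral_mono_AE)
    show "AE w in P. cmod (iexp (t * kernel_sum n w) - ?T w * c) \<le> ?H w"
      unfolding a_def c_def by (intro always_eventually allI char_kernel_sum_pointwise[OF n])
  next
    show "integrable P (\<lambda>w. cmod (iexp (t * kernel_sum n w) - ?T w * c))"
      by (intro integrable_norm Bochner_Integration.integrable_diff integrable_mult_left iT iE)
    show "integrable P ?H"
      by (intro Bochner_Integration.integrable_add integrable_mult_right iV) simp
  qed
  also have "\<dots> = 2 * \<bar>t\<bar> ^ 3 / sqrt (real n) + exp (t\<^sup>2 / 2) * (t\<^sup>2 / (2 * real n) * (\<integral>w. ?V w \<partial>P))"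
  proof -
    have lin: "(\<integral>w. k1 + k2 * (k3 * f w) \<partial>P) = k1 + k2 * (k3 * (\<integral>w. f w \<partial>P))"
      if "integrable P f" for f :: "(nat \<Rightarrow> real) \<Rightarrow> real" and k1 k2 k3
      using that by (simp add: P.prob_space)
    show ?thesis by (rule lin[OF iV])
  qed
  also have "\<dots> \<le> 2 * \<bar>t\<bar> ^ 3 / sqrt (real n) + exp (t\<^sup>2 / 2) * (t\<^sup>2 / (2 * real n) * (2 * sqrt (real n) + 1))"
    using sum_\<psi>_sq_deviation[OF n] by (intro add_left_mono mult_left_mono) auto
  finally show ?thesis unfolding c_def .
qed

end

section \<open>The rank identity\<close>

lemma rank_le_eq_sum: "real (rank_le n w i) = (\<Sum>l=1..n. if w l \<le> w i then 1 else 0)"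
  unfolding rank_le_def by (simp add: sum.If_cases Int_def)

lemma rank_ge_eq_sum: "real (rank_ge n w l) = (\<Sum>j=1..n. if w l \<le> w j then 1 else 0)"
  unfolding rank_ge_def by (simp add: sum.If_cases Int_def)

lemma sum_sq_consecutive_diff:
  fixes u :: "nat \<Rightarrow> real"
  assumes "n \<ge> 1"
  shows "(\<Sum>i\<in>{1..<n}. (u (i + 1) - u i)\<^sup>2)
    = 2 * (\<Sum>i=1..n. (u i)\<^sup>2) - (u 1)\<^sup>2 - (u n)\<^sup>2 - 2 * (\<Sum>i\<in>{1..<n}. u i * u (i + 1))"
  using assms
proof (induction n rule: dec_induct)
  case (step n)
  then have "{1..<Suc n} = insert n {1..<n}" "{1..Suc n} = insert (Suc n) {1..n}" by auto
  with step.IH show ?case by (simp add: power2_eq_square algebra_simps)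
qed simp

text \<open>Both sides are \<open>(card J)\<^sup>2\<close> times the empirical variance of the \<open>h j\<close>, which is invariant under a shift by \<open>g\<close>;
  for indicators it is \<open>p (1 - p)\<close> with \<open>p\<close> the mean.\<close>

lemma sum_indicator_variance:
  fixes h :: "'i \<Rightarrow> real"
  assumes h: "\<And>j. j \<in> J \<Longrightarrow> h j = 0 \<or> h j = 1"
  shows "(\<Sum>j\<in>J. h j) * (real (card J) - (\<Sum>j\<in>J. h j))
    = real (card J) * (\<Sum>j\<in>J. (h j - g)\<^sup>2) - (\<Sum>j\<in>J. h j - g)\<^sup>2"
proof -
  have sq: "(\<Sum>j\<in>J. (h j)\<^sup>2) = (\<Sum>j\<in>J. h j)"
  proof (intro sum.cong refl)
    fix j assume "j \<in> J"
    then show "(h j)\<^sup>2 = h j" using h[of j] by auto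
  qed
  have V: "(\<Sum>j\<in>J. (h j - g)\<^sup>2) = (\<Sum>j\<in>J. (h j)\<^sup>2) - 2 * g * (\<Sum>j\<in>J. h j) + real (card J) * g\<^sup>2"
    by (simp add: power2_diff sum.distrib sum_subtractf sum_distrib_left sum_distrib_right mult_ac)
  have L: "(\<Sum>j\<in>J. h j - g) = (\<Sum>j\<in>J. h j) - real (card J) * g"
    by (simp add: sum_subtractf)
  show ?thesis
    unfolding V L sq by (simp add: power2_eq_square algebra_simps)
qed

text \<open>The sets \<open>{l. w l \<le> w i}\<close> are totally ordered by inclusion, so the difference of their cardinalities is
  the size of the symmetric difference, that is, the sum of the squared differences of the indicators.
  The shift by \<open>g l\<close> cancels in each of them.\<close>

lemma rank_jump_eq:
  "\<bar>real (rank_le n w (i + 1)) - real (rank_le n w i)\<bar>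
    = (\<Sum>l=1..n. (((if w l \<le> w (i + 1) then 1 else 0) - g l) - ((if w l \<le> w i then 1 else 0) - g l))\<^sup>2)"
    (is "?lhs = (\<Sum>l=1..n. ?f l)")
proof (cases "w i \<le> w (i + 1)")
  case True
  then have "?f l = (if w l \<le> w (i + 1) then 1 else 0) - (if w l \<le> w i then 1 else 0)" for l by auto
  then have "(\<Sum>l=1..n. ?f l) = real (rank_le n w (i + 1)) - real (rank_le n w i)"
    unfolding rank_le_eq_sum by (simp only: sum_subtractf)
  moreover have "0 \<le> (\<Sum>l=1..n. ?f l)" by (intro sum_nonneg) simp
  ultimately show ?thesis by linarith
next
  case False
  then have "?f l = (if w l \<le> w i then 1 else 0) - (if w l \<le> w (i + 1) then 1 else 0)" for l by auto
  then have "(\<Sum>l=1..n. ?f l) = real (rank_le n w i) - real (rank_le n w (i + 1))"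
    unfolding rank_le_eq_sum by (simp only: sum_subtractf)
  moreover have "0 \<le> (\<Sum>l=1..n. ?f l)" by (intro sum_nonneg) simp
  ultimately show ?thesis by linarith
qed

definition rank_den :: "nat \<Rightarrow> (nat \<Rightarrow> real) \<Rightarrow> real" where
  "rank_den n w = (\<Sum>i=1..n. real (rank_ge n w i) * (real n - real (rank_ge n w i)))"

definition rank_jumps :: "nat \<Rightarrow> (nat \<Rightarrow> real) \<Rightarrow> real" where
  "rank_jumps n w = (\<Sum>i\<in>{1..<n}. \<bar>real (rank_le n w (i + 1)) - real (rank_le n w i)\<bar>)"

lemma xi_eq:
  assumes "n \<ge> 1"
  shows "xi c n p y = (if rank_den n (\<lambda>i. y (p i)) = 0 then c
    else 1 - real n * rank_jumps n (\<lambda>i. y (p i)) / (2 * rank_den n (\<lambda>i. y (p i))))"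
proof -
  have "{1..n - 1} = {1..<n}" using assms by auto
  then show ?thesis by (simp add: xi_def rank_den_def rank_jumps_def Let_def)
qed

lemma xi_id_eq:
  assumes "n \<ge> 1"
  shows "xi c n id w = (if rank_den n w = 0 then c else 1 - real n * rank_jumps n w / (2 * rank_den n w))"
  by (subst xi_eq[OF assms]) simp

lemma xi_measurable:
  fixes v :: "'a \<Rightarrow> nat \<Rightarrow> real"
  assumes v: "\<And>i. i \<in> {1..n} \<Longrightarrow> (\<lambda>x. v x i) \<in> borel_measurable M"
  shows "(\<lambda>x. xi c n id (v x)) \<in> borel_measurable M"
proof (cases "n = 0")
  case True
  then show ?thesis by (simp add: xi_def)
next
  case False
  have h: "(\<lambda>x. if v x l \<le> v x i then 1 else 0 :: real) \<in> borel_measurable M" if "l \<in> {1..n}" "i \<in> {1..n}" for l i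
    using v that by measurable
  have le: "(\<lambda>x. real (rank_le n (v x) i)) \<in> borel_measurable M" if "i \<in> {1..n}" for i
    unfolding rank_le_eq_sum using that by (intro borel_measurable_sum h)
  have ge: "(\<lambda>x. real (rank_ge n (v x) i)) \<in> borel_measurable M" if "i \<in> {1..n}" for i
    unfolding rank_ge_eq_sum using that by (intro borel_measurable_sum h)
  have d: "(\<lambda>x. rank_den n (v x)) \<in> borel_measurable M"
    unfolding rank_den_def by (intro borel_measurable_sum borel_measurable_times borel_measurable_diff borel_measurable_const ge)
  have j: "(\<lambda>x. rank_jumps n (v x)) \<in> borel_measurable M"
    unfolding rank_jumps_def by (intro borel_measurable_sum borel_measurable_abs borel_measurable_diff le) auto
  show ?thesis
    using d j False by (simp add: xi_id_eq)
qed

lemma xi_permute: "xi c n p y = xi c n id (\<lambda>i. y (p i))"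
  by (simp add: xi_def)

lemma xi_restrict: "xi c n id (\<lambda>i\<in>{1..n}. y i) = xi c n id y"
proof (cases "n = 0")
  case False
  have "rank_ge n (restrict y {1..n}) i = rank_ge n y i" "rank_le n (restrict y {1..n}) i = rank_le n y i" if "i \<in> {1..n}" for i
    using that unfolding rank_ge_def rank_le_def by (intro arg_cong[of _ _ card]; force)+
  then have "rank_den n (restrict y {1..n}) = rank_den n y" "rank_jumps n (restrict y {1..n}) = rank_jumps n y"
    unfolding rank_den_def rank_jumps_def by (auto intro!: sum.cong)
  moreover have "n \<ge> 1" using False by simp
  ultimately show ?thesis by (simp only: xi_id_eq)
qed (simp add: xi_def)

text \<open>The identity holds for every shift \<open>g\<close>. Below, \<open>g l\<close> is the value of \<open>G\<close> at the \<open>l\<close>-th observation,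
  which turns the \<open>u i l\<close> into variables centred given that observation.\<close>

lemma rank_identity:
  fixes g :: "nat \<Rightarrow> real" and w :: "nat \<Rightarrow> real" and n :: nat
  assumes "n \<ge> 1"
  defines "u \<equiv> \<lambda>i l. (if w l \<le> w i then 1 else 0) - g l"
  shows "2 * rank_den n w - real n * rank_jumps n w
    = (\<Sum>l=1..n. 2 * real n * (\<Sum>i\<in>{1..<n}. u i l * u (i + 1) l)
        + real n * ((u 1 l)\<^sup>2 + (u n l)\<^sup>2) - 2 * (\<Sum>j=1..n. u j l)\<^sup>2)"
proof -
  have "rank_jumps n w = (\<Sum>i\<in>{1..<n}. \<Sum>l=1..n. (u (i + 1) l - u i l)\<^sup>2)"
    unfolding rank_jumps_def u_def by (subst rank_jump_eq[of n w _ g]) (rule refl)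
  also have "\<dots> = (\<Sum>l=1..n. \<Sum>i\<in>{1..<n}. (u (i + 1) l - u i l)\<^sup>2)" by (rule sum.swap)
  finally have A: "rank_jumps n w = (\<Sum>l=1..n. 2 * (\<Sum>i=1..n. (u i l)\<^sup>2) - (u 1 l)\<^sup>2 - (u n l)\<^sup>2
      - 2 * (\<Sum>i\<in>{1..<n}. u i l * u (i + 1) l))"
    by (simp only: sum_sq_consecutive_diff[OF assms(1), of "\<lambda>i. u i _"])
  have B: "rank_den n w = (\<Sum>l=1..n. real n * (\<Sum>j=1..n. (u j l)\<^sup>2) - (\<Sum>j=1..n. u j l)\<^sup>2)"
    unfolding rank_den_def
  proof (rule sum.cong[OF refl])
    fix l
    show "real (rank_ge n w l) * (real n - real (rank_ge n w l))
      = real n * (\<Sum>j=1..n. (u j l)\<^sup>2) - (\<Sum>j=1..n. u j l)\<^sup>2"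
      using sum_indicator_variance[of "{1..n}" "\<lambda>j. if w l \<le> w j then 1 else 0" "g l"]
      by (simp add: rank_ge_eq_sum u_def)
  qed
  show ?thesis
  proof -
    have lin: "2 * (\<Sum>l=1..n. real n * a l - c l) - real n * (\<Sum>l=1..n. 2 * a l - b1 l - bn l - 2 * d l)
        = (\<Sum>l=1..n. 2 * real n * d l + real n * (b1 l + bn l) - 2 * c l)" for a b1 bn c d :: "nat \<Rightarrow> real"
      unfolding sum.distrib sum_subtractf sum_distrib_left[symmetric] by (simp add: algebra_simps)
    show ?thesis unfolding A B by (rule lin)
  qed
qed

section \<open>Limit of the coefficient for a sample in the given order\<close>

context sampling
begin

definition row_sum :: "nat \<Rightarrow> nat \<Rightarrow> (nat \<Rightarrow> real) \<Rightarrow> real" where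
  "row_sum n l w = (\<Sum>j=1..n. e (w j) (w l))"

lemma row_sum_measurable [measurable]: "row_sum n l \<in> borel_measurable P"
  unfolding row_sum_def by measurable

lemma row_sum_bound: "\<bar>row_sum n l w\<bar> \<le> real n"
proof -
  have "\<bar>row_sum n l w\<bar> \<le> (\<Sum>j=1..n. \<bar>e (w j) (w l)\<bar>)" unfolding row_sum_def by (rule sum_abs)
  also have "\<dots> \<le> (\<Sum>j=1..n. 1)" by (intro sum_mono e_bound)
  finally show ?thesis by simp
qed

lemma row_sum_sq_bound: "(row_sum n l w)\<^sup>2 \<le> (real n)\<^sup>2"
  using power_mono[OF row_sum_bound[of n l w], of 2] by simp

lemma sum_row_sum_sq_expectation: "(\<integral>w. (\<Sum>l=1..n. (row_sum n l w)\<^sup>2) \<partial>P) \<le> (real n)\<^sup>2"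
proof -
  have "(\<integral>w. (\<Sum>l=1..n. (row_sum n l w)\<^sup>2) \<partial>P) = (\<Sum>l=1..n. (\<integral>w. (row_sum n l w)\<^sup>2 \<partial>P))"
    using row_sum_sq_bound by (intro Bochner_Integration.integral_sum P.integrable_bounded[of _ "(real n)\<^sup>2"]) auto
  also have "\<dots> \<le> (\<Sum>l=1..n. real n)"
    unfolding row_sum_def by (intro sum_mono row_sum_sq_expectation)
  finally show ?thesis by (simp add: power2_eq_square)
qed

lemma integrable_sum_row_sum_sq: "integrable P (\<lambda>w. \<Sum>l=1..n. (row_sum n l w)\<^sup>2)"
  using row_sum_sq_bound by (intro Bochner_Integration.integrable_sum P.integrable_bounded[of _ "(real n)\<^sup>2"]) auto

definition far_sum :: "nat \<Rightarrow> (nat \<Rightarrow> real) \<Rightarrow> real" where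
  "far_sum n w = (\<Sum>a\<in>far_pairs n. \<rho> (fst a) (snd a) w)"

lemma far_sum_measurable [measurable]: "far_sum n \<in> borel_measurable P"
  unfolding far_sum_def by measurable

lemma far_sum_bound: "\<bar>far_sum n w\<bar> \<le> 2 * real (card (far_pairs n))"
proof -
  have "\<bar>far_sum n w\<bar> \<le> (\<Sum>a\<in>far_pairs n. \<bar>\<rho> (fst a) (snd a) w\<bar>)" unfolding far_sum_def by (rule sum_abs)
  also have "\<dots> \<le> (\<Sum>a\<in>far_pairs n. 2)" by (intro sum_mono \<rho>_bound)
  finally show ?thesis by simp
qed

lemma integrable_far_sum: "integrable P (\<lambda>w. \<bar>far_sum n w\<bar>)"
  using far_sum_bound by (intro P.integrable_bounded[of _ "2 * real (card (far_pairs n))"]) auto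

lemma far_sum_expectation: "(\<integral>w. \<bar>far_sum n w\<bar> \<partial>P) \<le> 6 * real n"
proof -
  have "(\<integral>w. \<bar>far_sum n w\<bar> \<partial>P) \<le> sqrt (28 * (real n)\<^sup>2)"
    using \<rho>_sum_second_moment[of n] unfolding far_sum_def[symmetric]
    by (intro P.expectation_abs_le_sqrt[OF _ far_sum_bound]) simp_all
  also have "\<dots> \<le> sqrt ((6 * real n)\<^sup>2)" by (subst real_sqrt_le_iff) (simp add: power_mult_distrib)
  also have "sqrt ((6 * real n)\<^sup>2) = 6 * real n" by (subst real_sqrt_abs) simp
  finally show ?thesis .
qed

lemma consecutive_product_sum:
  fixes n :: nat
  shows "\<bar>(\<Sum>l=1..n. \<Sum>i\<in>{1..<n}. e (w i) (w l) * e (w (i + 1)) (w l))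
      - real n * (\<Sum>i\<in>{1..<n}. \<psi> (w i) (w (i + 1))) - far_sum n w\<bar> \<le> 4 * real n"
proof -
  let ?near = "{a \<in> {1..<n} \<times> {1..n}. \<not> (snd a \<noteq> fst a \<and> snd a \<noteq> fst a + 1)}"
  have "(\<Sum>l=1..n. \<Sum>i\<in>{1..<n}. e (w i) (w l) * e (w (i + 1)) (w l))
      = (\<Sum>i\<in>{1..<n}. \<Sum>l=1..n. e (w i) (w l) * e (w (i + 1)) (w l))" by (rule sum.swap)
  also have "\<dots> - real n * (\<Sum>i\<in>{1..<n}. \<psi> (w i) (w (i + 1))) = (\<Sum>i\<in>{1..<n}. \<Sum>l=1..n. \<rho> i l w)"
    unfolding \<rho>_def by (simp add: sum_subtractf sum_distrib_left)
  also have "\<dots> = (\<Sum>a\<in>{1..<n} \<times> {1..n}. \<rho> (fst a) (snd a) w)"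
    by (simp add: sum.cartesian_product case_prod_unfold)
  also have "\<dots> = far_sum n w + (\<Sum>a\<in>?near. \<rho> (fst a) (snd a) w)"
    unfolding far_sum_def far_pairs_def by (subst sum.union_disjoint[symmetric]) (auto intro!: sum.cong)
  finally have eq: "(\<Sum>l=1..n. \<Sum>i\<in>{1..<n}. e (w i) (w l) * e (w (i + 1)) (w l))
      - real n * (\<Sum>i\<in>{1..<n}. \<psi> (w i) (w (i + 1))) = far_sum n w + (\<Sum>a\<in>?near. \<rho> (fst a) (snd a) w)" .
  have "card ?near \<le> card ((\<lambda>i. (i, i)) ` {1..<n} \<union> (\<lambda>i. (i, i + 1)) ` {1..<n})"
    by (intro card_mono) auto
  also have "\<dots> \<le> card ((\<lambda>i. (i, i)) ` {1..<n}) + card ((\<lambda>i. (i, i + 1)) ` {1..<n})" by (rule card_Un_le)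
  also have "\<dots> \<le> card {1..<n} + card {1..<n}" by (intro add_mono card_image_le) auto
  finally have card: "card ?near \<le> 2 * n" by simp
  have "\<bar>\<Sum>a\<in>?near. \<rho> (fst a) (snd a) w\<bar> \<le> (\<Sum>a\<in>?near. \<bar>\<rho> (fst a) (snd a) w\<bar>)" by (rule sum_abs)
  also have "\<dots> \<le> (\<Sum>a\<in>?near. 2)" by (intro sum_mono \<rho>_bound)
  also have "\<dots> = 2 * real (card ?near)" by simp
  also have "\<dots> \<le> 4 * real n" using of_nat_mono[OF card, where 'a=real] by simp
  finally have near: "\<bar>\<Sum>a\<in>?near. \<rho> (fst a) (snd a) w\<bar> \<le> 4 * real n" .
  have *: "\<bar>x - y - z\<bar> \<le> m" if "x - y = z + v" "\<bar>v\<bar> \<le> m" for x y z v m :: real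
    using that by linarith
  show ?thesis by (rule *[OF eq near])
qed

text \<open>Up to a factor two, the left-hand side of the rank identity on its natural scale; the
  normalisations are such that \<open>\<surd>n * \<xi>\<^sub>n\<close> is the quotient of \<open>scaled_num\<close> and \<open>scaled_den\<close>.\<close>

definition scaled_num :: "nat \<Rightarrow> (nat \<Rightarrow> real) \<Rightarrow> real" where
  "scaled_num n w = (2 * rank_den n w - real n * rank_jumps n w) / (2 * (real n)\<^sup>2 * sqrt (real n))"

definition scaled_den :: "nat \<Rightarrow> (nat \<Rightarrow> real) \<Rightarrow> real" where
  "scaled_den n w = rank_den n w / real n ^ 3"

lemma rank_den_measurable [measurable]: "rank_den n \<in> borel_measurable P"
  unfolding rank_den_def rank_ge_eq_sum by measurable

lemma rank_jumps_measurable [measurable]: "rank_jumps n \<in> borel_measurable P"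
  unfolding rank_jumps_def rank_le_eq_sum by measurable

lemma scaled_num_measurable [measurable]: "scaled_num n \<in> borel_measurable P"
  unfolding scaled_num_def by measurable

lemma scaled_den_measurable [measurable]: "scaled_den n \<in> borel_measurable P"
  unfolding scaled_den_def by measurable

text \<open>In the rank identity, the boundary terms and the pairs with \<open>l \<in> {i, i + 1}\<close> contribute at most
  \<open>5 * n\<close> on the scale of \<open>far_sum\<close>.\<close>

lemma scaled_num_approx:
  fixes n :: nat
  assumes n: "n \<ge> 1"
  shows "\<bar>scaled_num n w - kernel_sum n w\<bar> \<le>
    (\<bar>far_sum n w\<bar> + 5 * real n) / (real n * sqrt (real n)) + (\<Sum>l=1..n. (row_sum n l w)\<^sup>2) / ((real n)\<^sup>2 * sqrt (real n))"
proof -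
  define Q where "Q = (\<Sum>l=1..n. \<Sum>i\<in>{1..<n}. e (w i) (w l) * e (w (i + 1)) (w l))"
  define E where "E = (\<Sum>l=1..n. (e (w 1) (w l))\<^sup>2 + (e (w n) (w l))\<^sup>2)"
  define T where "T = (\<Sum>l=1..n. (row_sum n l w)\<^sup>2)"
  define s where "s = sqrt (real n)"
  define D where "D = (\<Sum>i\<in>{1..<n}. \<psi> (w i) (w (i + 1)))"
  have s: "s > 0" using n by (simp add: s_def)
  have np: "real n > 0" using n by simp
  have "2 * rank_den n w - real n * rank_jumps n w
    = (\<Sum>l=1..n. 2 * real n * (\<Sum>i\<in>{1..<n}. e (w i) (w l) * e (w (i + 1)) (w l))
        + real n * ((e (w 1) (w l))\<^sup>2 + (e (w n) (w l))\<^sup>2) - 2 * (row_sum n l w)\<^sup>2)"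
    unfolding e_def row_sum_def by (rule rank_identity[OF n])
  also have "\<dots> = 2 * real n * Q + real n * E - 2 * T"
  proof -
    have lin: "(\<Sum>l=1..n. 2 * real n * a l + real n * b l - 2 * c l)
        = 2 * real n * (\<Sum>l=1..n. a l) + real n * (\<Sum>l=1..n. b l) - 2 * (\<Sum>l=1..n. c l)" for a b c :: "nat \<Rightarrow> real"
      by (simp add: sum.distrib sum_subtractf flip: sum_distrib_left)
    show ?thesis unfolding Q_def E_def T_def by (rule lin)
  qed
  finally have id: "2 * rank_den n w - real n * rank_jumps n w = 2 * real n * Q + real n * E - 2 * T" .
  have "0 \<le> E" unfolding E_def by (intro sum_nonneg) simp
  have "E \<le> (\<Sum>l=1..n. 2)"
    unfolding E_def
  proof (rule sum_mono)
    fix l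
    have "(e x (w l))\<^sup>2 \<le> 1" for x using e_bound[of x "w l"] by (simp add: abs_square_le_1)
    from add_mono[OF this this] show "(e (w 1) (w l))\<^sup>2 + (e (w n) (w l))\<^sup>2 \<le> 2" by simp
  qed
  then have "E \<le> 2 * real n" by simp
  have "\<bar>Q - real n * D - far_sum n w\<bar> \<le> 4 * real n" unfolding Q_def D_def by (rule consecutive_product_sum)
  then have X: "\<bar>(Q - real n * D) + E / 2\<bar> \<le> \<bar>far_sum n w\<bar> + 5 * real n"
    using \<open>0 \<le> E\<close> \<open>E \<le> 2 * real n\<close> by linarith
  have T: "0 \<le> T" unfolding T_def by (intro sum_nonneg) simp
  have "scaled_num n w - kernel_sum n w = ((Q - real n * D) + E / 2) / (real n * s) - T / ((real n)\<^sup>2 * s)"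
    unfolding scaled_num_def kernel_sum_def id D_def[symmetric] s_def[symmetric]
    using s np by (simp add: field_simps power2_eq_square)
  then have "\<bar>scaled_num n w - kernel_sum n w\<bar> \<le> \<bar>((Q - real n * D) + E / 2) / (real n * s)\<bar> + \<bar>T / ((real n)\<^sup>2 * s)\<bar>"
    by (simp only: abs_triangle_ineq4)
  also have "\<dots> = \<bar>(Q - real n * D) + E / 2\<bar> / (real n * s) + T / ((real n)\<^sup>2 * s)"
    using s np T by (simp add: abs_divide abs_mult)
  also have "\<dots> \<le> (\<bar>far_sum n w\<bar> + 5 * real n) / (real n * s) + T / ((real n)\<^sup>2 * s)"
    using X s np by (intro add_right_mono divide_right_mono) auto
  finally show ?thesis unfolding s_def T_def .
qed

lemma scaled_num_approx_integrable:
  assumes n: "n \<ge> 1"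
  shows "integrable P (\<lambda>w. \<bar>scaled_num n w - kernel_sum n w\<bar>)"
proof (rule Bochner_Integration.integrable_bound)
  show "integrable P (\<lambda>w. (\<bar>far_sum n w\<bar> + 5 * real n) / (real n * sqrt (real n))
      + (\<Sum>l=1..n. (row_sum n l w)\<^sup>2) / ((real n)\<^sup>2 * sqrt (real n)))"
    using integrable_far_sum[of n] integrable_sum_row_sum_sq[of n] by simp
  show "AE w in P. norm \<bar>scaled_num n w - kernel_sum n w\<bar> \<le> norm ((\<bar>far_sum n w\<bar> + 5 * real n) / (real n * sqrt (real n))
      + (\<Sum>l=1..n. (row_sum n l w)\<^sup>2) / ((real n)\<^sup>2 * sqrt (real n)))"
    using scaled_num_approx[OF n] by (intro always_eventually allI) (smt (verit) real_norm_def)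
qed simp

lemma scaled_num_approx_expectation:
  fixes n :: nat
  assumes n: "n \<ge> 1"
  shows "(\<integral>w. \<bar>scaled_num n w - kernel_sum n w\<bar> \<partial>P) \<le> 12 / sqrt (real n)"
proof -
  define k where "k = real n * sqrt (real n)"
  have k: "k > 0" using n by (simp add: k_def)
  have np: "real n > 0" using n by simp
  have i: "integrable P (\<lambda>w. (\<bar>far_sum n w\<bar> + 5 * real n) / k)" "integrable P (\<lambda>w. (\<Sum>l=1..n. (row_sum n l w)\<^sup>2) / (real n * k))"
    using integrable_far_sum[of n] integrable_sum_row_sum_sq[of n] by simp_all
  have "(\<integral>w. \<bar>scaled_num n w - kernel_sum n w\<bar> \<partial>P) \<le> (\<integral>w. (\<bar>far_sum n w\<bar> + 5 * real n) / k + (\<Sum>l=1..n. (row_sum n l w)\<^sup>2) / (real n * k) \<partial>P)"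
    using scaled_num_approx[OF n] i
    by (intro integral_mono scaled_num_approx_integrable[OF n] Bochner_Integration.integrable_add)
      (simp_all add: k_def power2_eq_square mult.assoc)
  also have "\<dots> = ((\<integral>w. \<bar>far_sum n w\<bar> \<partial>P) + 5 * real n) / k + (\<integral>w. (\<Sum>l=1..n. (row_sum n l w)\<^sup>2) \<partial>P) / (real n * k)"
    using i integrable_far_sum[of n] by (simp add: P.prob_space)
  also have "\<dots> \<le> (6 * real n + 5 * real n) / k + (real n)\<^sup>2 / (real n * k)"
    using k np far_sum_expectation[of n] sum_row_sum_sq_expectation[of n]
    by (intro add_mono divide_right_mono) auto
  also have "\<dots> = 12 / sqrt (real n)"
    using np by (simp add: k_def field_simps power2_eq_square)
  finally show ?thesis .
qed

text \<open>The rank \<open>l\<^sub>i\<close> equals \<open>n * G (w i)\<close> up to \<open>row_sum n i w\<close>, and \<open>x (n - x)\<close> is Lipschitz with constant \<open>n\<close> on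
  \<open>[0, n]\<close>.\<close>

lemma scaled_den_deviation:
  fixes n :: nat
  assumes n: "n \<ge> 1"
  shows "(scaled_den n w - den_limit)\<^sup>2 \<le> 2 * ((\<Sum>l=1..n. (row_sum n l w)\<^sup>2) / real n ^ 3)
    + 2 * ((\<Sum>l=1..n. G (w l) * (1 - G (w l)) - den_limit)\<^sup>2 / (real n)\<^sup>2)"
proof -
  define D1 where "D1 = rank_den n w - (real n)\<^sup>2 * (\<Sum>l=1..n. G (w l) * (1 - G (w l)))"
  define D2 where "D2 = (\<Sum>l=1..n. G (w l) * (1 - G (w l)) - den_limit)"
  define T where "T = (\<Sum>l=1..n. (row_sum n l w)\<^sup>2)"
  have np: "real n > 0" using n by simp
  have one: "\<bar>real (rank_ge n w l) * (real n - real (rank_ge n w l)) - (real n)\<^sup>2 * (G (w l) * (1 - G (w l)))\<bar>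
      \<le> real n * \<bar>row_sum n l w\<bar>" for l
  proof -
    let ?r = "real (rank_ge n w l)"
    have r: "?r = real n * G (w l) + row_sum n l w"
      unfolding rank_ge_eq_sum row_sum_def e_def by (simp add: sum_subtractf)
    have "card {j \<in> {1..n}. w j \<ge> w l} \<le> card {1..n}" by (intro card_mono) auto
    then have r_le: "?r \<le> real n" by (simp add: rank_ge_def)
    have "0 \<le> real n * G (w l)" "real n * G (w l) \<le> real n"
      using G_bounds[of "w l"] by (auto simp: mult_left_le)
    then have bd: "\<bar>real n - ?r - real n * G (w l)\<bar> \<le> real n"
      using r_le by simp
    \<comment> \<open>This factorisation is the Lipschitz estimate: \<open>x (n - x) - y (n - y) = (n - x - y) (x - y)\<close>.\<close>
    have "?r * (real n - ?r) - (real n)\<^sup>2 * (G (w l) * (1 - G (w l))) = (real n - ?r - real n * G (w l)) * row_sum n l w"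
      unfolding r by (simp add: power2_eq_square algebra_simps)
    then show ?thesis using bd by (simp add: abs_mult mult_right_mono)
  qed
  have "\<bar>D1\<bar> = \<bar>\<Sum>l=1..n. real (rank_ge n w l) * (real n - real (rank_ge n w l)) - (real n)\<^sup>2 * (G (w l) * (1 - G (w l)))\<bar>"
    by (simp add: D1_def rank_den_def sum_subtractf sum_distrib_left)
  also have "\<dots> \<le> (\<Sum>l=1..n. real n * \<bar>row_sum n l w\<bar>)"
    by (intro order.trans[OF sum_abs] sum_mono one)
  finally have D1_le: "\<bar>D1\<bar> \<le> real n * (\<Sum>l=1..n. \<bar>row_sum n l w\<bar>)" by (simp add: sum_distrib_left)
  have CS: "(\<Sum>l=1..n. \<bar>row_sum n l w\<bar>)\<^sup>2 \<le> real n * T"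
    using sum_squared_le_sum_of_squares[of "\<lambda>l. \<bar>row_sum n l w\<bar>" "{1..n}"] by (simp add: T_def mult.commute)
  have "D1\<^sup>2 \<le> (real n * (\<Sum>l=1..n. \<bar>row_sum n l w\<bar>))\<^sup>2"
    using power_mono[OF D1_le, of 2] by simp
  also have "\<dots> \<le> (real n)\<^sup>2 * (real n * T)"
    using CS by (simp add: power_mult_distrib mult_left_mono)
  finally have D1_sq: "D1\<^sup>2 \<le> (real n)\<^sup>2 * (real n * T)" .
  have "scaled_den n w - den_limit = D1 / real n ^ 3 + D2 / real n"
  proof -
    have D2: "(\<Sum>l=1..n. G (w l) * (1 - G (w l))) = D2 + real n * den_limit"
      by (simp add: D2_def sum_subtractf)
    show ?thesis
      unfolding scaled_den_def D1_def D2 using np by (simp add: field_simps power2_eq_square power3_eq_cube)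
  qed
  then have "(scaled_den n w - den_limit)\<^sup>2 \<le> 2 * (D1 / real n ^ 3)\<^sup>2 + 2 * (D2 / real n)\<^sup>2"
    using sum_squares_bound[of "D1 / real n ^ 3" "D2 / real n"] by (simp add: power2_sum)
  also have "(D1 / real n ^ 3)\<^sup>2 \<le> T / real n ^ 3"
  proof -
    have "(D1 / real n ^ 3)\<^sup>2 \<le> ((real n)\<^sup>2 * (real n * T)) / (real n ^ 3)\<^sup>2"
      unfolding power_divide using D1_sq by (intro divide_right_mono) auto
    also have "\<dots> = T / real n ^ 3" using np by (simp add: field_simps power2_eq_square power3_eq_cube)
    finally show ?thesis .
  qed
  finally show ?thesis by (simp add: T_def D2_def power_divide)
qed

lemma scaled_den_bounds: "0 \<le> scaled_den n w" "scaled_den n w \<le> 1"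
proof -
  have r: "0 \<le> real (rank_ge n w i) * (real n - real (rank_ge n w i))"
    "real (rank_ge n w i) * (real n - real (rank_ge n w i)) \<le> (real n)\<^sup>2" for i
  proof -
    have "card {j \<in> {1..n}. w j \<ge> w i} \<le> card {1..n}" by (intro card_mono) auto
    then have *: "0 \<le> real (rank_ge n w i)" "real (rank_ge n w i) \<le> real n" by (simp_all add: rank_ge_def)
    show "0 \<le> real (rank_ge n w i) * (real n - real (rank_ge n w i))" using * by simp
    show "real (rank_ge n w i) * (real n - real (rank_ge n w i)) \<le> (real n)\<^sup>2"
      unfolding power2_eq_square using * by (intro mult_mono) auto
  qed
  have "0 \<le> rank_den n w" unfolding rank_den_def by (intro sum_nonneg r)
  moreover have "rank_den n w \<le> (\<Sum>i=1..n. (real n)\<^sup>2)" unfolding rank_den_def by (intro sum_mono r)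
  ultimately show "0 \<le> scaled_den n w" "scaled_den n w \<le> 1"
    by (auto simp: scaled_den_def power2_eq_square power3_eq_cube divide_simps)
qed

lemma scaled_den_expectation:
  fixes n :: nat
  assumes n: "n \<ge> 1"
  shows "(\<integral>w. (scaled_den n w - den_limit)\<^sup>2 \<partial>P) \<le> 4 / real n"
proof -
  have np: "real n > 0" using n by simp
  let ?T = "\<lambda>w. \<Sum>l=1..n. (row_sum n l w)\<^sup>2"
  let ?B = "\<lambda>w. (\<Sum>l=1..n. G (w l) * (1 - G (w l)) - den_limit)\<^sup>2"
  have "\<bar>\<Sum>l=1..n. G (w l) * (1 - G (w l)) - den_limit\<bar> \<le> real n" for w :: "nat \<Rightarrow> real"
  proof -
    have "\<bar>G (w l) * (1 - G (w l)) - den_limit\<bar> \<le> 1" for l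
      using G_var_bounds[of "w l"] den_limit_bounds unfolding abs_le_iff by linarith
    then have "\<bar>\<Sum>l=1..n. G (w l) * (1 - G (w l)) - den_limit\<bar> \<le> (\<Sum>l=1..n. 1)"
      by (intro order.trans[OF sum_abs] sum_mono)
    then show ?thesis by simp
  qed
  from power_mono[OF this, where n=2] have B_bd: "?B w \<le> (real n)\<^sup>2" for w by simp
  have iB: "integrable P ?B"
    using B_bd by (intro P.integrable_bounded[of _ "(real n)\<^sup>2"]) auto
  have iT: "integrable P ?T" by (rule integrable_sum_row_sum_sq)
  have "(\<integral>w. ?B w \<partial>P) \<le> real (card {1..n})"
    using G_var_bounds unfolding den_limit_def by (intro sum_iid_second_moment) auto
  then have B: "(\<integral>w. ?B w \<partial>P) \<le> real n" by simp
  have sq_bd: "(scaled_den n w - den_limit)\<^sup>2 \<le> 1" for w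
    using scaled_den_bounds[of n w] den_limit_bounds by (simp add: abs_square_le_1 abs_le_iff)
  have "(\<integral>w. (scaled_den n w - den_limit)\<^sup>2 \<partial>P) \<le> (\<integral>w. 2 * (?T w / real n ^ 3) + 2 * (?B w / (real n)\<^sup>2) \<partial>P)"
  proof (rule integral_mono)
    show "integrable P (\<lambda>w. (scaled_den n w - den_limit)\<^sup>2)"
      using sq_bd by (intro P.integrable_bounded[of _ 1]) auto
  qed (use iT iB scaled_den_deviation[OF n] in auto)
  also have "\<dots> = 2 * ((\<integral>w. ?T w \<partial>P) / real n ^ 3) + 2 * ((\<integral>w. ?B w \<partial>P) / (real n)\<^sup>2)"
    using iT iB by simp
  also have "\<dots> \<le> 2 * ((real n)\<^sup>2 / real n ^ 3) + 2 * (real n / (real n)\<^sup>2)"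
    using sum_row_sum_sq_expectation[of n] B by (intro add_mono mult_left_mono divide_right_mono) auto
  also have "\<dots> = 4 / real n" using np by (simp add: power2_eq_square power3_eq_cube)
  finally show ?thesis .
qed

lemma sqrt_xi_eq:
  assumes "n \<ge> 1" and "scaled_den n w \<noteq> 0"
  shows "sqrt (real n) * xi c n id w = scaled_num n w / scaled_den n w"
proof -
  have d: "rank_den n w \<noteq> 0" using assms by (auto simp: scaled_den_def)
  have s: "sqrt (real n) > 0" "real n > 0" using assms by auto
  have ss: "sqrt (real n) * sqrt (real n) = real n" by simp
  have "sqrt (real n) * xi c n id w = sqrt (real n) * ((2 * rank_den n w - real n * rank_jumps n w) / (2 * rank_den n w))"
    using d by (simp add: xi_eq[OF assms(1)] diff_divide_distrib)
  also have "\<dots> = scaled_num n w / scaled_den n w"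
  proof -
    have "x = y / (2 * n'\<^sup>2 * r) / (D / n' ^ 3)" if "r * r = n'" "r > 0" "n' > 0" "D \<noteq> 0" "x = r * (y / (2 * D))"
      for x y n' r D :: real
    proof -
      have "y / (2 * n'\<^sup>2 * r) / (D / n' ^ 3) = y * n' / (2 * r * D)"
        using that by (simp add: field_simps power2_eq_square power3_eq_cube)
      also have "\<dots> = r * (y / (2 * D))"
        unfolding that(1)[symmetric] using that(2,4) by (simp add: field_simps)
      finally show ?thesis using that by simp
    qed
    then show ?thesis unfolding scaled_num_def scaled_den_def using ss s d by blast
  qed
  finally show ?thesis .
qed

lemma kernel_sum_sq_expectation:
  fixes n :: nat
  assumes n: "n \<ge> 1"
  shows "integrable P (\<lambda>w. (kernel_sum n w)\<^sup>2)" "(\<integral>w. (kernel_sum n w)\<^sup>2 \<partial>P) \<le> 1"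
proof -
  have W: "(kernel_sum n w)\<^sup>2 = (\<Sum>i\<in>{1..<n}. \<psi> (w i) (w (i + 1)))\<^sup>2 / real n" for w
    by (simp add: kernel_sum_def power_divide)
  show "(\<integral>w. (kernel_sum n w)\<^sup>2 \<partial>P) \<le> 1"
    unfolding W using sum_\<psi>_second_moment[of n] n by (simp add: divide_le_eq)
  have "\<bar>\<Sum>i\<in>{1..<n}. \<psi> (w i) (w (i + 1))\<bar> \<le> (\<Sum>i\<in>{1..<n}. 1)" for w
    by (intro order.trans[OF sum_abs] sum_mono \<psi>_bound)
  from power_mono[OF this, where n=2]
  have "(\<Sum>i\<in>{1..<n}. \<psi> (w i) (w (i + 1)))\<^sup>2 \<le> (real (n - 1))\<^sup>2" for w by simp
  then have "integrable P (\<lambda>w. (\<Sum>i\<in>{1..<n}. \<psi> (w i) (w (i + 1)))\<^sup>2)"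
    by (intro P.integrable_bounded[of _ "(real (n - 1))\<^sup>2"]) auto
  then show "integrable P (\<lambda>w. (kernel_sum n w)\<^sup>2)" unfolding W by simp
qed

lemma sqrt_xi_measurable:
  "(\<lambda>w. sqrt (real n) * xi c n id w) \<in> borel_measurable P"
  by (intro borel_measurable_times borel_measurable_const xi_measurable measurable_coordinate)

text \<open>If the denominator is below half its limit, which includes the case where the coefficient has an
  arbitrary value, the trivial bound \<open>2\<close> is absorbed by the last summand, as in Chebyshev's inequality.\<close>

lemma char_xi_pointwise:
  fixes n :: nat and t :: real
  assumes n: "n \<ge> 1" and b: "den_limit > 0"
  shows "cmod (iexp (t * (sqrt (real n) * xi c n id w)) - iexp (t / den_limit * kernel_sum n w))
    \<le> \<bar>t\<bar> * (2 / den_limit * \<bar>scaled_num n w - kernel_sum n w\<bar> + ((kernel_sum n w)\<^sup>2 / sqrt (real n) + sqrt (real n) * (scaled_den n w - den_limit)\<^sup>2) / den_limit\<^sup>2)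
      + 8 / den_limit\<^sup>2 * (scaled_den n w - den_limit)\<^sup>2" (is "?L \<le> \<bar>t\<bar> * ?A + ?B")
proof (cases "scaled_den n w \<ge> den_limit / 2")
  case True
  have s: "sqrt (real n) > 0" using n by simp
  have "?L \<le> \<bar>t * (sqrt (real n) * xi c n id w) - t / den_limit * kernel_sum n w\<bar>" by (rule cmod_iexp_diff_le)
  also have "t * (sqrt (real n) * xi c n id w) - t / den_limit * kernel_sum n w = t * (scaled_num n w / scaled_den n w - kernel_sum n w / den_limit)"
    using True b sqrt_xi_eq[OF n, of w c] by (simp add: right_diff_distrib)
  also have "\<bar>\<dots>\<bar> \<le> \<bar>t\<bar> * ?A"
    unfolding abs_mult by (intro mult_left_mono ratio_deviation b True s) simp
  also have "\<dots> \<le> \<bar>t\<bar> * ?A + ?B" by simp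
  finally show ?thesis .
next
  case False
  have "den_limit / 2 \<le> \<bar>scaled_den n w - den_limit\<bar>" using False by linarith
  then have "(den_limit / 2)\<^sup>2 \<le> (scaled_den n w - den_limit)\<^sup>2" using b by (simp add: abs_le_square_iff[symmetric])
  then have B: "2 \<le> ?B" using b by (simp add: power_divide field_simps)
  have "?L \<le> 1 + 1" by (intro order.trans[OF norm_triangle_ineq4] add_mono) auto
  moreover have "0 \<le> ?A" using b n by simp
  ultimately show ?thesis using B mult_nonneg_nonneg[of "\<bar>t\<bar>" ?A] by linarith
qed

lemma char_xi_estimate:
  fixes n :: nat and t :: real
  assumes n: "n \<ge> 1" and b: "den_limit > 0"
  shows "cmod ((\<integral>w. iexp (t * (sqrt (real n) * xi c n id w)) \<partial>P) - (\<integral>w. iexp (t / den_limit * kernel_sum n w) \<partial>P))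
    \<le> \<bar>t\<bar> * (2 / den_limit * (12 / sqrt (real n)) + (1 / sqrt (real n) + sqrt (real n) * (4 / real n)) / den_limit\<^sup>2)
      + 8 / den_limit\<^sup>2 * (4 / real n)"
proof -
  have np: "real n > 0" using n by simp
  let ?N = "\<lambda>w. \<bar>scaled_num n w - kernel_sum n w\<bar>" and ?W = "\<lambda>w. (kernel_sum n w)\<^sup>2" and ?D = "\<lambda>w. (scaled_den n w - den_limit)\<^sup>2"
  let ?x = "\<lambda>w. iexp (t * (sqrt (real n) * xi c n id w))" and ?y = "\<lambda>w. iexp (t / den_limit * kernel_sum n w)"
  let ?H = "\<lambda>N W D. \<bar>t\<bar> * (2 / den_limit * N + (W / sqrt (real n) + sqrt (real n) * D) / den_limit\<^sup>2) + 8 / den_limit\<^sup>2 * D"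
  have "?D w \<le> 1" for w
    using scaled_den_bounds[of n w] den_limit_bounds by (simp add: abs_square_le_1 abs_le_iff)
  then have iD: "integrable P ?D" by (intro P.integrable_bounded[of _ 1]) auto
  have lin: "integrable P (\<lambda>w. ?H (f w) (g w) (h w)) \<and>
      (\<integral>w. ?H (f w) (g w) (h w) \<partial>P) = ?H (\<integral>w. f w \<partial>P) (\<integral>w. g w \<partial>P) (\<integral>w. h w \<partial>P)"
    if "integrable P f" "integrable P g" "integrable P h" for f g h :: "(nat \<Rightarrow> real) \<Rightarrow> real"
    using that by simp
  note lin = lin[OF scaled_num_approx_integrable[OF n] kernel_sum_sq_expectation(1)[OF n] iD]
  have iexp_int: "integrable P (\<lambda>w. iexp (a * Z w))" if "Z \<in> borel_measurable P" for a Z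
  proof -
    have "(\<lambda>x. iexp (a * x)) \<in> borel_measurable borel" by measurable
    from measurable_compose[OF that this] show ?thesis
      by (rule P.integrable_bounded[of _ 1]) (simp only: norm_exp_i_times)
  qed
  have ix: "integrable P ?x" by (rule iexp_int[OF sqrt_xi_measurable])
  have iy: "integrable P ?y" by (rule iexp_int[OF kernel_sum_measurable])
  have "(\<integral>w. ?x w \<partial>P) - (\<integral>w. ?y w \<partial>P) = (\<integral>w. ?x w - ?y w \<partial>P)"
    using ix iy by (rule Bochner_Integration.integral_diff[symmetric])
  then have "cmod ((\<integral>w. ?x w \<partial>P) - (\<integral>w. ?y w \<partial>P)) = cmod (\<integral>w. ?x w - ?y w \<partial>P)" by (rule arg_cong)
  moreover have "cmod (\<integral>w. ?x w - ?y w \<partial>P) \<le> (\<integral>w. cmod (?x w - ?y w) \<partial>P)" by (rule integral_norm_bound)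
  moreover have "(\<integral>w. cmod (?x w - ?y w) \<partial>P) \<le> (\<integral>w. ?H (?N w) (?W w) (?D w) \<partial>P)"
  proof (rule integral_mono)
    show "integrable P (\<lambda>w. cmod (?x w - ?y w))"
      by (intro integrable_norm Bochner_Integration.integrable_diff ix iy)
    show "integrable P (\<lambda>w. ?H (?N w) (?W w) (?D w))" using lin by (rule conjunct1)
    show "cmod (?x w - ?y w) \<le> ?H (?N w) (?W w) (?D w)" for w
      by (rule char_xi_pointwise[OF n b])
  qed
  moreover have "(\<integral>w. ?H (?N w) (?W w) (?D w) \<partial>P) = ?H (\<integral>w. ?N w \<partial>P) (\<integral>w. ?W w \<partial>P) (\<integral>w. ?D w \<partial>P)"
    using lin by (rule conjunct2)
  moreover have "?H (\<integral>w. ?N w \<partial>P) (\<integral>w. ?W w \<partial>P) (\<integral>w. ?D w \<partial>P) \<le> ?H (12 / sqrt (real n)) 1 (4 / real n)"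
    using b np scaled_num_approx_expectation[OF n] kernel_sum_sq_expectation(2)[OF n] scaled_den_expectation[OF n]
    by (intro add_mono mult_left_mono divide_right_mono) auto
  ultimately show ?thesis by linarith
qed

theorem char_xi_tendsto:
  fixes t :: real and c :: "nat \<Rightarrow> real"
  assumes b: "den_limit > 0"
  shows "(\<lambda>n. \<integral>w. iexp (t * (sqrt (real n) * xi (c n) n id w)) \<partial>P)
    \<longlonglongrightarrow> complex_of_real (exp (- ((t / den_limit)\<^sup>2 * kernel_variance / 2)))"
proof -
  let ?x = "\<lambda>n. \<integral>w. iexp (t * (sqrt (real n) * xi (c n) n id w)) \<partial>P"
  let ?y = "\<lambda>n. \<integral>w. iexp (t / den_limit * kernel_sum n w) \<partial>P"
  let ?l = "complex_of_real (exp (- ((t / den_limit)\<^sup>2 * kernel_variance / 2)))"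
  define u where "u = \<bar>t / den_limit\<bar>"
  let ?E = "\<lambda>n. (\<bar>t\<bar> * (2 / den_limit * (12 / sqrt (real n)) + (1 / sqrt (real n) + sqrt (real n) * (4 / real n)) / den_limit\<^sup>2)
      + 8 / den_limit\<^sup>2 * (4 / real n)) +
     (2 * u ^ 3 / sqrt (real n) + exp ((t / den_limit)\<^sup>2 / 2) * ((t / den_limit)\<^sup>2 / (2 * real n) * (2 * sqrt (real n) + 1)))"
  have lim: "?E \<longlonglongrightarrow> 0"
    using b by real_asymp
  have le: "cmod (?x n - ?l) \<le> ?E n" if n: "n \<ge> 1" for n
  proof -
    have "cmod (?x n - ?l) \<le> cmod (?x n - ?y n) + cmod (?y n - ?l)"
      using norm_triangle_ineq[of "?x n - ?y n" "?y n - ?l"] by simp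
    then show ?thesis
      using char_xi_estimate[OF n b, of t "c n"] char_kernel_sum_estimate[OF n, of "t / den_limit"] unfolding u_def by linarith
  qed
  have "(\<lambda>n. ?x n - ?l) \<longlonglongrightarrow> 0"
    by (rule Lim_null_comparison[OF _ lim]) (use le in \<open>auto simp: eventually_sequentially\<close>)
  then show ?thesis by (simp add: LIM_zero_iff)
qed

theorem xi_clt:
  fixes c :: "nat \<Rightarrow> real"
  assumes b: "den_limit > 0" and kernel_variance: "kernel_variance > 0"
  shows "weak_conv_m (\<lambda>n. distr P borel (\<lambda>w. sqrt (real n) * xi (c n) n id w))
    (density lborel (normal_density 0 (sqrt (kernel_variance / den_limit\<^sup>2))))"
proof (rule levy_continuity)
  have pos: "sqrt (kernel_variance / den_limit\<^sup>2) > 0" using b kernel_variance by simp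
  show "real_distribution (distr P borel (\<lambda>w. sqrt (real n) * xi (c n) n id w))" for n
    by (rule P.real_distribution_distr) (rule sqrt_xi_measurable)
  show "real_distribution (density lborel (normal_density 0 (sqrt (kernel_variance / den_limit\<^sup>2))))"
    by (rule char_normal(1)[OF pos])
  fix t
  have "char (distr P borel (\<lambda>w. sqrt (real n) * xi (c n) n id w)) t
      = (\<integral>w. iexp (t * (sqrt (real n) * xi (c n) n id w)) \<partial>P)" for n
    unfolding char_def by (rule integral_distr[OF sqrt_xi_measurable]) measurable
  moreover have "char (density lborel (normal_density 0 (sqrt (kernel_variance / den_limit\<^sup>2)))) t
      = complex_of_real (exp (- ((t / den_limit)\<^sup>2 * kernel_variance / 2)))"
    unfolding char_normal(2)[OF pos] using kernel_variance by (simp add: power_mult_distrib power_divide mult.commute)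
  ultimately show "(\<lambda>n. char (distr P borel (\<lambda>w. sqrt (real n) * xi (c n) n id w)) t)
      \<longlonglongrightarrow> char (density lborel (normal_density 0 (sqrt (kernel_variance / den_limit\<^sup>2)))) t"
    using char_xi_tendsto[OF b, of t c] by simp
qed

end

section \<open>The limiting variance\<close>

context sampling
begin

definition F :: "real \<Rightarrow> real" where "F t = measure N {..t}"

definition \<phi> :: "real \<Rightarrow> real \<Rightarrow> real" where "\<phi> x y = min (F x) (F y)"

definition g :: "real \<Rightarrow> real" where "g x = (\<integral>y. \<phi> x y \<partial>N)"

definition \<mu> :: real where "\<mu> = (\<integral>x. g x \<partial>N)"

lemma F_mono: "x \<le> y \<Longrightarrow> F x \<le> F y"
  unfolding F_def by (intro finite_measure_mono) auto

lemma F_bounds: "0 \<le> F t" "F t \<le> 1"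
  by (auto simp: F_def)

lemma F_measurable [measurable]: "F \<in> borel_measurable borel"
  by (rule borel_measurable_mono) (simp add: mono_def F_mono)

lemma \<phi>_measurable [measurable]: "(\<lambda>(x, y). \<phi> x y) \<in> borel_measurable (borel \<Otimes>\<^sub>M borel)"
  unfolding \<phi>_def by measurable

lemma g_measurable [measurable]: "g \<in> borel_measurable borel"
  unfolding g_def by measurable

lemma \<phi>_bounds: "0 \<le> \<phi> x y" "\<phi> x y \<le> 1"
  using F_bounds[of x] F_bounds[of y] by (auto simp: \<phi>_def)

lemma \<phi>_commute: "\<phi> x y = \<phi> y x"
  by (simp add: \<phi>_def min.commute)

lemma g_bounds: "0 \<le> g x" "g x \<le> 1"
proof -
  show "0 \<le> g x" unfolding g_def by (intro Bochner_Integration.integral_nonneg \<phi>_bounds)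
  have "\<bar>\<phi> x y\<bar> \<le> 1" for y using \<phi>_bounds[of x y] by simp
  then have "\<bar>g x\<bar> \<le> 1" unfolding g_def by (intro abs_expectation_le) auto
  then show "g x \<le> 1" by simp
qed

lemma \<phi>_eq_integral: "\<phi> x y = (\<integral>z. (if z \<le> x then 1 else 0) * (if z \<le> y then 1 else 0) \<partial>N)"
proof -
  have "\<phi> x y = F (min x y)"
    using F_mono[of x y] F_mono[of y x] by (auto simp: \<phi>_def min_def)
  also have "\<dots> = (\<integral>z. indicator {..min x y} z \<partial>N)" by (simp add: F_def)
  also have "\<dots> = (\<integral>z. (if z \<le> x then 1 else 0) * (if z \<le> y then 1 else 0) \<partial>N)"
    by (intro Bochner_Integration.integral_cong) (auto simp: indicator_def)
  finally show ?thesis .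
qed

lemma g_eq_integral: "g x = (\<integral>z. (if z \<le> x then 1 else 0) * G z \<partial>N)"
proof -
  have "g x = (\<integral>z. (\<integral>y. (if z \<le> x then 1 else 0) * (if z \<le> y then 1 else 0) \<partial>N) \<partial>N)"
    unfolding g_def \<phi>_eq_integral by (rule Fubini_bounded[of _ 1]) auto
  then show ?thesis unfolding G_eq_integral by simp
qed

lemma \<mu>_eq_integral: "\<mu> = (\<integral>z. G z * G z \<partial>N)"
proof -
  have "\<bar>(if z \<le> x then 1 else 0) * G z\<bar> \<le> 1" for x z
    using G_bounds[of z] by auto
  then have "\<mu> = (\<integral>z. (\<integral>x. (if z \<le> x then 1 else 0) * G z \<partial>N) \<partial>N)"
    unfolding \<mu>_def g_eq_integral by (intro Fubini_bounded[of _ 1]) auto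
  also have "\<dots> = (\<integral>z. G z * G z \<partial>N)"
  proof (rule Bochner_Integration.integral_cong[OF refl])
    fix z
    show "(\<integral>x. (if z \<le> x then 1 else 0) * G z \<partial>N) = G z * G z"
      unfolding integral_mult_left_zero G_eq_integral[symmetric] ..
  qed
  finally show ?thesis .
qed

text \<open>The kernel is the second-order Hoeffding projection of \<open>\<phi>\<close>: expand the product of the centred
  indicators.\<close>

lemma \<psi>_eq: "\<psi> x y = \<phi> x y - g x - g y + \<mu>"
proof -
  let ?i = "\<lambda>x z. if z \<le> x then 1 else 0 :: real"
  have int: "integrable N (\<lambda>z. ?i x z * ?i y z)" "integrable N (\<lambda>z. ?i x z * G z)" "integrable N (\<lambda>z. ?i y z * G z)"
    "integrable N (\<lambda>z. G z * G z)"
    using G_bounds by (auto intro!: integrable_bounded[of _ 1] mult_le_one)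
  have "\<psi> x y = (\<integral>z. ?i x z * ?i y z - ?i x z * G z - ?i y z * G z + G z * G z \<partial>N)"
    unfolding \<psi>_def e_def by (intro Bochner_Integration.integral_cong) (auto simp: algebra_simps)
  also have "\<dots> = \<phi> x y - g x - g y + \<mu>"
    unfolding \<phi>_eq_integral g_eq_integral \<mu>_eq_integral using int
    by (simp only: Bochner_Integration.integral_add Bochner_Integration.integral_diff Bochner_Integration.integrable_diff Bochner_Integration.integrable_add)
  finally show ?thesis .
qed

lemma kernel_variance_eq_expectation: "kernel_variance = (\<integral>w. (\<psi> (w 1) (w 2))\<^sup>2 \<partial>P)"
  unfolding kernel_variance_def kernel_sq_mean_def
  by (rule expectation_two_coordinates[symmetric, of _ 1]) (use \<psi>_sq in auto)

lemma \<phi>_moments: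
  "(\<integral>w. \<phi> (w 1) (w 2) \<partial>P) = \<mu>"
  "(\<integral>w. \<phi> (w 1) (w 2) * \<phi> (w 1) (w 3) \<partial>P) = (\<integral>x. (g x)\<^sup>2 \<partial>N)"
  "(\<integral>w. \<phi> (w 1) (w 2) * g (w 1) \<partial>P) = (\<integral>x. (g x)\<^sup>2 \<partial>N)"
  "(\<integral>w. \<phi> (w 1) (w 2) * g (w 2) \<partial>P) = (\<integral>x. (g x)\<^sup>2 \<partial>N)"
  "(\<integral>w. g (w 1) * g (w 2) \<partial>P) = \<mu>\<^sup>2"
  "(\<integral>w. (g (w i))\<^sup>2 \<partial>P) = (\<integral>x. (g x)\<^sup>2 \<partial>N)"
  "(\<integral>w. g (w i) \<partial>P) = \<mu>"
proof -
  have \<phi>: "\<bar>\<phi> x y\<bar> \<le> 1" and g: "\<bar>g x\<bar> \<le> 1" for x y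
    using \<phi>_bounds[of x y] g_bounds[of x] by auto
  have bd: "\<bar>\<phi> x y * g z\<bar> \<le> 1" "\<bar>g x * g y\<bar> \<le> 1" "\<bar>(g x)\<^sup>2\<bar> \<le> 1" "\<bar>\<phi> x y * \<phi> z v\<bar> \<le> 1" for x y z v
    using \<phi>_bounds[of x y] g_bounds[of z] g_bounds[of x] g_bounds[of y] \<phi>_bounds[of z v]
    by (auto simp: abs_mult power2_eq_square mult_le_one)
  show "(\<integral>w. \<phi> (w 1) (w 2) \<partial>P) = \<mu>"
    unfolding \<mu>_def g_def by (rule expectation_two_coordinates[of _ 1]) (use \<phi> in auto)
  show m12: "(\<integral>w. \<phi> (w 1) (w 2) * g (w 1) \<partial>P) = (\<integral>x. (g x)\<^sup>2 \<partial>N)"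
  proof -
    have "(\<integral>w. \<phi> (w 1) (w 2) * g (w 1) \<partial>P) = (\<integral>x. (\<integral>y. \<phi> x y * g x \<partial>N) \<partial>N)"
      by (rule expectation_two_coordinates[of _ 1]) (use bd in auto)
    then show ?thesis by (simp add: g_def power2_eq_square)
  qed
  show "(\<integral>w. \<phi> (w 1) (w 2) * g (w 2) \<partial>P) = (\<integral>x. (g x)\<^sup>2 \<partial>N)"
  proof -
    have "(\<integral>w. \<phi> (w 2) (w 1) * g (w 2) \<partial>P) = (\<integral>x. (\<integral>y. \<phi> x y * g x \<partial>N) \<partial>N)"
      by (rule expectation_two_coordinates[of _ 1]) (use bd in auto)
    then show ?thesis by (simp add: g_def power2_eq_square \<phi>_commute)
  qed
  show "(\<integral>w. g (w 1) * g (w 2) \<partial>P) = \<mu>\<^sup>2"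
  proof -
    have "(\<integral>w. g (w 1) * g (w 2) \<partial>P) = (\<integral>x. (\<integral>y. g x * g y \<partial>N) \<partial>N)"
      by (rule expectation_two_coordinates[of _ 1]) (use bd in auto)
    then show ?thesis by (simp add: \<mu>_def power2_eq_square)
  qed
  show "(\<integral>w. (g (w i))\<^sup>2 \<partial>P) = (\<integral>x. (g x)\<^sup>2 \<partial>N)"
    by (rule expectation_coordinate[of _ 1]) (use bd in auto)
  show "(\<integral>w. g (w i) \<partial>P) = \<mu>"
    unfolding \<mu>_def by (rule expectation_coordinate[of _ 1]) (use g in auto)
  have "(\<integral>w. \<phi> (w 1) (w 2) * \<phi> (w 1) (w 3) \<partial>P) = (\<integral>w. \<phi> (w 1) (w 2) * g (w 1) \<partial>P)"
    using resample[of "\<lambda>w. \<phi> (w 1) (w 2) * \<phi> (w 1) (w 3)" 1 3] bd by (simp add: g_def)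
  then show "(\<integral>w. \<phi> (w 1) (w 2) * \<phi> (w 1) (w 3) \<partial>P) = (\<integral>x. (g x)\<^sup>2 \<partial>N)"
    unfolding m12 .
qed

lemma kernel_variance_eq:
  "kernel_variance = (\<integral>w. (\<phi> (w 1) (w 2))\<^sup>2 \<partial>P) - 2 * (\<integral>w. \<phi> (w 1) (w 2) * \<phi> (w 1) (w 3) \<partial>P)
    + (\<integral>w. \<phi> (w 1) (w 2) \<partial>P)\<^sup>2"
proof -
  have \<phi>: "\<bar>\<phi> x y\<bar> \<le> 1" and g: "\<bar>g x\<bar> \<le> 1" for x y
    using \<phi>_bounds[of x y] g_bounds[of x] by auto
  have bd: "\<bar>\<phi> x y * g z\<bar> \<le> 1" "\<bar>g x * g y\<bar> \<le> 1" "\<bar>(g x)\<^sup>2\<bar> \<le> 1" "\<bar>(\<phi> x y)\<^sup>2\<bar> \<le> 1" for x y z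
    using \<phi>_bounds[of x y] g_bounds[of z] g_bounds[of x] g_bounds[of y]
    by (auto simp: abs_mult power2_eq_square mult_le_one)
  have int: "integrable P (\<lambda>w. (\<phi> (w 1) (w 2))\<^sup>2)" "integrable P (\<lambda>w. (g (w 1))\<^sup>2)" "integrable P (\<lambda>w. (g (w 2))\<^sup>2)"
    "integrable P (\<lambda>w. \<phi> (w 1) (w 2) * g (w 1))" "integrable P (\<lambda>w. \<phi> (w 1) (w 2) * g (w 2))"
    "integrable P (\<lambda>w. g (w 1) * g (w 2))" "integrable P (\<lambda>w. \<phi> (w 1) (w 2))"
    "integrable P (\<lambda>w. g (w 1))" "integrable P (\<lambda>w. g (w 2))"
    by (rule P.integrable_bounded[of _ 1]; use bd \<phi> g in simp)+
  have lin: "(\<integral>w. f1 w + f2 w + f3 w + \<mu>\<^sup>2 - 2 * f4 w - 2 * f5 w + 2 * f6 w + 2 * \<mu> * f7 w - 2 * \<mu> * f8 w - 2 * \<mu> * f9 w \<partial>P)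
    = (\<integral>w. f1 w \<partial>P) + (\<integral>w. f2 w \<partial>P) + (\<integral>w. f3 w \<partial>P) + \<mu>\<^sup>2 - 2 * (\<integral>w. f4 w \<partial>P) - 2 * (\<integral>w. f5 w \<partial>P)
      + 2 * (\<integral>w. f6 w \<partial>P) + 2 * \<mu> * (\<integral>w. f7 w \<partial>P) - 2 * \<mu> * (\<integral>w. f8 w \<partial>P) - 2 * \<mu> * (\<integral>w. f9 w \<partial>P)"
    if "integrable P f1" "integrable P f2" "integrable P f3" "integrable P f4" "integrable P f5" "integrable P f6"
      "integrable P f7" "integrable P f8" "integrable P f9" for f1 f2 f3 f4 f5 f6 f7 f8 f9 :: "(nat \<Rightarrow> real) \<Rightarrow> real"
    using that by (simp add: P.prob_space)
  have "kernel_variance = (\<integral>w. (\<phi> (w 1) (w 2))\<^sup>2 + (g (w 1))\<^sup>2 + (g (w 2))\<^sup>2 + \<mu>\<^sup>2 - 2 * (\<phi> (w 1) (w 2) * g (w 1))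
      - 2 * (\<phi> (w 1) (w 2) * g (w 2)) + 2 * (g (w 1) * g (w 2)) + 2 * \<mu> * \<phi> (w 1) (w 2) - 2 * \<mu> * g (w 1) - 2 * \<mu> * g (w 2) \<partial>P)"
    unfolding kernel_variance_eq_expectation \<psi>_eq
    by (intro Bochner_Integration.integral_cong) (auto simp: power2_eq_square algebra_simps)
  also have "\<dots> = (\<integral>w. (\<phi> (w 1) (w 2))\<^sup>2 \<partial>P) - 2 * (\<integral>x. (g x)\<^sup>2 \<partial>N) + \<mu>\<^sup>2"
    unfolding lin[OF int(1,2,3,4,5,6,7,8,9)] \<phi>_moments by (simp add: power2_eq_square)
  finally show ?thesis unfolding \<phi>_moments(1,2) .
qed

subsection \<open>Positivity\<close>

lemma prob_greaterThan: "measure N {t<..} = 1 - F t"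
proof -
  have "{t<..} = UNIV - {..t}" by auto
  then show ?thesis using finite_measure_compl[of "{..t}"] by (simp add: F_def space_eq_univ)
qed

lemma G_le_beyond: "t < z \<Longrightarrow> G z \<le> 1 - F t"
  unfolding prob_greaterThan[symmetric] G_def by (intro finite_measure_mono) auto

text \<open>If \<open>F\<close> took only the values \<open>0\<close> and \<open>1\<close>, all mass would sit at the point where it jumps.\<close>

lemma nondegenerate_split:
  assumes "\<not> (\<exists>a. AE x in N. x = a)"
  obtains t where "0 < F t" "F t < 1"
proof -
  have "\<exists>t. F t \<noteq> 0 \<and> F t \<noteq> 1"
  proof (rule ccontr)
    assume "\<not> ?thesis"
    then have F01: "F t = 0 \<or> F t = 1" for t by blast
    define A where "A = {t. F t = 1}"
    have F_cdf: "F = cdf N" by (auto simp: F_def cdf_def)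
    have "eventually (\<lambda>t. F t > 1 / 2) at_top"
      unfolding F_cdf by (rule order_tendstoD(1)[OF cdf_lim_at_top_prob]) simp
    then obtain t1 where "F t1 > 1 / 2" using eventually_happens by (metis trivial_limit_at_top_linorder)
    then have ne: "A \<noteq> {}" using F01[of t1] by (auto simp: A_def)
    have "eventually (\<lambda>t. F t < 1 / 2) at_bot"
      unfolding F_cdf by (rule order_tendstoD(2)[OF cdf_lim_at_bot]) simp
    then obtain t0 where t0: "F t0 < 1 / 2" using eventually_happens by (metis trivial_limit_at_bot_linorder)
    have bdd: "bdd_below A"
    proof (rule bdd_belowI[of _ t0])
      fix x assume "x \<in> A"
      then show "t0 \<le> x" using F_mono[of x t0] t0 by (cases "t0 \<le> x") (auto simp: A_def)
    qed
    \<comment> \<open>The level at which \<open>F\<close> jumps from 0 to 1.\<close>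
    define a where "a = Inf A"
    have above: "F x = 1" if "a < x" for x
    proof -
      from that obtain y where "y \<in> A" "y < x" using cInf_less_iff[OF ne bdd] by (auto simp: a_def)
      then show ?thesis using F_mono[of y x] F_bounds[of x] by (simp add: A_def)
    qed
    have below: "F x = 0" if "x < a" for x
    proof -
      have "x \<notin> A" using that cInf_lower[OF _ bdd, of x] by (auto simp: a_def)
      then show ?thesis using F01[of x] by (simp add: A_def)
    qed
    have "AE x in N. x \<le> a + 1 / real (Suc n)" for n
    proof (subst AE_iff_measurable[of "{a + 1 / real (Suc n)<..}"])
      show "emeasure N {a + 1 / real (Suc n)<..} = 0"
        unfolding emeasure_eq_measure prob_greaterThan using above by simp
    qed (auto simp: space_eq_univ)
    then have up: "AE x in N. \<forall>n. x \<le> a + 1 / real (Suc n)" by (simp add: AE_all_countable)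
    have "AE x in N. a - 1 / real (Suc n) < x" for n
    proof (subst AE_iff_measurable[of "{..a - 1 / real (Suc n)}"])
      show "emeasure N {..a - 1 / real (Suc n)} = 0"
        unfolding emeasure_eq_measure F_def[symmetric] using below by simp
    qed (auto simp: space_eq_univ)
    then have dn: "AE x in N. \<forall>n. a - 1 / real (Suc n) < x" by (simp add: AE_all_countable)
    have "AE x in N. x = a"
      using up dn
    proof eventually_elim
      case (elim x)
      show ?case
      proof (rule ccontr)
        assume "x \<noteq> a"
        then obtain n where "1 / real (Suc n) < \<bar>x - a\<bar>" using nat_approx_posE[of "\<bar>x - a\<bar>"] by auto
        moreover have "x \<le> a + 1 / real (Suc n)" "a - 1 / real (Suc n) < x" using elim by auto
        ultimately show False by (auto simp: abs_if split: if_splits)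
      qed
    qed
    then show False using assms by blast
  qed
  then obtain t where "F t \<noteq> 0" "F t \<noteq> 1" by blast
  with F_bounds[of t] show ?thesis by (intro that[of t]) auto
qed

text \<open>Of two independent values above \<open>t\<close> at least one is not below the other, so by symmetry the event
  that the second is at least the first has at least half of the total mass.\<close>

lemma upper_tail_mass:
  "2 * (\<integral>z. (if t < z then 1 else 0) * G z \<partial>N) \<ge> (1 - F t)\<^sup>2"
proof -
  let ?a = "\<lambda>z. if t < z then 1 else 0 :: real"
  let ?k = "\<lambda>z x. ?a z * ?a x * (if z \<le> x then 1 else 0)"
  have i1: "(\<integral>x. ?a z * (if z \<le> x then 1 else 0) \<partial>N) = ?a z * G z" for z
    by (simp add: G_eq_integral)
  have k: "?a z * (if z \<le> x then 1 else 0) = ?k z x" for z x by auto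
  have kb: "\<bar>?k z x\<bar> \<le> 1" for z x by auto
  have sum: "?k z x + ?k x z \<ge> ?a z * ?a x" for z x by auto
  have a: "(\<integral>x. ?a x \<partial>N) = 1 - F t"
  proof -
    have "(\<integral>x. ?a x \<partial>N) = (\<integral>x. indicator {t<..} x \<partial>N)"
      by (intro Bochner_Integration.integral_cong) (auto simp: indicator_def)
    then show ?thesis by (simp add: prob_greaterThan)
  qed
  have I: "(\<integral>z. ?a z * G z \<partial>N) = (\<integral>z. (\<integral>x. ?k z x \<partial>N) \<partial>N)"
    unfolding i1[symmetric] k ..
  have I': "(\<integral>z. ?a z * G z \<partial>N) = (\<integral>z. (\<integral>x. ?k x z \<partial>N) \<partial>N)"
    unfolding I using kb by (intro Fubini_bounded[of _ 1]) auto
  have inti: "integrable N (\<lambda>x. ?k z x)" "integrable N (\<lambda>x. ?k x z)" for z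
    by (auto intro!: integrable_bounded[of _ 1])
  have ib: "\<bar>\<integral>x. ?k z x \<partial>N\<bar> \<le> 1" "\<bar>\<integral>x. ?k x z \<partial>N\<bar> \<le> 1" for z
    using kb by (intro abs_expectation_le; simp)+
  have into: "integrable N (\<lambda>z. \<integral>x. ?k z x \<partial>N)" "integrable N (\<lambda>z. \<integral>x. ?k x z \<partial>N)"
    using ib by (auto intro!: integrable_bounded[of _ 1])
  have "(1 - F t)\<^sup>2 = (\<integral>z. (\<integral>x. ?a z * ?a x \<partial>N) \<partial>N)"
    by (simp only: integral_mult_right_zero integral_mult_left_zero a power2_eq_square)
  also have "\<dots> \<le> (\<integral>z. (\<integral>x. ?k z x \<partial>N) + (\<integral>x. ?k x z \<partial>N) \<partial>N)"
  proof (rule integral_mono)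
    show "integrable N (\<lambda>z. \<integral>x. ?a z * ?a x \<partial>N)"
      unfolding integral_mult_right_zero by (intro integrable_mult_left integrable_bounded[of _ 1]) auto
    show "integrable N (\<lambda>z. (\<integral>x. ?k z x \<partial>N) + (\<integral>x. ?k x z \<partial>N))"
      by (intro Bochner_Integration.integrable_add into)
    fix z
    have "(\<integral>x. ?a z * ?a x \<partial>N) \<le> (\<integral>x. ?k z x + ?k x z \<partial>N)"
    proof (rule integral_mono)
      show "integrable N (\<lambda>x. ?a z * ?a x)" by (auto intro!: integrable_bounded[of _ 1])
      show "integrable N (\<lambda>x. ?k z x + ?k x z)" by (intro Bochner_Integration.integrable_add inti)
    qed (rule sum)
    then show "(\<integral>x. ?a z * ?a x \<partial>N) \<le> (\<integral>x. ?k z x \<partial>N) + (\<integral>x. ?k x z \<partial>N)"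
      unfolding Bochner_Integration.integral_add[OF inti] .
  qed
  also have "\<dots> = 2 * (\<integral>z. ?a z * G z \<partial>N)"
    unfolding Bochner_Integration.integral_add[OF into] I[symmetric] I'[symmetric] by simp
  finally show ?thesis .
qed

lemma den_limit_pos:
  assumes "\<not> (\<exists>a. AE x in N. x = a)"
  shows "den_limit > 0"
proof -
  from nondegenerate_split[OF assms] obtain t where t: "0 < F t" "F t < 1" .
  let ?a = "\<lambda>z. if t < z then 1 else 0 :: real"
  have aG: "\<bar>?a z * G z\<bar> \<le> 1" for z using G_bounds[of z] by auto
  have "F t * (\<integral>z. ?a z * G z \<partial>N) = (\<integral>z. F t * (?a z * G z) \<partial>N)" by simp
  also have "\<dots> \<le> den_limit"
    unfolding den_limit_def
  proof (rule integral_mono)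
    show "integrable N (\<lambda>z. F t * (?a z * G z))"
      using aG by (intro integrable_mult_right integrable_bounded[of _ 1]) auto
    show "integrable N (\<lambda>z. G z * (1 - G z))"
      using G_var_bounds by (intro integrable_bounded[of _ 1]) auto
    fix z
    show "F t * (?a z * G z) \<le> G z * (1 - G z)"
    proof (cases "t < z")
      case True
      then have "F t \<le> 1 - G z" using G_le_beyond[of t z] by simp
      from mult_left_mono[OF this G_bounds(1)[of z]] show ?thesis using True by (simp add: mult.commute)
    next
      case False
      then show ?thesis using G_var_bounds(1)[of z] by simp
    qed
  qed
  finally have "F t * (\<integral>z. ?a z * G z \<partial>N) \<le> den_limit" .
  moreover have "(\<integral>z. ?a z * G z \<partial>N) > 0"
    using upper_tail_mass[of t] t zero_less_power[of "1 - F t" 2] by linarith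
  ultimately show ?thesis using mult_pos_pos[OF t(1)] by (meson less_le_trans)
qed

text \<open>Testing the positive semidefinite kernel against the indicator \<open>a\<close> of \<open>{t<..}\<close> gives the integral of
  \<open>m\<^sup>2\<close>, where \<open>m z\<close> is the mean of \<open>a x * e x z\<close> over \<open>x\<close>. For \<open>z > t\<close> this mean is \<open>F t * G z\<close>, which
  does not vanish almost everywhere on \<open>{t<..}\<close>. So the quadratic form is positive, and \<open>\<psi>\<close> is not
  almost everywhere zero.\<close>

lemma kernel_variance_pos:
  assumes "\<not> (\<exists>a. AE x in N. x = a)"
  shows "kernel_variance > 0"
proof -
  from nondegenerate_split[OF assms] obtain t where t: "0 < F t" "F t < 1" .
  let ?a = "\<lambda>z. if t < z then 1 else 0 :: real"
  define m where "m z = (\<integral>x. ?a x * e x z \<partial>N)" for z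
  have ae: "\<bar>?a x * e x z\<bar> \<le> 1" for x z using e_bound[of x z] by auto
  have [measurable]: "m \<in> borel_measurable borel" unfolding m_def by measurable
  have m_bd: "\<bar>m z\<bar> \<le> 1" for z unfolding m_def using ae by (intro abs_expectation_le) auto
  have m_tail: "?a z * m z = F t * (?a z * G z)" for z
  proof (cases "t < z")
    case True
    have "m z = (\<integral>x. (if z \<le> x then 1 else 0) - G z * ?a x \<partial>N)"
      unfolding m_def e_def using True by (intro Bochner_Integration.integral_cong) auto
    also have "\<dots> = G z - G z * (\<integral>x. ?a x \<partial>N)"
      unfolding G_eq_integral[of z]
      by (subst Bochner_Integration.integral_diff) (auto intro!: integrable_bounded[of _ 1] simp flip: G_eq_integral)
    also have "(\<integral>x. ?a x \<partial>N) = 1 - F t"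
    proof -
      have "(\<integral>x. ?a x \<partial>N) = (\<integral>x. indicator {t<..} x \<partial>N)"
        by (intro Bochner_Integration.integral_cong) (auto simp: indicator_def)
      then show ?thesis by (simp add: prob_greaterThan)
    qed
    finally show ?thesis using True by (simp add: algebra_simps)
  qed simp
  have aG: "\<bar>?a z * G z\<bar> \<le> 1" for z using G_bounds[of z] by auto
  have tail: "(\<integral>z. ?a z * G z \<partial>N) > 0"
    using upper_tail_mass[of t] t zero_less_power[of "1 - F t" 2] by linarith
  have am: "\<bar>?a z * m z\<bar> \<le> 1" for z using m_bd[of z] by auto
  have "(\<integral>z. ?a z * m z \<partial>N) = F t * (\<integral>z. ?a z * G z \<partial>N)"
    unfolding m_tail by simp
  then have "(\<integral>z. ?a z * m z \<partial>N) > 0" using t tail by simp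
  then have "0 < (\<integral>z. ?a z * m z \<partial>N)\<^sup>2" by simp
  also have "\<dots> \<le> (\<integral>z. (?a z * m z)\<^sup>2 \<partial>N)"
    using am by (intro square_expectation_le[of _ 1]) auto
  also have "\<dots> \<le> (\<integral>z. (m z)\<^sup>2 \<partial>N)"
  proof (rule integral_mono)
    have "\<bar>(m z)\<^sup>2\<bar> \<le> 1" "\<bar>(?a z * m z)\<^sup>2\<bar> \<le> 1" for z
      using m_bd[of z] am[of z] by (simp_all add: abs_square_le_1)
    then show "integrable N (\<lambda>z. (m z)\<^sup>2)" "integrable N (\<lambda>z. (?a z * m z)\<^sup>2)"
      by (auto intro!: integrable_bounded[of _ 1])
  qed auto
  finally have m2: "0 < (\<integral>z. (m z)\<^sup>2 \<partial>N)" .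
  \<comment> \<open>Resampling the coordinates 3, 2 and 1 in turn turns the quadratic form into the integral of \<open>m\<^sup>2\<close>.\<close>
  let ?J = "\<integral>w. ?a (w 1) * ?a (w 2) * \<psi> (w 1) (w 2) \<partial>P"
  let ?Z = "\<lambda>w::nat \<Rightarrow> real. (?a (w 1) * e (w 1) (w 3)) * (?a (w 2) * e (w 2) (w 3))"
  have Z_bd: "\<bar>?Z w\<bar> \<le> 1" for w
    unfolding abs_mult[of "?a (w 1) * e (w 1) (w 3)"] using ae by (intro mult_le_one) auto
  have mm_bd: "\<bar>?a (w 1) * e (w 1) (w 3) * m (w 3)\<bar> \<le> 1" for w :: "nat \<Rightarrow> real"
    unfolding abs_mult[of "?a (w 1) * e (w 1) (w 3)"] using ae m_bd by (intro mult_le_one) auto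
  have "?J = (\<integral>w. (\<integral>y. ?Z (w(3 := y)) \<partial>N) \<partial>P)"
  proof (rule Bochner_Integration.integral_cong[OF refl])
    fix w :: "nat \<Rightarrow> real"
    have "(\<integral>y. ?Z (w(3 := y)) \<partial>N) = (\<integral>y. ?a (w 1) * ?a (w 2) * (e (w 1) y * e (w 2) y) \<partial>N)"
      by (intro Bochner_Integration.integral_cong) auto
    also have "\<dots> = ?a (w 1) * ?a (w 2) * \<psi> (w 1) (w 2)"
      unfolding \<psi>_def by (rule integral_mult_right_zero)
    finally show "?a (w 1) * ?a (w 2) * \<psi> (w 1) (w 2) = (\<integral>y. ?Z (w(3 := y)) \<partial>N)" by (rule sym)
  qed
  also have "\<dots> = (\<integral>w. ?Z w \<partial>P)"
    using Z_bd by (intro resample[symmetric, of _ 1]) auto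
  also have "\<dots> = (\<integral>w. (\<integral>y. ?Z (w(2 := y)) \<partial>N) \<partial>P)"
    using Z_bd by (intro resample[of _ 1]) auto
  also have "\<dots> = (\<integral>w. ?a (w 1) * e (w 1) (w 3) * m (w 3) \<partial>P)"
  proof (rule Bochner_Integration.integral_cong[OF refl])
    fix w :: "nat \<Rightarrow> real"
    have "(\<integral>y. ?Z (w(2 := y)) \<partial>N) = (\<integral>y. ?a (w 1) * e (w 1) (w 3) * (?a y * e y (w 3)) \<partial>N)"
      by (intro Bochner_Integration.integral_cong) auto
    also have "\<dots> = ?a (w 1) * e (w 1) (w 3) * m (w 3)"
      unfolding m_def by (rule integral_mult_right_zero)
    finally show "(\<integral>y. ?Z (w(2 := y)) \<partial>N) = ?a (w 1) * e (w 1) (w 3) * m (w 3)" .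
  qed
  also have "\<dots> = (\<integral>w. (\<integral>y. ?a y * e y (w 3) * m (w 3) \<partial>N) \<partial>P)"
    using resample[of "\<lambda>w. ?a (w 1) * e (w 1) (w 3) * m (w 3)" 1 1] mm_bd by simp
  also have "\<dots> = (\<integral>w. (m (w 3))\<^sup>2 \<partial>P)"
    unfolding integral_mult_left_zero m_def[symmetric] power2_eq_square ..
  also have "\<dots> = (\<integral>z. (m z)\<^sup>2 \<partial>N)"
    by (rule expectation_coordinate[of _ 1]) (use m_bd in \<open>auto simp: abs_square_le_1\<close>)
  finally have "0 < ?J" using m2 by simp
  then have "0 < ?J\<^sup>2" by simp
  have aa\<psi>: "\<bar>?a x * ?a y * \<psi> x y\<bar> \<le> 1" for x y using \<psi>_bound[of x y] by auto
  have "?J\<^sup>2 \<le> (\<integral>w. (?a (w 1) * ?a (w 2) * \<psi> (w 1) (w 2))\<^sup>2 \<partial>P)"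
    using aa\<psi> by (intro P.square_expectation_le[of _ 1]) auto
  also have "\<dots> \<le> (\<integral>w. (\<psi> (w 1) (w 2))\<^sup>2 \<partial>P)"
  proof (rule integral_mono)
    have "\<bar>(\<psi> x y)\<^sup>2\<bar> \<le> 1" "\<bar>(?a x * ?a y * \<psi> x y)\<^sup>2\<bar> \<le> 1" for x y
      using \<psi>_bound[of x y] aa\<psi>[of x y] by (simp_all add: abs_square_le_1)
    then show "integrable P (\<lambda>w. (\<psi> (w 1) (w 2))\<^sup>2)" "integrable P (\<lambda>w. (?a (w 1) * ?a (w 2) * \<psi> (w 1) (w 2))\<^sup>2)"
      by (auto intro!: P.integrable_bounded[of _ 1])
  qed auto
  finally show ?thesis unfolding kernel_variance_eq_expectation using \<open>0 < ?J\<^sup>2\<close> by linarith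
qed

subsection \<open>Continuous distribution functions\<close>

text \<open>The probability integral transform. The intermediate value theorem provides \<open>t\<close> with \<open>F t = u\<close>, and
  then \<open>{..t}\<close> lies between \<open>{F < u}\<close> and \<open>{F \<le> u}\<close>; flat pieces of \<open>F\<close> are dealt with by letting \<open>v\<close>
  decrease to \<open>u\<close>.\<close>

lemma F_uniform:
  assumes cont: "continuous_on UNIV F"
  shows "distributed N lborel F (\<lambda>x. indicator {0..1} x / measure lborel {0..1::real})"
proof (rule uniform_distrI_borel_atLeastAtMost)
  have F_cdf: "F = cdf N" by (auto simp: F_def cdf_def)
  let ?H = "\<lambda>u. prob {x \<in> space N. F x \<le> u}"
  have squeeze: "\<exists>t. F t = u" if "0 < u" "u < 1" for u
  proof -
    have "eventually (\<lambda>t. F t > u) at_top"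
      unfolding F_cdf by (rule order_tendstoD(1)[OF cdf_lim_at_top_prob that(2)])
    then obtain t1 where t1: "u < F t1" using eventually_happens by (metis trivial_limit_at_top_linorder)
    have "eventually (\<lambda>t. F t < u) at_bot"
      unfolding F_cdf by (rule order_tendstoD(2)[OF cdf_lim_at_bot that(1)])
    then obtain t0 where t0: "F t0 < u" using eventually_happens by (metis trivial_limit_at_bot_linorder)
    have "t0 \<le> t1" using F_mono[of t1 t0] t0 t1 by (cases "t0 \<le> t1") auto
    then have "\<exists>t\<ge>t0. t \<le> t1 \<and> F t = u"
      using t0 t1 by (intro IVT' continuous_on_subset[OF cont]) auto
    then show ?thesis by blast
  qed
  have ge: "u \<le> ?H u" if "0 < u" "u < 1" for u
  proof -
    obtain t where t: "F t = u" using squeeze[OF \<open>0 < u\<close> \<open>u < 1\<close>] by blast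
    have "{..t} \<subseteq> {x \<in> space N. F x \<le> u}" using F_mono t by (auto simp: space_eq_univ)
    then have "prob {..t} \<le> ?H u" by (intro finite_measure_mono) auto
    then show ?thesis using t by (simp add: F_def)
  qed
  have le: "?H u \<le> v" if "u < v" "0 < v" "v < 1" for u v
  proof -
    obtain t where t: "F t = v" using squeeze[OF \<open>0 < v\<close> \<open>v < 1\<close>] by blast
    have "x \<le> t" if "F x \<le> u" for x using F_mono[of t x] t that \<open>u < v\<close> by (cases "x \<le> t") auto
    then have "{x \<in> space N. F x \<le> u} \<subseteq> {..t}" by auto
    then have "?H u \<le> prob {..t}" by (intro finite_measure_mono) auto
    then show ?thesis using t by (simp add: F_def)
  qed
  fix u :: real assume u: "0 \<le> u" "u \<le> 1"
  show "?H u = (u - 0) / (1 - 0)"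
  proof (cases "u = 1")
    case True
    then show ?thesis using F_bounds by (simp add: space_eq_univ)
  next
    case False
    then have "u < 1" using u by simp
    have "?H u \<le> u"
    proof (rule dense_ge_bounded[OF \<open>u < 1\<close>])
      fix v assume "u < v" "v < 1"
      then show "?H u \<le> v" using u by (intro le) auto
    qed
    moreover have "u \<le> ?H u"
      using ge[of u] u \<open>u < 1\<close> by (cases "u = 0") auto
    ultimately show ?thesis by simp
  qed
qed auto

lemma integral_F_uniform:
  fixes h :: "real \<Rightarrow> real"
  assumes cont: "continuous_on UNIV F" and h: "continuous_on UNIV h"
  shows "(\<integral>x. h (F x) \<partial>N) = integral {0..1} h"
proof -
  have hm: "h \<in> borel_measurable borel" by (rule borel_measurable_continuous_onI[OF h])
  have "(\<integral>x. h (F x) \<partial>N) = (\<integral>u. indicator {0..1} u / measure lborel {0..1::real} * h u \<partial>lborel)"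
    by (rule distributed_integral[symmetric, OF F_uniform[OF cont]]) (use hm in auto)
  also have "\<dots> = (LINT u:{0..1}|lborel. h u)"
    by (simp add: set_lebesgue_integral_def)
  also have "\<dots> = integral {0..1} h"
    by (intro set_borel_integral_eq_integral borel_integrable_atLeastAtMost' continuous_on_subset[OF h]) auto
  finally show ?thesis .
qed

lemma integral_min_power:
  fixes u :: real
  assumes u: "0 \<le> u" "u \<le> 1"
  shows "integral {0..1} (\<lambda>v. min u v) = u - u\<^sup>2 / 2"
    and "integral {0..1} (\<lambda>v. (min u v)\<^sup>2) = u\<^sup>2 - 2 * u ^ 3 / 3"
proof -
  have split: "integral {0..1} (\<lambda>v. (min u v) ^ k) = u ^ Suc k / real (Suc k) + u ^ k * (1 - u)" for k
  proof -
    have "integral {0..1} (\<lambda>v. (min u v) ^ k)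
        = integral {0..u} (\<lambda>v. (min u v) ^ k) + integral {u..1} (\<lambda>v. (min u v) ^ k)"
      using u by (intro Henstock_Kurzweil_Integration.integral_combine[symmetric] integrable_continuous_interval continuous_intros) auto
    also have "integral {0..u} (\<lambda>v. (min u v) ^ k) = integral {0..u} (\<lambda>v. v ^ k)"
      by (rule Henstock_Kurzweil_Integration.integral_cong) (simp add: min.absorb2)
    also have "integral {0..u} (\<lambda>v. v ^ k) = u ^ Suc k / real (Suc k)"
    proof (rule integral_unique)
      have "((\<lambda>v. v ^ k) has_integral (u ^ Suc k / real (Suc k) - 0 ^ Suc k / real (Suc k))) {0..u}"
        using u by (intro fundamental_theorem_of_calculus)
          (auto intro!: derivative_eq_intros simp del: power_Suc simp flip: has_real_derivative_iff_has_vector_derivative)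
      then show "((\<lambda>v. v ^ k) has_integral (u ^ Suc k / real (Suc k))) {0..u}" by simp
    qed
    also have "integral {u..1} (\<lambda>v. (min u v) ^ k) = integral {u..1} (\<lambda>v. u ^ k)"
      by (rule Henstock_Kurzweil_Integration.integral_cong) (simp add: min_def)
    also have "\<dots> = u ^ k * (1 - u)" using u by simp
    finally show ?thesis .
  qed
  show "integral {0..1} (\<lambda>v. min u v) = u - u\<^sup>2 / 2"
    using split[of 1] by (simp add: power2_eq_square algebra_simps)
  show "integral {0..1} (\<lambda>v. (min u v)\<^sup>2) = u\<^sup>2 - 2 * u ^ 3 / 3"
    using split[of 2] by (simp add: power2_eq_square power3_eq_cube eval_nat_numeral algebra_simps)
qed

lemma integral_quartic_unit:
  fixes c1 c2 c3 c4 :: real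
  shows "integral {0..1} (\<lambda>u. c1 * u + c2 * u\<^sup>2 + c3 * u ^ 3 + c4 * u ^ 4) = c1 / 2 + c2 / 3 + c3 / 4 + c4 / 5"
proof (rule integral_unique)
  let ?p = "\<lambda>u. c1 * u\<^sup>2 / 2 + c2 * u ^ 3 / 3 + c3 * u ^ 4 / 4 + c4 * u ^ 5 / 5"
  have "((\<lambda>u. c1 * u + c2 * u\<^sup>2 + c3 * u ^ 3 + c4 * u ^ 4) has_integral (?p 1 - ?p 0)) {0..1}"
    by (intro fundamental_theorem_of_calculus)
      (auto intro!: derivative_eq_intros simp flip: has_real_derivative_iff_has_vector_derivative)
  then show "((\<lambda>u. c1 * u + c2 * u\<^sup>2 + c3 * u ^ 3 + c4 * u ^ 4) has_integral (c1 / 2 + c2 / 3 + c3 / 4 + c4 / 5)) {0..1}"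
    by simp
qed

lemma continuous_case:
  assumes cont: "continuous_on UNIV F"
  shows "kernel_variance = 1 / 90" and "den_limit = 1 / 6"
proof -
  note I = integral_F_uniform[OF cont]
  have g: "g x = F x - (F x)\<^sup>2 / 2" for x
    using F_bounds[of x] unfolding g_def \<phi>_def
    by (subst I[of "\<lambda>v. min (F x) v"]) (auto intro!: continuous_intros simp: integral_min_power)
  have \<phi>2: "(\<integral>y. (\<phi> x y)\<^sup>2 \<partial>N) = (F x)\<^sup>2 - 2 * (F x) ^ 3 / 3" for x
    using F_bounds[of x] unfolding \<phi>_def
    by (subst I[of "\<lambda>v. (min (F x) v)\<^sup>2"]) (auto intro!: continuous_intros simp: integral_min_power)
  have poly: "(\<integral>x. c1 * F x + c2 * (F x)\<^sup>2 + c3 * F x ^ 3 + c4 * F x ^ 4 \<partial>N) = c1 / 2 + c2 / 3 + c3 / 4 + c4 / 5" for c1 c2 c3 c4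
    by (subst I[of "\<lambda>u. c1 * u + c2 * u\<^sup>2 + c3 * u ^ 3 + c4 * u ^ 4"]) (auto intro!: continuous_intros simp: integral_quartic_unit)
  have \<mu>: "\<mu> = 1 / 3"
    using poly[of 1 "- 1 / 2" 0 0] unfolding \<mu>_def g by simp
  have g2: "(\<integral>x. (g x)\<^sup>2 \<partial>N) = 2 / 15"
  proof -
    have "(\<integral>x. (g x)\<^sup>2 \<partial>N) = (\<integral>x. 0 * F x + 1 * (F x)\<^sup>2 + (- 1) * F x ^ 3 + (1 / 4) * F x ^ 4 \<partial>N)"
      unfolding g by (intro Bochner_Integration.integral_cong) (auto simp: power2_eq_square eval_nat_numeral field_simps)
    then show ?thesis unfolding poly by simp
  qed
  have "\<bar>(\<phi> x y)\<^sup>2\<bar> \<le> 1" for x y using \<phi>_bounds[of x y] by (simp add: abs_square_le_1)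
  then have "(\<integral>w. (\<phi> (w 1) (w 2))\<^sup>2 \<partial>P) = (\<integral>x. (\<integral>y. (\<phi> x y)\<^sup>2 \<partial>N) \<partial>N)"
    by (intro expectation_two_coordinates[of _ 1]) auto
  also have "\<dots> = 1 / 6"
    unfolding \<phi>2 using poly[of 0 1 "- 2 / 3" 0] by (simp add: algebra_simps)
  finally have "(\<integral>w. (\<phi> (w 1) (w 2))\<^sup>2 \<partial>P) = 1 / 6" .
  then show "kernel_variance = 1 / 90"
    unfolding kernel_variance_eq \<phi>_moments(1,2) \<mu> g2 by (simp add: power2_eq_square)
  have G: "G z = 1 - F z" for z
  proof -
    have "isCont (cdf N) z"
      using cont by (simp add: continuous_on_eq_continuous_at F_def[abs_def] cdf_def[abs_def])
    then have atom: "prob {z} = 0" by (simp add: isCont_cdf)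
    have "{z..} = {z} \<union> {z<..}" by auto
    then have "G z = prob {z} + prob {z<..}"
      unfolding G_def by (simp only:) (rule finite_measure_Union, auto)
    then show ?thesis by (simp add: atom prob_greaterThan)
  qed
  have "den_limit = (\<integral>x. 1 * F x + (- 1) * (F x)\<^sup>2 + 0 * F x ^ 3 + 0 * F x ^ 4 \<partial>N)"
    unfolding den_limit_def G by (intro Bochner_Integration.integral_cong) (auto simp: power2_eq_square algebra_simps)
  then show "den_limit = 1 / 6" unfolding poly by simp
qed

end

section \<open>Random tie breaking\<close>

text \<open>An event about finitely many of the components is a product event about the pairs, no condition being
  imposed on the missing components. Independence of the pairs splits it into one factor for each pair, and
  independence within each pair splits these factors.\<close>

lemma (in prob_space) indep_vars_components_of_indep_pairs:
  fixes U V :: "nat \<Rightarrow> 'a \<Rightarrow> real"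
  assumes indep: "indep_vars (\<lambda>_. borel \<Otimes>\<^sub>M borel) (\<lambda>i \<omega>. (U i \<omega>, V i \<omega>)) I" and "finite I"
    and UV: "\<And>i. i \<in> I \<Longrightarrow> indep_var borel (U i) borel (V i)"
  shows "indep_vars (\<lambda>_. borel) (\<lambda>(b, i). if b then V i else U i) (UNIV \<times> I)"
proof -
  define Z where "Z = (\<lambda>(b, i). if b then V i else U i)"
  have rv: "random_variable borel (U i)" "random_variable borel (V i)" if "i \<in> I" for i
    using UV[OF that] by (auto dest: indep_var_rv1 indep_var_rv2)
  have Z_rv: "random_variable borel (Z j)" if "j \<in> UNIV \<times> I" for j :: "bool \<times> nat"
    using that rv by (auto simp: Z_def split: prod.splits)
  have "indep_sets (\<lambda>j. {Z j -` A \<inter> space M | A. A \<in> sets borel}) (UNIV \<times> I)"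
  proof (rule indep_setsI)
    fix j :: "bool \<times> nat" assume "j \<in> UNIV \<times> I"
    then show "{Z j -` A \<inter> space M | A. A \<in> sets borel} \<subseteq> events"
      using Z_rv[of j] by (auto intro: measurable_sets)
  next
    fix A J assume J: "J \<noteq> {}" "J \<subseteq> UNIV \<times> I" "finite J"
      and A: "\<forall>j\<in>J. A j \<in> {Z j -` A \<inter> space M | A. A \<in> sets borel}"
    then have "\<forall>j\<in>J. \<exists>B. A j = Z j -` B \<inter> space M \<and> B \<in> sets borel" by blast
    then obtain B where B: "\<And>j. j \<in> J \<Longrightarrow> A j = Z j -` B j \<inter> space M" "\<And>j. j \<in> J \<Longrightarrow> B j \<in> sets borel"
      by metis
    define C where "C j = (if j \<in> J then B j else UNIV)" for j
    have C: "C j \<in> sets borel" for j using B(2) by (simp add: C_def)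
    have "I \<noteq> {}" using J by auto
    have AC: "A j = Z j -` C j \<inter> space M" if "j \<in> J" for j using B(1) that by (simp add: C_def)
    have "(\<Inter>j\<in>J. A j) = (\<Inter>i\<in>I. (\<lambda>\<omega>. (U i \<omega>, V i \<omega>)) -` (C (False, i) \<times> C (True, i)) \<inter> space M)" (is "_ = ?R")
    proof (intro set_eqI iffI)
      fix \<omega> assume \<omega>: "\<omega> \<in> (\<Inter>j\<in>J. A j)"
      have sp: "\<omega> \<in> space M" using \<omega> J(1) AC by auto
      have "Z j \<omega> \<in> C j" for j
        using \<omega> AC[of j] by (cases "j \<in> J") (auto simp: C_def)
      from this[of "(False, _)"] this[of "(True, _)"] sp show "\<omega> \<in> ?R" by (auto simp: Z_def)
    next
      fix \<omega> assume \<omega>: "\<omega> \<in> ?R"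
      show "\<omega> \<in> (\<Inter>j\<in>J. A j)"
      proof
        fix j assume j: "j \<in> J"
        then obtain b i where bi: "j = (b, i)" "i \<in> I" using J(2) by auto
        from \<omega> bi(2) have "\<omega> \<in> (\<lambda>\<omega>. (U i \<omega>, V i \<omega>)) -` (C (False, i) \<times> C (True, i)) \<inter> space M" by (rule INT_D)
        then show "\<omega> \<in> A j" unfolding AC[OF j] unfolding bi(1) Z_def by (cases b) simp_all
      qed
    qed
    then have "prob (\<Inter>j\<in>J. A j) = prob ?R" by simp
    also have "\<dots> = (\<Prod>i\<in>I. prob ((\<lambda>\<omega>. (U i \<omega>, V i \<omega>)) -` (C (False, i) \<times> C (True, i)) \<inter> space M))"
      using C \<open>I \<noteq> {}\<close> \<open>finite I\<close> by (intro indep_varsD_finite[OF indep]) auto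
    also have "\<dots> = (\<Prod>i\<in>I. prob (U i -` C (False, i) \<inter> space M) * prob (V i -` C (True, i) \<inter> space M))"
    proof (rule prod.cong[OF refl])
      fix i assume "i \<in> I"
      have "(\<lambda>\<omega>. (U i \<omega>, V i \<omega>)) -` (C (False, i) \<times> C (True, i)) \<inter> space M
          = (U i -` C (False, i) \<inter> space M) \<inter> (V i -` C (True, i) \<inter> space M)" by auto
      then show "prob ((\<lambda>\<omega>. (U i \<omega>, V i \<omega>)) -` (C (False, i) \<times> C (True, i)) \<inter> space M)
          = prob (U i -` C (False, i) \<inter> space M) * prob (V i -` C (True, i) \<inter> space M)"
        using indep_varD[OF UV[OF \<open>i \<in> I\<close>] C C, of "(False, i)" "(True, i)"]
        by (simp add: Int_commute vimage_Times Int_assoc comp_def) 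
    qed
    also have "\<dots> = (\<Prod>j\<in>UNIV \<times> I. prob (Z j -` C j \<inter> space M))"
    proof -
      have "(\<Prod>j\<in>UNIV \<times> I. prob (Z j -` C j \<inter> space M)) = (\<Prod>b\<in>UNIV. \<Prod>i\<in>I. prob (Z (b, i) -` C (b, i) \<inter> space M))"
        by (subst prod.cartesian_product) (simp add: case_prod_unfold)
      also have "\<dots> = (\<Prod>i\<in>I. prob (U i -` C (False, i) \<inter> space M) * prob (V i -` C (True, i) \<inter> space M))"
        by (simp add: UNIV_bool Z_def prod.distrib mult.commute)
      finally show ?thesis by simp
    qed
    also have "\<dots> = (\<Prod>j\<in>J. prob (A j))"
    proof (rule prod.mono_neutral_cong_right)
      show "\<forall>j\<in>UNIV \<times> I - J. prob (Z j -` C j \<inter> space M) = 1"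
        by (auto simp: C_def prob_space)
    qed (use J \<open>finite I\<close> AC in auto)
    finally show "prob (\<Inter>j\<in>J. A j) = (\<Prod>j\<in>J. prob (A j))" .
  qed
  then have "indep_vars (\<lambda>_. borel) Z (UNIV \<times> I)"
    unfolding indep_vars_def2 using Z_rv by blast
  then show ?thesis unfolding Z_def .
qed

lemma (in prob_space) indep_var_component_vectors:
  fixes U V :: "nat \<Rightarrow> 'a \<Rightarrow> real"
  assumes indep: "indep_vars (\<lambda>_. borel \<Otimes>\<^sub>M borel) (\<lambda>i \<omega>. (U i \<omega>, V i \<omega>)) I" and "finite I"
    and UV: "\<And>i. i \<in> I \<Longrightarrow> indep_var borel (U i) borel (V i)"
  shows "indep_var (PiM I (\<lambda>_. borel)) (\<lambda>\<omega>. \<lambda>i\<in>I. U i \<omega>) (PiM I (\<lambda>_. borel)) (\<lambda>\<omega>. \<lambda>i\<in>I. V i \<omega>)"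
proof -
  let ?Z = "\<lambda>(b, i). if b then V i else U i"
  let ?J = "\<lambda>b::bool. {b} \<times> I"
  let ?r = "\<lambda>b f. \<lambda>i\<in>I. f (b, i)"
  have ind: "indep_var (PiM (?J False) (\<lambda>_. borel)) (\<lambda>\<omega>. restrict (\<lambda>j. ?Z j \<omega>) (?J False))
      (PiM (?J True) (\<lambda>_. borel)) (\<lambda>\<omega>. restrict (\<lambda>j. ?Z j \<omega>) (?J True))"
    by (rule indep_var_restrict[OF indep_vars_components_of_indep_pairs[OF assms]]) auto
  have r: "?r b \<in> measurable (PiM (?J b) (\<lambda>_. borel)) (PiM I (\<lambda>_. borel :: real measure))" for b :: bool
    by (rule measurable_restrict) (auto intro: measurable_component_singleton)
  have "indep_var (PiM I (\<lambda>_. borel)) (?r False \<circ> (\<lambda>\<omega>. restrict (\<lambda>j. ?Z j \<omega>) (?J False)))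
      (PiM I (\<lambda>_. borel)) (?r True \<circ> (\<lambda>\<omega>. restrict (\<lambda>j. ?Z j \<omega>) (?J True)))"
    by (rule indep_var_compose[OF ind r r])
  also have "?r False \<circ> (\<lambda>\<omega>. restrict (\<lambda>j. ?Z j \<omega>) (?J False)) = (\<lambda>\<omega>. \<lambda>i\<in>I. U i \<omega>)"
    by (auto simp: fun_eq_iff restrict_def)
  also have "?r True \<circ> (\<lambda>\<omega>. restrict (\<lambda>j. ?Z j \<omega>) (?J True)) = (\<lambda>\<omega>. \<lambda>i\<in>I. V i \<omega>)"
    by (auto simp: fun_eq_iff restrict_def)
  finally show ?thesis .
qed

lemma increasing_rearrangements_restrict:
  "increasing_rearrangements n (\<lambda>i\<in>{1..n}. x i) = increasing_rearrangements n x"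
proof -
  have "mono_on {1..n} (\<lambda>i. (\<lambda>i\<in>{1..n}. x i) (p i)) \<longleftrightarrow> mono_on {1..n} (\<lambda>i. x (p i))" if "p permutes {1..n}" for p
    using permutes_in_image[OF that] by (auto simp: mono_on_def)
  then show ?thesis unfolding increasing_rearrangements_def by auto
qed

text \<open>The set of increasing rearrangements takes finitely many values, each on a set described by finitely many
  comparisons of coordinates. So every function of it is measurable.\<close>

lemma increasing_rearrangements_measurable:
  "increasing_rearrangements n \<in> measurable (PiM {1..n} (\<lambda>_. borel)) (count_space (Pow {p. p permutes {1..n}}))"
proof -
  let ?Q = "{p. p permutes {1..n}}"
  let ?N = "PiM {1..n} (\<lambda>_. borel :: real measure)"
  define A where "A p = {x \<in> space ?N. mono_on {1..n} (\<lambda>i. x (p i))}" for p :: "nat \<Rightarrow> nat"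
  have fin: "finite ?Q" by (simp add: finite_permutations)
  have A: "A p \<in> sets ?N" if p: "p \<in> ?Q" for p
  proof -
    have m: "(\<lambda>x. x (p i)) \<in> borel_measurable ?N" if "i \<in> {1..n}" for i
      using permutes_in_image[of p "{1..n}" i] p that by (intro measurable_component_singleton) auto
    have "{x \<in> space ?N. \<forall>i\<in>{1..n}. \<forall>j\<in>{1..n}. i \<le> j \<longrightarrow> x (p i) \<le> x (p j)} \<in> sets ?N"
    proof (intro sets.sets_Collect_finite_All)
      fix i j assume "i \<in> {1..n}" "j \<in> {1..n}"
      then have "{x \<in> space ?N. x (p i) \<le> x (p j)} \<in> sets ?N"
        by (intro borel_measurable_le m)
      then show "{x \<in> space ?N. i \<le> j \<longrightarrow> x (p i) \<le> x (p j)} \<in> sets ?N"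
        by (cases "i \<le> j") simp_all
    qed simp_all
    also have "{x \<in> space ?N. \<forall>i\<in>{1..n}. \<forall>j\<in>{1..n}. i \<le> j \<longrightarrow> x (p i) \<le> x (p j)} = A p"
      unfolding A_def mono_on_def by blast
    finally show ?thesis .
  qed
  have incr: "increasing_rearrangements n x = {p \<in> ?Q. x \<in> A p}" if "x \<in> space ?N" for x
    using that by (simp add: A_def increasing_rearrangements_def)
  have pre: "increasing_rearrangements n -` {T} \<inter> space ?N
      = (space ?N - (\<Union>p\<in>T. space ?N - A p)) - (\<Union>p\<in>?Q - T. A p)" if "T \<subseteq> ?Q" for T
  proof -
    have "increasing_rearrangements n x = T \<longleftrightarrow> (\<forall>p\<in>T. x \<in> A p) \<and> (\<forall>p\<in>?Q - T. x \<notin> A p)"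
      if "x \<in> space ?N" for x
      unfolding incr[OF that] using \<open>T \<subseteq> ?Q\<close> by blast
    then show ?thesis by (intro set_eqI) (simp only: vimage_eq Int_iff Diff_iff UN_iff singleton_iff, blast)
  qed
  show ?thesis
  proof (rule measurable_count_space_eq_countable[THEN iffD2], rule countable_finite)
    show "increasing_rearrangements n \<in> space ?N \<rightarrow> Pow ?Q \<and>
        (\<forall>T\<in>Pow ?Q. increasing_rearrangements n -` {T} \<inter> space ?N \<in> sets ?N)"
    proof (intro conjI ballI)
      show "increasing_rearrangements n \<in> space ?N \<rightarrow> Pow ?Q"
        unfolding increasing_rearrangements_def by blast
      fix T assume "T \<in> Pow ?Q"
      then have T: "T \<subseteq> ?Q" by simp
      show "increasing_rearrangements n -` {T} \<inter> space ?N \<in> sets ?N"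
        unfolding pre[OF T]
      proof (intro sets.Diff sets.top sets.finite_UN)
        show "finite T" by (rule finite_subset[OF T fin])
        show "finite (?Q - T)" using fin by (rule finite_Diff)
        show "A p \<in> sets ?N" if "p \<in> T" for p using that T by (intro A) blast
        show "A p \<in> sets ?N" if "p \<in> ?Q - T" for p using that by (intro A) blast
      qed
    qed
  qed (use fin in simp)
qed

text \<open>The conditional law of the permutation given all data is a function of the \<open>X\<close>-sample, so after
  conditioning, the joint probability becomes the expectation of a product of a function of the
  \<open>X\<close>-sample and a function of the \<open>Y\<close>-sample. This factorises; that the first factor is the
  probability of \<open>s = p\<close> is the case of the trivial event for \<open>Y\<close>.\<close>

lemma (in prob_space) uniform_rearrangement_indep:
  fixes Xs Ys :: "nat \<Rightarrow> 'a \<Rightarrow> real" and s :: "'a \<Rightarrow> nat \<Rightarrow> nat" and n :: nat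
  defines "Xv \<equiv> \<lambda>\<omega>. \<lambda>i\<in>{1..n}. Xs i \<omega>" and "Yv \<equiv> \<lambda>\<omega>. \<lambda>i\<in>{1..n}. Ys i \<omega>"
  assumes unif: "uniform_rearrangement M n Xs Ys s"
    and [measurable]: "\<And>i. i \<in> {1..n} \<Longrightarrow> Xs i \<in> borel_measurable M" "\<And>i. i \<in> {1..n} \<Longrightarrow> Ys i \<in> borel_measurable M"
    and indep: "indep_var (PiM {1..n} (\<lambda>_. borel)) Xv (PiM {1..n} (\<lambda>_. borel)) Yv"
    and p: "p permutes {1..n}" and B: "B \<in> sets (PiM {1..n} (\<lambda>_. borel))"
  shows "prob {\<omega> \<in> space M. s \<omega> = p \<and> Yv \<omega> \<in> B} = prob {\<omega> \<in> space M. s \<omega> = p} * prob {\<omega> \<in> space M. Yv \<omega> \<in> B}"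
proof -
  define F where "F = sample_sigma_algebra M n Xs Ys"
  define h where "h x = pmf (pmf_of_set (increasing_rearrangements n x)) p" for x
  let ?PV = "\<lambda>\<omega>. \<lambda>i\<in>{1..n}. (Xs i \<omega>, Ys i \<omega>)"
  let ?\<Pi> = "PiM {1..n} (\<lambda>_. borel \<Otimes>\<^sub>M borel :: (real \<times> real) measure)"
  let ?\<Pi>1 = "PiM {1..n} (\<lambda>_. borel :: real measure)"
  have PV: "?PV \<in> measurable M ?\<Pi>" by measurable
  have subalg: "subalgebra M F"
    unfolding F_def sample_sigma_algebra_def subalgebra_def
    using PV measurable_space[OF PV] by (auto simp: sets_vimage_algebra2 Pi_iff intro: measurable_sets)
  interpret finite_measure_subalgebra M F
    using subalg by unfold_locales
  have PVF: "?PV \<in> measurable F ?\<Pi>"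
    unfolding F_def sample_sigma_algebra_def
    using measurable_space[OF PV] by (intro measurable_vimage_algebra1) auto
  have snd: "(\<lambda>f. \<lambda>i\<in>{1..n}. snd (f i)) \<in> measurable ?\<Pi> ?\<Pi>1" by measurable
  have "(\<lambda>\<omega>. (\<lambda>f. \<lambda>i\<in>{1..n}. snd (f i)) (?PV \<omega>)) \<in> measurable F ?\<Pi>1"
    by (rule measurable_compose[OF PVF snd])
  also have "(\<lambda>\<omega>. (\<lambda>f. \<lambda>i\<in>{1..n}. snd (f i)) (?PV \<omega>)) = Yv"
    by (auto simp: Yv_def fun_eq_iff restrict_def)
  finally have YvF: "Yv \<in> measurable F ?\<Pi>1" .
  have Yv: "Yv \<in> measurable M ?\<Pi>1" unfolding Yv_def by measurable
  have Xv: "Xv \<in> measurable M ?\<Pi>1" unfolding Xv_def by measurable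
  have h: "h \<in> borel_measurable ?\<Pi>1"
  proof -
    have "(\<lambda>T. pmf (pmf_of_set T) p) \<in> borel_measurable (count_space (Pow {p. p permutes {1..n}}))" by simp
    from measurable_compose[OF increasing_rearrangements_measurable this] show ?thesis
      unfolding h_def by simp
  qed
  have s: "s \<in> measurable M (count_space {p. p permutes {1..n}})"
    and cond: "AE \<omega> in M. real_cond_exp M F (indicator {\<omega> \<in> space M. s \<omega> = p}) \<omega> = h (Xv \<omega>)"
    using unif p unfolding uniform_rearrangement_def F_def h_def Xv_def increasing_rearrangements_restrict by blast+
  have sp [measurable]: "{\<omega> \<in> space M. s \<omega> = p} \<in> sets M"
  proof -
    have "s -` {p} \<inter> space M \<in> sets M" using p by (intro measurable_sets[OF s]) simp
    also have "s -` {p} \<inter> space M = {\<omega> \<in> space M. s \<omega> = p}" by auto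
    finally show ?thesis .
  qed
  have main: "prob {\<omega> \<in> space M. s \<omega> = p \<and> Yv \<omega> \<in> B} = (\<integral>\<omega>. h (Xv \<omega>) \<partial>M) * prob {\<omega> \<in> space M. Yv \<omega> \<in> B}"
    if B: "B \<in> sets ?\<Pi>1" for B
  proof -
    let ?I = "\<lambda>\<omega>. indicator B (Yv \<omega>) :: real"
    have I_F: "?I \<in> borel_measurable F" using YvF B by measurable
    have I_M [measurable]: "?I \<in> borel_measurable M" using Yv B by measurable
    have hX [measurable]: "(\<lambda>\<omega>. h (Xv \<omega>)) \<in> borel_measurable M" by (rule measurable_compose[OF Xv h])
    have "prob {\<omega> \<in> space M. s \<omega> = p \<and> Yv \<omega> \<in> B} = (\<integral>\<omega>. indicator {\<omega> \<in> space M. s \<omega> = p \<and> Yv \<omega> \<in> B} \<omega> \<partial>M)"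
      by (simp add: Int_absorb2 subset_eq)
    also have "\<dots> = (\<integral>\<omega>. ?I \<omega> * indicator {\<omega> \<in> space M. s \<omega> = p} \<omega> \<partial>M)"
      by (intro Bochner_Integration.integral_cong) (auto simp: indicator_def)
    also have "\<dots> = (\<integral>\<omega>. ?I \<omega> * real_cond_exp M F (indicator {\<omega> \<in> space M. s \<omega> = p}) \<omega> \<partial>M)"
    proof (rule real_cond_exp_intg(2)[symmetric, OF _ I_F])
      show "integrable M (\<lambda>\<omega>. ?I \<omega> * indicator {\<omega> \<in> space M. s \<omega> = p} \<omega>)"
      proof (rule integrable_bounded[of _ 1])
        show "(\<lambda>\<omega>. ?I \<omega> * indicator {\<omega> \<in> space M. s \<omega> = p} \<omega>) \<in> borel_measurable M"
          by (intro borel_measurable_times I_M borel_measurable_indicator sp)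
      qed (simp split: split_indicator)
    qed (intro borel_measurable_indicator sp)
    also have "\<dots> = (\<integral>\<omega>. h (Xv \<omega>) * ?I \<omega> \<partial>M)"
      using cond by (intro integral_cong_AE) (auto simp: mult.commute)
    also have "\<dots> = (\<integral>\<omega>. h (Xv \<omega>) \<partial>M) * (\<integral>\<omega>. ?I \<omega> \<partial>M)"
    proof (rule indep_var_lebesgue_integral)
      show "indep_var borel (\<lambda>\<omega>. h (Xv \<omega>)) borel ?I"
        using indep_var_compose[OF indep h borel_measurable_indicator[OF B]] by (simp add: comp_def)
      show "integrable M (\<lambda>\<omega>. h (Xv \<omega>))"
        by (rule integrable_bounded[OF hX, of 1]) (simp add: h_def pmf_le_1)
      show "integrable M ?I" by (rule integrable_bounded[OF I_M, of 1]) (simp split: split_indicator)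
    qed
    also have "(\<integral>\<omega>. ?I \<omega> \<partial>M) = prob {\<omega> \<in> space M. Yv \<omega> \<in> B}"
    proof -
      have "(\<integral>\<omega>. ?I \<omega> \<partial>M) = (\<integral>\<omega>. indicator {\<omega> \<in> space M. Yv \<omega> \<in> B} \<omega> \<partial>M)"
        by (intro Bochner_Integration.integral_cong) (auto simp: indicator_def)
      then show ?thesis by (simp add: Int_absorb2 subset_eq)
    qed
    finally show ?thesis .
  qed
  have "{\<omega> \<in> space M. s \<omega> = p \<and> Yv \<omega> \<in> space ?\<Pi>1} = {\<omega> \<in> space M. s \<omega> = p}"
    "{\<omega> \<in> space M. Yv \<omega> \<in> space ?\<Pi>1} = space M"
    using measurable_space[OF Yv] by auto
  with main[OF sets.top] have "prob {\<omega> \<in> space M. s \<omega> = p} = (\<integral>\<omega>. h (Xv \<omega>) \<partial>M)"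
    by (simp add: prob_space)
  with main[OF B] show ?thesis by simp
qed

text \<open>Decompose according to the value of the permutation: given this value, the permuted vector has the
  same product law as the original one.\<close>

lemma (in prob_space) law_rearranged_statistic:
  fixes Ys :: "nat \<Rightarrow> 'a \<Rightarrow> real" and s :: "'a \<Rightarrow> nat \<Rightarrow> nat" and n :: nat
    and f :: "(nat \<Rightarrow> real) \<Rightarrow> real"
  defines "Yv \<equiv> \<lambda>\<omega>. \<lambda>i\<in>{1..n}. Ys i \<omega>"
  assumes N: "real_distribution N"
    and s: "s \<in> measurable M (count_space {p. p permutes {1..n}})"
    and Yv: "Yv \<in> measurable M (PiM {1..n} (\<lambda>_. borel))"
    and law: "distr M (PiM {1..n} (\<lambda>_. borel)) Yv = PiM {1..n} (\<lambda>_. N)"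
    and ind: "\<And>p B. p permutes {1..n} \<Longrightarrow> B \<in> sets (PiM {1..n} (\<lambda>_. borel)) \<Longrightarrow>
      prob {\<omega> \<in> space M. s \<omega> = p \<and> Yv \<omega> \<in> B} = prob {\<omega> \<in> space M. s \<omega> = p} * prob {\<omega> \<in> space M. Yv \<omega> \<in> B}"
    and f: "f \<in> borel_measurable (PiM {1..n} (\<lambda>_. borel))"
  shows "(\<lambda>\<omega>. f (\<lambda>i\<in>{1..n}. Ys (s \<omega> i) \<omega>)) \<in> borel_measurable M" (is "?g \<in> _")
    and "distr M borel (\<lambda>\<omega>. f (\<lambda>i\<in>{1..n}. Ys (s \<omega> i) \<omega>)) = distr (PiM {1..n} (\<lambda>_. N)) borel f"
proof -
  interpret N: real_distribution N by (rule N)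
  let ?B = "PiM {1..n} (\<lambda>_. borel :: real measure)" and ?N = "PiM {1..n} (\<lambda>_. N)"
  let ?Q = "{p. p permutes {1..n}}"
  have setsN: "sets ?N = sets ?B" by (intro sets_PiM_cong refl N.events_eq_borel)
  have spN: "space ?N = space ?B" using setsN by (rule sets_eq_imp_space_eq)
  have fin: "finite ?Q" by (simp add: finite_permutations)
  have fN: "f \<in> borel_measurable ?N" using f setsN by (simp cong: measurable_cong_sets)
  define r where "r p v = (\<lambda>i\<in>{1..n}. v (p i))" for p :: "nat \<Rightarrow> nat" and v :: "nat \<Rightarrow> real"
  have r: "r p \<in> measurable ?B ?B" if "p \<in> ?Q" for p
    unfolding r_def using permutes_in_image[of p "{1..n}"] that
    by (intro measurable_restrict measurable_component_singleton) auto
  \<comment> \<open>The vectors that are mapped into \<open>A\<close> after permutation by \<open>p\<close>.\<close>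
  define D where "D A p = r p -` (f -` A \<inter> space ?B) \<inter> space ?B" for A p
  have D: "D A p \<in> sets ?B" if "A \<in> sets borel" "p \<in> ?Q" for A p
    unfolding D_def by (intro measurable_sets[OF r] measurable_sets[OF f] that)
  have perm_law: "distr ?N ?N (r p) = ?N" if "p \<in> ?Q" for p
    unfolding r_def
    using distr_PiM_reindex[of "{1..n}" "\<lambda>_. N" p "{1..n}"] permutes_inj_on[of p "{1..n}" "{1..n}"]
      permutes_in_image[of p "{1..n}"] that N.prob_space_axioms by simp
  have sY: "{\<omega> \<in> space M. s \<omega> = p \<and> Yv \<omega> \<in> C} \<in> events" if "p \<in> ?Q" "C \<in> sets ?B" for p C
  proof -
    have "s -` {p} \<inter> space M \<in> events" using that by (intro measurable_sets[OF s]) simp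
    moreover have "Yv -` C \<inter> space M \<in> events" by (intro measurable_sets[OF Yv] that)
    moreover have "{\<omega> \<in> space M. s \<omega> = p \<and> Yv \<omega> \<in> C} = (s -` {p} \<inter> space M) \<inter> (Yv -` C \<inter> space M)" by blast
    ultimately show ?thesis by simp
  qed
  have sQ: "s \<omega> \<in> ?Q" if "\<omega> \<in> space M" for \<omega>
    using measurable_space[OF s that] by simp
  have rY: "r p (Yv \<omega>) = (\<lambda>i\<in>{1..n}. Ys (p i) \<omega>)" if "p \<in> ?Q" for p \<omega>
    unfolding r_def Yv_def using permutes_in_image[of p "{1..n}"] that by (auto simp: restrict_def fun_eq_iff)
  have pre: "?g -` A \<inter> space M = (\<Union>p\<in>?Q. {\<omega> \<in> space M. s \<omega> = p \<and> Yv \<omega> \<in> D A p})" for A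
  proof (intro set_eqI)
    fix \<omega>
    have "Yv \<omega> \<in> D A (s \<omega>) \<longleftrightarrow> ?g \<omega> \<in> A" if "\<omega> \<in> space M"
      using measurable_space[OF Yv that] measurable_space[OF r[OF sQ[OF that]]]
      unfolding D_def vimage_eq Int_iff rY[OF sQ[OF that]] by (metis rY[OF sQ[OF that]])
    then show "\<omega> \<in> ?g -` A \<inter> space M \<longleftrightarrow> \<omega> \<in> (\<Union>p\<in>?Q. {\<omega> \<in> space M. s \<omega> = p \<and> Yv \<omega> \<in> D A p})"
      using sQ by blast
  qed
  show g: "?g \<in> borel_measurable M"
  proof (rule measurableI)
    fix A :: "real set" assume "A \<in> sets borel"
    then show "?g -` A \<inter> space M \<in> events"
      unfolding pre using fin D by (intro sets.finite_UN sY) auto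
  qed simp
  show "distr M borel ?g = distr ?N borel f"
  proof (rule measure_eqI)
    interpret PN: prob_space ?N by (intro prob_space_PiM N.prob_space_axioms)
    fix A assume "A \<in> sets (distr M borel ?g)"
    then have A: "A \<in> sets borel" by simp
    have "prob (?g -` A \<inter> space M) = (\<Sum>p\<in>?Q. prob {\<omega> \<in> space M. s \<omega> = p \<and> Yv \<omega> \<in> D A p})"
      unfolding pre using fin sY D[OF A]
      by (intro finite_measure_finite_Union) (auto simp: disjoint_family_on_def)
    also have "\<dots> = (\<Sum>p\<in>?Q. prob {\<omega> \<in> space M. s \<omega> = p} * measure ?N (f -` A \<inter> space ?N))"
    proof (rule sum.cong[OF refl])
      fix p assume p: "p \<in> ?Q"
      have "prob {\<omega> \<in> space M. Yv \<omega> \<in> D A p} = measure (distr M ?B Yv) (D A p)"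
        using D[OF A p] Yv by (subst measure_distr) (auto intro!: arg_cong[of _ _ prob])
      also have "\<dots> = measure ?N (r p -` (f -` A \<inter> space ?N) \<inter> space ?N)"
        unfolding law D_def spN ..
      also have "\<dots> = measure (distr ?N ?N (r p)) (f -` A \<inter> space ?N)"
        using r[OF p] setsN measurable_sets[OF fN A]
        by (subst measure_distr) (simp_all cong: measurable_cong_sets)
      finally have "prob {\<omega> \<in> space M. Yv \<omega> \<in> D A p} = measure ?N (f -` A \<inter> space ?N)"
        unfolding perm_law[OF p] .
      then show "prob {\<omega> \<in> space M. s \<omega> = p \<and> Yv \<omega> \<in> D A p} = prob {\<omega> \<in> space M. s \<omega> = p} * measure ?N (f -` A \<inter> space ?N)"
        using ind[of p "D A p"] p D[OF A p] by simp
    qed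
    also have "\<dots> = (\<Sum>p\<in>?Q. prob {\<omega> \<in> space M. s \<omega> = p}) * measure ?N (f -` A \<inter> space ?N)"
      by (simp add: sum_distrib_right)
    also have "(\<Sum>p\<in>?Q. prob {\<omega> \<in> space M. s \<omega> = p}) = prob (\<Union>p\<in>?Q. {\<omega> \<in> space M. s \<omega> = p})"
    proof (rule finite_measure_finite_Union[symmetric, OF fin])
      show "(\<lambda>p. {\<omega> \<in> space M. s \<omega> = p}) ` ?Q \<subseteq> events"
      proof safe
        fix p assume "p permutes {1..n}"
        then have "s -` {p} \<inter> space M \<in> events" by (intro measurable_sets[OF s]) simp
        moreover have "s -` {p} \<inter> space M = {\<omega> \<in> space M. s \<omega> = p}" by blast
        ultimately show "{\<omega> \<in> space M. s \<omega> = p} \<in> events" by simp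
      qed
    qed (auto simp: disjoint_family_on_def)
    also have "(\<Union>p\<in>?Q. {\<omega> \<in> space M. s \<omega> = p}) = space M" using sQ by blast
    finally have "prob (?g -` A \<inter> space M) = measure ?N (f -` A \<inter> space ?N)"
      by (simp only: prob_space mult_1_left)
    then show "emeasure (distr M borel ?g) A = emeasure (distr ?N borel f) A"
      unfolding emeasure_distr[OF g A] emeasure_distr[OF fN A] emeasure_eq_measure PN.emeasure_eq_measure
      by (rule arg_cong)
  qed simp
qed

lemma (in prob_space) law_iid_vector:
  fixes Ys :: "nat \<Rightarrow> 'a \<Rightarrow> real" and n :: nat
  assumes ind: "indep_vars (\<lambda>_. borel) Ys {1..}"
    and law: "\<And>i. i \<ge> 1 \<Longrightarrow> distr M borel (Ys i) = N" and n: "n \<ge> 1"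
  shows "distr M (PiM {1..n} (\<lambda>_. borel)) (\<lambda>\<omega>. \<lambda>i\<in>{1..n}. Ys i \<omega>) = PiM {1..n} (\<lambda>_. N)"
proof -
  have rv: "random_variable borel (Ys i)" if "i \<in> {1..n}" for i
    using ind that by (simp add: indep_vars_def2)
  have "indep_vars (\<lambda>_. borel) Ys {1..n}" by (rule indep_vars_subset[OF ind]) auto
  then have "distr M (PiM {1..n} (\<lambda>_. borel)) (\<lambda>\<omega>. \<lambda>i\<in>{1..n}. Ys i \<omega>) = PiM {1..n} (\<lambda>i. distr M borel (Ys i))"
    using n rv by (subst indep_vars_iff_distr_eq_PiM'[symmetric]) auto
  also have "\<dots> = PiM {1..n} (\<lambda>_. N)"
    using law by (intro PiM_cong) auto
  finally show ?thesis .
qed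

lemma (in prob_space) expectation_iid_vector:
  fixes Ys :: "nat \<Rightarrow> 'a \<Rightarrow> real" and n :: nat and k :: "(nat \<Rightarrow> real) \<Rightarrow> real"
  assumes N: "sampling N" and Yv: "(\<lambda>\<omega>. \<lambda>i\<in>{1..n}. Ys i \<omega>) \<in> measurable M (PiM {1..n} (\<lambda>_. borel))"
    and law: "distr M (PiM {1..n} (\<lambda>_. borel)) (\<lambda>\<omega>. \<lambda>i\<in>{1..n}. Ys i \<omega>) = PiM {1..n} (\<lambda>_. N)"
    and k: "k \<in> borel_measurable (PiM {1..n} (\<lambda>_. borel))"
  shows "(\<integral>\<omega>. k (\<lambda>i\<in>{1..n}. Ys i \<omega>) \<partial>M) = (\<integral>w. k (restrict w {1..n}) \<partial>sampling.P N)"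
proof -
  interpret S: sampling N by (rule N)
  have sets: "sets (PiM {1..n} (\<lambda>_. N)) = sets (PiM {1..n} (\<lambda>_. borel))"
    by (intro sets_PiM_cong refl S.events_eq_borel)
  have kN: "k \<in> borel_measurable (PiM {1..n} (\<lambda>_. N))"
    using k sets by (simp cong: measurable_cong_sets)
  have "(\<integral>\<omega>. k (\<lambda>i\<in>{1..n}. Ys i \<omega>) \<partial>M) = (\<integral>v. k v \<partial>PiM {1..n} (\<lambda>_. N))"
    unfolding law[symmetric] by (rule integral_distr[symmetric, OF Yv k])
  also have "\<dots> = (\<integral>v. k v \<partial>distr S.P (PiM {1..n} (\<lambda>_. N)) (\<lambda>w. restrict w {1..n}))"
    unfolding S.distr_restrict ..
  also have "\<dots> = (\<integral>w. k (restrict w {1..n}) \<partial>S.P)"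
    by (rule integral_distr[OF S.measurable_restrict_P kN])
  finally show ?thesis .
qed

section \<open>The limit theorem\<close>

theorem theorem2p2:
  fixes M :: "'a measure"
    and X Y :: "'a \<Rightarrow> real"
    and Xs Ys :: "nat \<Rightarrow> 'a \<Rightarrow> real"
    and \<sigma> :: "nat \<Rightarrow> 'a \<Rightarrow> nat \<Rightarrow> nat"
    and c :: "nat \<Rightarrow> real"
  assumes "prob_space M"
    and "X \<in> borel_measurable M" and "Y \<in> borel_measurable M"
    and Y_not_const: "\<not> (\<exists>a. AE \<omega> in M. Y \<omega> = a)"
    and iid_indep: "prob_space.indep_vars M (\<lambda>_. borel \<Otimes>\<^sub>M borel) (\<lambda>i \<omega>. (Xs i \<omega>, Ys i \<omega>)) {1..}"
    and iid_law: "\<And>i. i \<ge> 1 \<Longrightarrow> distr M (borel \<Otimes>\<^sub>M borel) (\<lambda>\<omega>. (Xs i \<omega>, Ys i \<omega>))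
                             = distr M (borel \<Otimes>\<^sub>M borel) (\<lambda>\<omega>. (X \<omega>, Y \<omega>))"
    and tie_breaking: "\<And>n. n \<ge> 2 \<Longrightarrow> uniform_rearrangement M n Xs Ys (\<sigma> n)"
    and XY_indep: "prob_space.indep_var M borel X borel Y"
  shows "weak_conv_m
           (\<lambda>n. distr M borel (\<lambda>\<omega>. sqrt (real n) * xi (c n) n (\<sigma> n \<omega>) (\<lambda>i. Ys i \<omega>)))
           (density lborel (normal_density 0 (sqrt (tau_sq M Y Ys))))
       \<and> tau_sq M Y Ys > 0
       \<and> (continuous_on UNIV (F_of M Y) \<longrightarrow> tau_sq M Y Ys = 2 / 5)"
proof -
  interpret prob_space M by fact
  note X = \<open>X \<in> borel_measurable M\<close> and Y = \<open>Y \<in> borel_measurable M\<close>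
  define N where "N = distr M borel Y"
  have N_dist: "real_distribution N" unfolding N_def by (rule real_distribution_distr[OF Y])
  have N_sampling: "sampling N" using N_dist by (simp add: sampling_def)
  interpret S: sampling N by (rule N_sampling)

  have pair: "(\<lambda>\<omega>. (Xs i \<omega>, Ys i \<omega>)) \<in> measurable M (borel \<Otimes>\<^sub>M borel)" if "i \<ge> 1" for i
    using iid_indep that by (simp add: indep_vars_def2)
  have Xs: "Xs i \<in> borel_measurable M" if "i \<ge> 1" for i
    using measurable_compose[OF pair[OF that] measurable_fst] by simp
  have Ys: "Ys i \<in> borel_measurable M" if "i \<ge> 1" for i
    using measurable_compose[OF pair[OF that] measurable_snd] by simp
  have XY: "(\<lambda>\<omega>. (X \<omega>, Y \<omega>)) \<in> measurable M (borel \<Otimes>\<^sub>M borel)"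
    using X Y by (rule measurable_Pair)
  have Xs_law: "distr M borel (Xs i) = distr M borel X" and Ys_law: "distr M borel (Ys i) = N" if "i \<ge> 1" for i
  proof -
    have "distr (distr M (borel \<Otimes>\<^sub>M borel) (\<lambda>\<omega>. (Xs i \<omega>, Ys i \<omega>))) borel fst
        = distr (distr M (borel \<Otimes>\<^sub>M borel) (\<lambda>\<omega>. (X \<omega>, Y \<omega>))) borel fst"
      unfolding iid_law[OF that] ..
    then show "distr M borel (Xs i) = distr M borel X"
      using pair[OF that] XY by (simp add: distr_distr comp_def)
    have "distr (distr M (borel \<Otimes>\<^sub>M borel) (\<lambda>\<omega>. (Xs i \<omega>, Ys i \<omega>))) borel snd
        = distr (distr M (borel \<Otimes>\<^sub>M borel) (\<lambda>\<omega>. (X \<omega>, Y \<omega>))) borel snd"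
      unfolding iid_law[OF that] ..
    then show "distr M borel (Ys i) = N"
      using pair[OF that] XY by (simp add: distr_distr comp_def N_def)
  qed
  have pair_indep: "indep_var borel (Xs i) borel (Ys i)" if "i \<ge> 1" for i
    using XY_indep Xs[OF that] Ys[OF that]
    unfolding indep_var_distribution_eq Xs_law[OF that] Ys_law[OF that] iid_law[OF that] N_def by simp
  have Ys_indep: "indep_vars (\<lambda>_. borel) Ys {1..}"
    using indep_vars_compose2[OF iid_indep, of "\<lambda>_. snd" "\<lambda>_. borel"] by simp
  have Yv: "(\<lambda>\<omega>. \<lambda>i\<in>{1..n}. Ys i \<omega>) \<in> measurable M (PiM {1..n} (\<lambda>_. borel))" for n
    by (intro measurable_restrict Ys) simp
  have Yv_law: "distr M (PiM {1..n} (\<lambda>_. borel)) (\<lambda>\<omega>. \<lambda>i\<in>{1..n}. Ys i \<omega>) = PiM {1..n} (\<lambda>_. N)" if "n \<ge> 1" for n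
    by (rule law_iid_vector[OF Ys_indep Ys_law that])

  have law: "distr M borel (\<lambda>\<omega>. sqrt (real n) * xi (c n) n (\<sigma> n \<omega>) (\<lambda>i. Ys i \<omega>))
      = distr S.P borel (\<lambda>w. sqrt (real n) * xi (c n) n id w)" if n: "n \<ge> 2" for n
  proof -
    let ?f = "\<lambda>v. sqrt (real n) * xi (c n) n id v"
    let ?B = "PiM {1..n} (\<lambda>_. borel :: real measure)"
    have f: "?f \<in> borel_measurable ?B"
      by (intro borel_measurable_times borel_measurable_const xi_measurable measurable_component_singleton)
    have sets: "sets (PiM {1..n} (\<lambda>_. N)) = sets ?B"
      by (intro sets_PiM_cong refl S.events_eq_borel)
    have fN: "?f \<in> borel_measurable (PiM {1..n} (\<lambda>_. N))"
      using f sets by (simp cong: measurable_cong_sets)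
    have s: "\<sigma> n \<in> measurable M (count_space {p. p permutes {1..n}})"
      using tie_breaking[OF n] by (simp add: uniform_rearrangement_def)
    have n1: "n \<ge> 1" using n by simp
    have vec: "indep_var ?B (\<lambda>\<omega>. \<lambda>i\<in>{1..n}. Xs i \<omega>) ?B (\<lambda>\<omega>. \<lambda>i\<in>{1..n}. Ys i \<omega>)"
      by (intro indep_var_component_vectors pair_indep indep_vars_subset[OF iid_indep]) auto
    have "distr M borel (\<lambda>\<omega>. ?f (\<lambda>i\<in>{1..n}. Ys (\<sigma> n \<omega> i) \<omega>)) = distr (PiM {1..n} (\<lambda>_. N)) borel ?f"
    proof (rule law_rearranged_statistic(2)[OF N_dist s Yv Yv_law[OF n1] _ f])
      fix p B assume "p permutes {1..n}" "B \<in> sets ?B"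
      then show "prob {\<omega> \<in> space M. \<sigma> n \<omega> = p \<and> (\<lambda>i\<in>{1..n}. Ys i \<omega>) \<in> B}
          = prob {\<omega> \<in> space M. \<sigma> n \<omega> = p} * prob {\<omega> \<in> space M. (\<lambda>i\<in>{1..n}. Ys i \<omega>) \<in> B}"
        by (intro uniform_rearrangement_indep[OF tie_breaking[OF n] _ _ vec] Xs Ys) auto
    qed
    also have "distr (PiM {1..n} (\<lambda>_. N)) borel ?f = distr S.P borel (\<lambda>w. ?f (restrict w {1..n}))"
      by (subst S.distr_restrict[symmetric], subst distr_distr[OF fN S.measurable_restrict_P]) (simp add: comp_def)
    finally show ?thesis
      unfolding xi_restrict by (subst xi_permute)
  qed

  have F: "F_of M Y t = S.F t" for t
    unfolding F_of_def S.F_def unfolding N_def by (subst measure_distr[OF Y]) (auto intro!: arg_cong[of _ _ prob])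
  have G: "G_of M Y t = S.G t" for t
    unfolding G_of_def S.G_def unfolding N_def by (subst measure_distr[OF Y]) (auto intro!: arg_cong[of _ _ prob])
  have phi: "phi M Y x y = S.\<phi> x y" for x y
    by (simp add: phi_def S.\<phi>_def F)
  have expectation3: "(\<integral>\<omega>. h (Ys 1 \<omega>) (Ys 2 \<omega>) (Ys 3 \<omega>) \<partial>M) = (\<integral>w. h (w 1) (w 2) (w 3) \<partial>S.P)"
    if h: "(\<lambda>(x, y, z). h x y z) \<in> borel_measurable (borel \<Otimes>\<^sub>M borel \<Otimes>\<^sub>M borel)" for h :: "real \<Rightarrow> real \<Rightarrow> real \<Rightarrow> real"
  proof -
    have "(\<lambda>v. (v 1, v 2, v 3)) \<in> measurable (PiM {1..3::nat} (\<lambda>_. borel :: real measure)) (borel \<Otimes>\<^sub>M borel \<Otimes>\<^sub>M borel)"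
      by (intro measurable_Pair measurable_component_singleton) auto
    from measurable_compose[OF this h]
    have "(\<lambda>v. h (v 1) (v 2) (v 3)) \<in> borel_measurable (PiM {1..3::nat} (\<lambda>_. borel))" by simp
    from expectation_iid_vector[OF N_sampling Yv Yv_law this] show ?thesis by simp
  qed
  have "(\<integral>\<omega>. (phi M Y (Ys 1 \<omega>) (Ys 2 \<omega>))\<^sup>2 \<partial>M) = (\<integral>w. (S.\<phi> (w 1) (w 2))\<^sup>2 \<partial>S.P)"
    unfolding phi by (rule expectation3[of "\<lambda>x y z. (S.\<phi> x y)\<^sup>2"]) measurable
  moreover have "(\<integral>\<omega>. phi M Y (Ys 1 \<omega>) (Ys 2 \<omega>) * phi M Y (Ys 1 \<omega>) (Ys 3 \<omega>) \<partial>M)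
      = (\<integral>w. S.\<phi> (w 1) (w 2) * S.\<phi> (w 1) (w 3) \<partial>S.P)"
    unfolding phi by (rule expectation3[of "\<lambda>x y z. S.\<phi> x y * S.\<phi> x z"]) measurable
  moreover have "(\<integral>\<omega>. phi M Y (Ys 1 \<omega>) (Ys 2 \<omega>) \<partial>M) = (\<integral>w. S.\<phi> (w 1) (w 2) \<partial>S.P)"
    unfolding phi by (rule expectation3[of "\<lambda>x y z. S.\<phi> x y"]) measurable
  moreover have "(\<integral>\<omega>. G_of M Y (Y \<omega>) * (1 - G_of M Y (Y \<omega>)) \<partial>M) = S.den_limit"
  proof -
    have "(\<lambda>z. S.G z * (1 - S.G z)) \<in> borel_measurable borel" by measurable
    from integral_distr[OF Y this] show ?thesis unfolding G S.den_limit_def N_def[symmetric] by (rule sym)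
  qed
  ultimately have tau: "tau_sq M Y Ys = S.kernel_variance / S.den_limit\<^sup>2"
    unfolding tau_sq_def S.kernel_variance_eq by simp

  have nondeg: "\<not> (\<exists>a. AE x in N. x = a)"
    using Y_not_const Y unfolding N_def by (subst AE_distr_iff) auto
  note den_limit_pos = S.den_limit_pos[OF nondeg] and kernel_variance_pos = S.kernel_variance_pos[OF nondeg]
  have "weak_conv_m (\<lambda>n. distr M borel (\<lambda>\<omega>. sqrt (real n) * xi (c n) n (\<sigma> n \<omega>) (\<lambda>i. Ys i \<omega>)))
      (density lborel (normal_density 0 (sqrt (tau_sq M Y Ys))))"
    unfolding weak_conv_m_def weak_conv_def
  proof (intro allI impI)
    fix x assume x: "isCont (cdf (density lborel (normal_density 0 (sqrt (tau_sq M Y Ys))))) x"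
    have "(\<lambda>n. cdf (distr S.P borel (\<lambda>w. sqrt (real n) * xi (c n) n id w)) x)
        \<longlonglongrightarrow> cdf (density lborel (normal_density 0 (sqrt (tau_sq M Y Ys)))) x"
      using S.xi_clt[OF den_limit_pos kernel_variance_pos, of c] x unfolding tau weak_conv_m_def weak_conv_def by simp
    \<comment> \<open>Nothing is known about \<open>\<sigma> 0\<close> and \<open>\<sigma> 1\<close>, but two terms do not influence the limit.\<close>
    moreover have "\<forall>\<^sub>F n in sequentially. cdf (distr S.P borel (\<lambda>w. sqrt (real n) * xi (c n) n id w)) x
        = cdf (distr M borel (\<lambda>\<omega>. sqrt (real n) * xi (c n) n (\<sigma> n \<omega>) (\<lambda>i. Ys i \<omega>))) x"
      using eventually_ge_at_top[of 2] by eventually_elim (simp only: law)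
    ultimately show "(\<lambda>n. cdf (distr M borel (\<lambda>\<omega>. sqrt (real n) * xi (c n) n (\<sigma> n \<omega>) (\<lambda>i. Ys i \<omega>))) x)
        \<longlonglongrightarrow> cdf (density lborel (normal_density 0 (sqrt (tau_sq M Y Ys)))) x"
      by (rule Lim_transform_eventually)
  qed
  moreover have "tau_sq M Y Ys > 0" unfolding tau using den_limit_pos kernel_variance_pos by simp
  moreover have "tau_sq M Y Ys = 2 / 5" if "continuous_on UNIV (F_of M Y)"
  proof -
    have "continuous_on UNIV S.F" using that F by (simp add: fun_eq_iff[symmetric] F_of_def[abs_def] S.F_def[abs_def])
    from S.continuous_case[OF this] show ?thesis unfolding tau by (simp only:) (simp add: power2_eq_square)
  qed
  ultimately show ?thesis by blast
qed

end
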